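(* Let $X_1,\dots,X_n$ be i.i.d. with density $f$ with respect to $\mu$, and consider testing $H_0: f\in\{g_\theta:\theta\in\Theta\}$ against $H_1: f\in\{h_\gamma:\gamma\in\Gamma\}$ by the generalized likelihood ratio test with rejection region $C_\lambda=\{(x_1,\dots,x_n): LR_n>\lambda\}$, where $$LR_n=\frac{\max_{\gamma\in\Gamma}\prod_{i=1}^n h_\gamma(X_i)}{\max_{\theta\in\Theta}\prod_{i=1}^n g_\theta(X_i)}.$$ Assume conditions A1, A2, A3 (listed in the context) and take $\lambda=1$. Then, as $n\to\infty$, $$\sup_{\theta\in\Theta}\log P_{g_\theta}(C_1)\ \sim\ \sup_{\gamma\in\Gamma}\log P_{h_\gamma}(C_1^c)\ \sim\ -n\times\min_{\theta\in\Theta,\gamma\in\Gamma}\rho_{\theta\gamma},$$ where $\rho_{\theta\gamma}$ is the Chernoff index between $g_\theta$ and $h_\gamma$.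
   Context: Setting: $\{g_\theta:\theta\in\Theta\}$ and $\{h_\gamma:\gamma\in\Gamma\}$ are two parametric families of probability densities on $\mathbb{R}$ with respect to a common baseline measure $\mu$; all distributions in the two families are mutually absolutely continuous. $P_f$ and $E_f$ denote probability and expectation when $X,X_1,X_2,\dots$ are i.i.d. with density $f$. Notation: $a_n\sim b_n$ means $a_n/b_n\to1$ as $n\to\infty$. Chernoff index: for densities $g,h$ let $l=\log h(X)-\log g(X)$, $M_g(z)=E_g(e^{zl})=\int (h/g)^z g\,d\mu$, $m_g(t)=\max_z[zt-\log M_g(z)]$. Switching the roles of $g$ and $h$, let $M_h(z)=E_h[e^{z(\log g(X)-\log h(X))}]$ and $m_h(t)=\max_z[zt-\log M_h(z)]$. The Chernoff index between $g$ and $h$ is $\rho=\max_{E_g(l)<t<E_h(l)}\min\{m_g(t),m_h(-t)\}$; it is attained at $t=0$ and equals $\max_z[-\log M_g(z)]$. $\rho_{\theta\gamma}$ is this quantity for $g=g_\theta$, $h=h_\gamma$. Conditions: A1 (complete separation): $\min_{\theta\in\Theta,\gamma\in\Gamma}E_{g_\theta}\{\log g_\theta(X)-\log h_\gamma(X)\}>0$. A2: $\Theta\subset\mathbb{R}^{d_g}$ and $\Gamma\subset\mathbb{R}^{d_h}$ are compact with continuously differentiable boundaries $\partial\Theta$, $\partial\Gamma$. A3: with $l_{\theta\gamma}=\log h_\gamma(X)-\log g_\theta(X)$ (differentiable in $\theta$ and $\gamma$), $S_1=\sup_{\theta,\gamma}|\nabla_\theta l_{\theta\gamma}|$ and $S_2=\sup_{\theta,\gamma}|\nabla_\gamma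 l_{\theta\gamma}|$, there exist $\eta,x_0>0$, independent of $\theta$ and $\gamma$, such that for all $x>x_0$ and $i=1,2$, $\sup_{\theta\in\Theta,\gamma\in\Gamma}\max\{P_{g_\theta}(S_i>x),P_{h_\gamma}(S_i>x)\}\le e^{-(\log x)^{1+\eta}}$. *)

theory Defs
  imports "HOL-Probability.Probability" "HOL-Library.Landau_Symbols"
begin

section \<open>Densities, expectations, log-likelihood ratios\<close>

abbreviation law :: "real measure \<Rightarrow> (real \<Rightarrow> real) \<Rightarrow> real measure" where
  "law M f \<equiv> density M (\<lambda>x. ennreal (f x))"

definition prob_density :: "real measure \<Rightarrow> (real \<Rightarrow> real) \<Rightarrow> bool" where
  "prob_density M f \<longleftrightarrow>
     f \<in> borel_measurable M \<and> (\<forall>x. 0 \<le> f x) \<and> prob_space (law M f)"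

text \<open>Expectation with values in the extended reals. The log-likelihood ratios below are always
  quasi-integrable, but they need not be integrable, and the Bochner integral would then be \<open>0\<close>.\<close>

definition ext_expectation :: "real measure \<Rightarrow> (real \<Rightarrow> real) \<Rightarrow> ereal" where
  "ext_expectation P f =
     enn2ereal (\<integral>\<^sup>+x. ennreal (f x) \<partial>P) - enn2ereal (\<integral>\<^sup>+x. ennreal (- f x) \<partial>P)"

definition llr :: "(real \<Rightarrow> real) \<Rightarrow> (real \<Rightarrow> real) \<Rightarrow> real \<Rightarrow> real" where
  "llr g h x = ln (h x) - ln (g x)"


section \<open>The Chernoff index\<close>

definition elog :: "ennreal \<Rightarrow> ereal" where
  "elog u = (if u = 0 then -\<infinity> else if u = \<infinity> then \<infinity> else ereal (ln (enn2real u)))"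

text \<open>The moment generating function of \<open>llr g h\<close> under \<open>g\<close>; it may be infinite outside \<open>[0, 1]\<close>.\<close>

definition llr_mgf :: "real measure \<Rightarrow> (real \<Rightarrow> real) \<Rightarrow> (real \<Rightarrow> real) \<Rightarrow> real \<Rightarrow> ennreal" where
  "llr_mgf M g h z = (\<integral>\<^sup>+x. ennreal (exp (z * llr g h x)) \<partial>law M g)"

definition rate_function :: "real measure \<Rightarrow> (real \<Rightarrow> real) \<Rightarrow> (real \<Rightarrow> real) \<Rightarrow> real \<Rightarrow> ereal" where
  "rate_function M g h t = (SUP z::real. ereal (z * t) - elog (llr_mgf M g h z))"

definition chernoff_index :: "real measure \<Rightarrow> (real \<Rightarrow> real) \<Rightarrow> (real \<Rightarrow> real) \<Rightarrow> ereal" where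
  "chernoff_index M g h =
     (SUP t\<in>{t::real. ext_expectation (law M g) (llr g h) < ereal t \<and>
                      ereal t < ext_expectation (law M h) (llr g h)}.
        min (rate_function M g h t) (rate_function M h g (- t)))"


section \<open>Regularity of the parameter sets and of the families\<close>

text \<open>Near each of its boundary points, the set is the region on one side of a level set of a
  continuously differentiable function with nonvanishing gradient. In particular a singleton or a
  lower-dimensional surface does not qualify.\<close>

definition C1_boundary :: "'a::euclidean_space set \<Rightarrow> bool" where
  "C1_boundary S \<longleftrightarrow>
     (\<forall>p\<in>frontier S. \<exists>r>0. \<exists>(\<phi>::'a \<Rightarrow> real) (\<phi>'::'a \<Rightarrow> 'a).
        (\<forall>y\<in>ball p r. (\<phi> has_derivative (\<lambda>v. \<phi>' y \<bullet> v)) (at y) \<and> \<phi>' y \<noteq> 0) \<and>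
        continuous_on (ball p r) \<phi>' \<and>
        S \<inter> ball p r = {y\<in>ball p r. \<phi> y \<le> 0})"

text \<open>Derivatives are taken within the parameter set, so that boundary points are covered; within a
  closed set with \<open>C1_boundary\<close> the gradient is unique.\<close>

definition gradient_within :: "'a::euclidean_space set \<Rightarrow> ('a \<Rightarrow> real) \<Rightarrow> 'a \<Rightarrow> 'a" where
  "gradient_within S f p = (THE D. (f has_derivative (\<lambda>v. D \<bullet> v)) (at p within S))"

definition score_sup1 ::
  "'a::euclidean_space set \<Rightarrow> 'b::euclidean_space set \<Rightarrow> ('a \<Rightarrow> real \<Rightarrow> real) \<Rightarrow> ('b \<Rightarrow> real \<Rightarrow> real)
     \<Rightarrow> real \<Rightarrow> ereal" where
  "score_sup1 \<Theta> \<Gamma> g h x =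
     (SUP \<theta>\<in>\<Theta>. SUP \<gamma>\<in>\<Gamma>. ereal (norm (gradient_within \<Theta> (\<lambda>t. llr (g t) (h \<gamma>) x) \<theta>)))"

definition score_sup2 ::
  "'a::euclidean_space set \<Rightarrow> 'b::euclidean_space set \<Rightarrow> ('a \<Rightarrow> real \<Rightarrow> real) \<Rightarrow> ('b \<Rightarrow> real \<Rightarrow> real)
     \<Rightarrow> real \<Rightarrow> ereal" where
  "score_sup2 \<Theta> \<Gamma> g h x =
     (SUP \<theta>\<in>\<Theta>. SUP \<gamma>\<in>\<Gamma>. ereal (norm (gradient_within \<Gamma> (\<lambda>c. llr (g \<theta>) (h c) x) \<gamma>)))"

text \<open>Almost surely, all log-likelihood ratios are defined (every density is positive at the
  observation) and differentiable in both parameters. The exceptional null set does not depend on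
  the parameters, since the suprema above range over all of them at once.\<close>

definition differentiable_llr ::
  "real measure \<Rightarrow> 'a::euclidean_space set \<Rightarrow> 'b::euclidean_space set \<Rightarrow>
     ('a \<Rightarrow> real \<Rightarrow> real) \<Rightarrow> ('b \<Rightarrow> real \<Rightarrow> real) \<Rightarrow> (real \<Rightarrow> real) \<Rightarrow> bool" where
  "differentiable_llr M \<Theta> \<Gamma> g h f \<longleftrightarrow>
     (AE x in law M f. \<forall>\<theta>\<in>\<Theta>. \<forall>\<gamma>\<in>\<Gamma>. 0 < g \<theta> x \<and> 0 < h \<gamma> x \<and>
        (\<lambda>t. llr (g t) (h \<gamma>) x) differentiable (at \<theta> within \<Theta>) \<and>
        (\<lambda>c. llr (g \<theta>) (h c) x) differentiable (at \<gamma> within \<Gamma>))"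

text \<open>Suprema over uncountable parameter sets of functions that are regular only almost surely are
  measurable only up to null sets; probabilities of events built from them are therefore taken in
  the completion.\<close>

definition score_tail_bound ::
  "real measure \<Rightarrow> (real \<Rightarrow> real) \<Rightarrow> (real \<Rightarrow> ereal) \<Rightarrow> real \<Rightarrow> real \<Rightarrow> bool" where
  "score_tail_bound M f S \<eta> x0 \<longleftrightarrow>
     S \<in> borel_measurable (completion (law M f)) \<and>
     (\<forall>x>x0. measure (completion (law M f)) {y\<in>space M. ereal x < S y}
               \<le> exp (- (ln x powr (1 + \<eta>))))"

definition score_tails ::
  "real measure \<Rightarrow> 'a::euclidean_space set \<Rightarrow> 'b::euclidean_space set \<Rightarrow>
     ('a \<Rightarrow> real \<Rightarrow> real) \<Rightarrow> ('b \<Rightarrow> real \<Rightarrow> real) \<Rightarrow> bool" where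
  "score_tails M \<Theta> \<Gamma> g h \<longleftrightarrow>
     (\<exists>\<eta>>0. \<exists>x0>0. \<forall>S\<in>{score_sup1 \<Theta> \<Gamma> g h, score_sup2 \<Theta> \<Gamma> g h}. \<forall>\<theta>\<in>\<Theta>. \<forall>\<gamma>\<in>\<Gamma>.
        score_tail_bound M (g \<theta>) S \<eta> x0 \<and> score_tail_bound M (h \<gamma>) S \<eta> x0)"


section \<open>The generalized likelihood ratio test\<close>

definition samples :: "real measure \<Rightarrow> nat \<Rightarrow> (nat \<Rightarrow> real) set" where
  "samples M n = space (\<Pi>\<^sub>M i\<in>{..<n}. M)"

text \<open>The statement applies \<open>ln\<close> to these probabilities. The convention \<open>ln 0 = 0\<close> is harmless: under
  mutual absolute continuity an event has probability zero under all members of the two families or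
  under none, and the error events in question have positive probability for all large \<open>n\<close>.\<close>

definition iid_prob :: "real measure \<Rightarrow> (real \<Rightarrow> real) \<Rightarrow> nat \<Rightarrow> (nat \<Rightarrow> real) set \<Rightarrow> real" where
  "iid_prob M f n A = measure (completion (\<Pi>\<^sub>M i\<in>{..<n}. law M f)) A"

definition gen_likelihood_ratio ::
  "'a set \<Rightarrow> 'b set \<Rightarrow> ('a \<Rightarrow> real \<Rightarrow> real) \<Rightarrow> ('b \<Rightarrow> real \<Rightarrow> real) \<Rightarrow> nat \<Rightarrow> (nat \<Rightarrow> real) \<Rightarrow> real" where
  "gen_likelihood_ratio \<Theta> \<Gamma> g h n X =
     (SUP \<gamma>\<in>\<Gamma>. \<Prod>i<n. h \<gamma> (X i)) / (SUP \<theta>\<in>\<Theta>. \<Prod>i<n. g \<theta> (X i))"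

definition rejection_region ::
  "real measure \<Rightarrow> 'a set \<Rightarrow> 'b set \<Rightarrow> ('a \<Rightarrow> real \<Rightarrow> real) \<Rightarrow> ('b \<Rightarrow> real \<Rightarrow> real) \<Rightarrow> nat \<Rightarrow> real
     \<Rightarrow> (nat \<Rightarrow> real) set" where
  "rejection_region M \<Theta> \<Gamma> g h n c = {X\<in>samples M n. gen_likelihood_ratio \<Theta> \<Gamma> g h n X > c}"

end

theory Submission
  imports Defs "HOL-Real_Asymp.Real_Asymp"
begin

text \<open>
Upper bound: if the test errs under \<open>g \<theta>\<close>, then some \<open>h \<gamma>\<close> has a likelihood at least that of \<open>g \<theta>\<close>.
A union bound over a net of subexponential cardinality and Chernoff's inequality for each net
point show that this has probability at most \<open>exp (- n (\<rho> - \<epsilon>))\<close>, uniformly in \<open>\<theta>\<close>, where \<open>\<rho>\<close> is the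
minimal Chernoff index; the score tails control the discretization. Exchanging the families
bounds the error of the second kind.

Lower bound: let \<open>g\<close> and \<open>h\<close> be a pair attaining \<open>\<rho>\<close>, tilt by \<open>exp (z L)\<close>, where \<open>L\<close> is the
log-likelihood ratio of the sample, and take \<open>z\<close> slightly larger than the minimizer of the moment generating
function. The tilted measure concentrates on \<open>n a \<le> L \<le> n b\<close> with \<open>0 < a\<close> and \<open>b\<close> small. There acceptance has
negligible tilted mass, because the error under \<open>h\<close> is already known to be at most about \<open>exp (- n \<rho>)\<close>.
So the tilted mass lies in the rejection region, and \<open>L \<le> n b\<close> transfers this back to \<open>g\<close> at the
cost of a factor \<open>exp (n b)\<close>. No law of large numbers uniform in the parameters is needed.
\<close>

section \<open>Sets with continuously differentiable boundary\<close>

text \<open>The scores bound derivatives at points of the parameter set, while a net needs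
  increments between neighbours. Near the boundary the segment joining two neighbours may leave the
  set, so increments are summed along short detours through the interior; this is where the smooth
  boundary enters.

  In the lower bound, a tilt exactly at the minimizer would give \<open>L\<close> zero drift.
  Acceptance could then be bounded only by \<open>exp (- n (\<rho> - e))\<close> with small
  \<open>e > 0\<close>, which exceeds the tilted mass. A strictly positive \<open>a\<close>
  contributes a further factor \<open>exp (- n (1 - z) a)\<close>, and this beats every sufficiently
  small \<open>e\<close>.

  Log-likelihood ratios need not be integrable. All arguments therefore use exponents in
  \<open>[0, 1]\<close>, where the moment generating function is always finite and where one minus
  its value is the integral of a nonnegative function. The latter also gives attainment of the
  minimal index: densities converge only pointwise along a sequence of parameters, but Fatou's lemma
  needs no majorant.\<close>

lemma segment_mean_value:
  fixes f :: "'a::euclidean_space \<Rightarrow> real"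
  assumes cont: "continuous_on (closed_segment x y) f"
    and deriv: "\<And>p. p \<in> open_segment x y \<Longrightarrow> (f has_derivative (\<lambda>v. D p \<bullet> v)) (at p)"
    and "x \<noteq> y"
  shows "\<exists>p\<in>open_segment x y. f y - f x = D p \<bullet> (y - x)"
proof -
  define c where "c = (\<lambda>t::real. x + t *\<^sub>R (y - x))"
  have c_alt: "c t = (1 - t) *\<^sub>R x + t *\<^sub>R y" for t
    by (simp add: c_def algebra_simps)
  have c_open: "c t \<in> open_segment x y" if "0 < t" "t < 1" for t
    using that \<open>x \<noteq> y\<close> by (auto simp: c_alt in_segment)
  have c_closed: "c t \<in> closed_segment x y" if "0 \<le> t" "t \<le> 1" for t
    using that by (auto simp: c_alt in_segment)
  have "continuous_on {0..1} (f \<circ> c)"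
    by (intro continuous_on_compose continuous_on_subset[OF cont])
      (auto simp: c_def[abs_def] intro!: continuous_intros c_closed[unfolded c_def])
  moreover have "((f \<circ> c) has_derivative (\<lambda>s. D (c t) \<bullet> (s *\<^sub>R (y - x)))) (at t)"
    if "0 < t" "t < 1" for t
  proof -
    have "(c has_derivative (\<lambda>s. s *\<^sub>R (y - x))) (at t)"
      unfolding c_def by (auto intro!: derivative_eq_intros)
    from diff_chain_at[OF this deriv[OF c_open[OF that]]] show ?thesis
      by (simp add: o_def)
  qed
  ultimately obtain t where t: "0 < t" "t < 1"
    "(f \<circ> c) 1 - (f \<circ> c) 0 = D (c t) \<bullet> ((1 - 0) *\<^sub>R (y - x))"
    using mvt[of 0 1 "f \<circ> c" "\<lambda>t s. D (c t) \<bullet> (s *\<^sub>R (y - x))"] by auto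
  then show ?thesis
    using c_open[of t] by (intro bexI[of _ "c t"]) (auto simp: c_def)
qed

text \<open>\<open>gradient_within\<close> is a definite description, meaningful only where a
  gradient exists and is unique. At an interior point the derivative is a full one: the Riesz vector
  built from \<open>Basis\<close> represents it, and uniqueness of derivatives identifies the
  description with it.\<close>

lemma gradient_within_interior:
  fixes f :: "'a::euclidean_space \<Rightarrow> real"
  assumes "f differentiable (at p within S)" "p \<in> interior S"
  shows "(f has_derivative (\<lambda>v. gradient_within S f p \<bullet> v)) (at p)"
proof -
  have at: "at p within S = at p"
    using assms(2) by (rule at_within_interior)
  obtain f' where f': "(f has_derivative f') (at p)"
    using assms(1) unfolding at differentiable_def by auto
  define D where "D = (\<Sum>b\<in>Basis. f' b *\<^sub>R b)"
  interpret linear f'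
    using f' by (rule has_derivative_linear)
  have "f' v = D \<bullet> v" for v
  proof -
    have "f' v = f' (\<Sum>b\<in>Basis. (v \<bullet> b) *\<^sub>R b)"
      by (simp add: euclidean_representation)
    also have "\<dots> = (\<Sum>b\<in>Basis. (v \<bullet> b) * f' b)"
      by (simp add: sum scale)
    also have "\<dots> = D \<bullet> v"
      by (simp add: D_def inner_sum_left mult.commute inner_commute[of v])
    finally show ?thesis .
  qed
  then have "f' = (\<lambda>v. D \<bullet> v)"
    by (rule ext)
  with f' have D: "(f has_derivative (\<lambda>v. D \<bullet> v)) (at p)"
    by simp
  have "gradient_within S f p = D"
    unfolding gradient_within_def at
  proof (rule the_equality)
    fix E assume "(f has_derivative (\<lambda>v. E \<bullet> v)) (at p)"
    from has_derivative_unique[OF this D] have "E \<bullet> v = D \<bullet> v" for v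
      by (rule fun_cong)
    then show "E = D"
      by - (rule euclidean_eqI, simp)
  qed (rule D)
  with D show ?thesis by simp
qed

text \<open>The end points may lie on the boundary. Differentiability within \<open>S\<close> still
  gives continuity there, and the mean value theorem evaluates the gradient only inside the segment,
  hence in the interior.\<close>

lemma segment_lipschitz:
  fixes f :: "'a::euclidean_space \<Rightarrow> real"
  assumes diff: "\<And>p. p \<in> S \<Longrightarrow> f differentiable (at p within S)"
    and bound: "\<And>p. p \<in> S \<Longrightarrow> norm (gradient_within S f p) \<le> B"
    and "x \<in> S" "y \<in> S" and open_seg: "open_segment x y \<subseteq> interior S"
  shows "\<bar>f x - f y\<bar> \<le> B * dist x y"
proof (cases "x = y")
  case False
  have "continuous_on S f"
    using diff by (intro differentiable_imp_continuous_on) (auto simp: differentiable_on_def)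
  moreover have "closed_segment x y \<subseteq> S"
    using assms(3,4) open_seg interior_subset[of S] by (auto simp: closed_segment_eq_open)
  ultimately have cont: "continuous_on (closed_segment x y) f"
    by (rule continuous_on_subset)
  have "\<exists>p\<in>open_segment x y. f y - f x = gradient_within S f p \<bullet> (y - x)"
    using cont _ False
  proof (rule segment_mean_value)
    fix p assume "p \<in> open_segment x y"
    with open_seg interior_subset[of S] show "(f has_derivative (\<lambda>v. gradient_within S f p \<bullet> v)) (at p)"
      by (intro gradient_within_interior diff) auto
  qed
  then obtain p where p: "p \<in> open_segment x y" "f y - f x = gradient_within S f p \<bullet> (y - x)"
    by blast
  have "\<bar>f y - f x\<bar> \<le> norm (gradient_within S f p) * norm (y - x)"
    unfolding p(2) by (rule Cauchy_Schwarz_ineq2)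
  also have "\<dots> \<le> B * norm (y - x)"
    using p(1) open_seg interior_subset[of S] by (intro mult_right_mono bound) auto
  finally show ?thesis
    by (simp add: dist_norm norm_minus_commute abs_minus_commute)
qed simp

text \<open>The detour of the path into the region, along the inner normal at a nearby boundary point, has
  to be long enough (four times the distance) to stay inside while moving parallel to the boundary.\<close>

lemma C1_boundary_detour:
  fixes S :: "'a::euclidean_space set"
  assumes "closed S" "C1_boundary S" "p \<in> S"
  obtains r where "r > 0"
    "\<And>x y. x \<in> S \<inter> ball p r \<Longrightarrow> y \<in> S \<inter> ball p r \<Longrightarrow> x \<noteq> y \<Longrightarrow> \<exists>a\<in>S. \<exists>b\<in>S.
       open_segment x a \<subseteq> interior S \<and> open_segment a b \<subseteq> interior S \<and> open_segment b y \<subseteq> interior S \<and>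
       dist x a + dist a b + dist b y \<le> 9 * dist x y"
proof (cases "p \<in> frontier S")
  case False
  then have "p \<in> interior S"
    using \<open>p \<in> S\<close> \<open>closed S\<close> by (auto simp: frontier_def)
  then obtain r where r: "r > 0" "ball p r \<subseteq> interior S"
    using open_contains_ball[of "interior S"] by auto
  show thesis
  proof (rule that[OF r(1)])
    fix x y assume xy: "x \<in> S \<inter> ball p r" "y \<in> S \<inter> ball p r"
    then have "open_segment x y \<subseteq> ball p r"
      using closed_segment_subset[of x "ball p r" y] by (auto simp: open_segment_def)
    with xy r(2) show "\<exists>a\<in>S. \<exists>b\<in>S. open_segment x a \<subseteq> interior S \<and> open_segment a b \<subseteq> interior S \<and>
        open_segment b y \<subseteq> interior S \<and> dist x a + dist a b + dist b y \<le> 9 * dist x y"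
      by (intro bexI[of _ x] bexI[of _ y]) auto
  qed
next
  case True
  with assms(2) have "\<exists>r>0. \<exists>(\<phi>::'a \<Rightarrow> real) \<phi>'.
        (\<forall>y\<in>ball p r. (\<phi> has_derivative (\<lambda>v. \<phi>' y \<bullet> v)) (at y) \<and> \<phi>' y \<noteq> 0) \<and>
        continuous_on (ball p r) \<phi>' \<and> S \<inter> ball p r = {y\<in>ball p r. \<phi> y \<le> 0}"
    unfolding C1_boundary_def by (rule bspec)
  then obtain R \<phi> \<phi>' where R: "R > 0"
    and \<phi>: "\<And>y. y \<in> ball p R \<Longrightarrow> (\<phi> has_derivative (\<lambda>v. \<phi>' y \<bullet> v)) (at y)" "\<And>y. y \<in> ball p R \<Longrightarrow> \<phi>' y \<noteq> 0"
    and cont: "continuous_on (ball p R) \<phi>'"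
    and S: "S \<inter> ball p R = {y\<in>ball p R. \<phi> y \<le> 0}"
    by blast
  define N where "N = \<phi>' p"
  define c where "c = norm N"
  have "c > 0"
    using \<phi>(2)[of p] R by (simp add: c_def N_def)
  \<comment> \<open>The inside is \<open>\<phi> \<le> 0\<close>, so the gradient points outwards and
    \<open>u\<close> is the inner unit normal at \<open>p\<close>.\<close>
  define u where "u = - (1 / c) *\<^sub>R N"
  have norm_u: "norm u = 1" and N_u: "N \<bullet> u = - c"
    using \<open>c > 0\<close> by (auto simp: u_def c_def power2_norm_eq_inner[symmetric] power2_eq_square)
  have "isCont \<phi>' p"
    using cont R by (simp add: continuous_on_eq_continuous_at)
  then have "\<forall>e>0. \<exists>d>0. \<forall>y. dist y p < d \<longrightarrow> dist (\<phi>' y) N < e"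
    unfolding continuous_at_eps_delta N_def .
  \<comment> \<open>On this ball the gradient differs from \<open>N\<close> by less than
    \<open>c / 2\<close>, so a move by \<open>t\<close> along \<open>u\<close> lowers
    \<open>\<phi>\<close> by at least \<open>t * c / 2\<close>.\<close>
  then obtain r0 where r0: "r0 > 0" "\<And>y. dist y p < r0 \<Longrightarrow> dist (\<phi>' y) N < c / 2"
    using \<open>c > 0\<close> half_gt_zero by blast
  define r1 where "r1 = min R r0"
  have r1: "r1 > 0" "ball p r1 \<subseteq> ball p R"
    using R r0 by (auto simp: r1_def)
  have near: "norm (\<phi>' y - N) < c / 2" if "y \<in> ball p r1" for y
    using r0(2)[of y] that by (auto simp: r1_def dist_norm dist_commute norm_minus_commute)
  have cont_\<phi>: "continuous_on (ball p r1) \<phi>"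
    using r1(2) by (intro has_derivative_continuous_on[of _ _ "\<lambda>y v. \<phi>' y \<bullet> v"]
      has_derivative_at_withinI[OF \<phi>(1)]) auto
  have step: "\<phi> y - \<phi> x \<le> N \<bullet> (y - x) + c / 2 * norm (y - x)"
    if x: "x \<in> ball p r1" and y: "y \<in> ball p r1" for x y
  proof (cases "x = y")
    case False
    have seg: "closed_segment x y \<subseteq> ball p r1"
      using x y by (simp add: closed_segment_subset)
    have "\<exists>q\<in>open_segment x y. \<phi> y - \<phi> x = \<phi>' q \<bullet> (y - x)"
    proof (rule segment_mean_value)
      show "continuous_on (closed_segment x y) \<phi>"
        using cont_\<phi> seg by (rule continuous_on_subset)
      fix q assume "q \<in> open_segment x y"
      then have "q \<in> ball p R"
        using seg r1(2) open_closed_segment by blast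
      then show "(\<phi> has_derivative (\<lambda>v. \<phi>' q \<bullet> v)) (at q)"
        by (rule \<phi>(1))
    qed (rule False)
    then obtain q where q: "q \<in> open_segment x y" "\<phi> y - \<phi> x = \<phi>' q \<bullet> (y - x)" by blast
    have "(\<phi>' q - N) \<bullet> (y - x) \<le> norm (\<phi>' q - N) * norm (y - x)"
      by (rule norm_cauchy_schwarz)
    also have "\<dots> \<le> c / 2 * norm (y - x)"
      using near[of q] q(1) seg open_closed_segment[of q x y] by (intro mult_right_mono) (auto intro: less_imp_le)
    finally show ?thesis
      by (simp add: q(2) inner_diff_left)
  qed simp
  have inner_pt: "y \<in> interior S" if "y \<in> ball p r1" "\<phi> y < 0" for y
  proof (rule interiorI[of "\<phi> -` {..<0} \<inter> ball p r1"])
    show "open (\<phi> -` {..<0} \<inter> ball p r1)"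
      using cont_\<phi> continuous_on_open_vimage[OF open_ball] open_lessThan by blast
    show "\<phi> -` {..<0} \<inter> ball p r1 \<subseteq> S"
      using S r1(2) by force
  qed (use that in auto)
  have up: "\<phi> (x + t *\<^sub>R u) < 0" "\<phi> (x + t *\<^sub>R u) \<le> - (t * c / 2)"
    if "x \<in> S" "x \<in> ball p r1" "x + t *\<^sub>R u \<in> ball p r1" "t > 0" for x t
  proof -
    have "\<phi> x \<le> 0" using S that r1(2) by auto
    moreover have "\<phi> (x + t *\<^sub>R u) - \<phi> x \<le> - (t * c) + c / 2 * t"
      using step[OF that(2,3)] that(4) by (simp add: N_u norm_u)
    ultimately show "\<phi> (x + t *\<^sub>R u) \<le> - (t * c / 2)"
      by (simp add: mult.commute)
    also have "\<dots> < 0"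
      using that(4) \<open>c > 0\<close> by simp
    finally show "\<phi> (x + t *\<^sub>R u) < 0" .
  qed
  show thesis
  proof (rule that[of "r1 / 10"])
    show "r1 / 10 > 0" using r1 by simp
    fix x y assume x: "x \<in> S \<inter> ball p (r1 / 10)" and y: "y \<in> S \<inter> ball p (r1 / 10)" and "x \<noteq> y"
    \<comment> \<open>Since \<open>d < r1 / 5\<close>, going a further \<open>4 * d\<close> from a
      point of the small ball stays within \<open>9 / 10 * r1\<close> of \<open>p\<close>. The three
      legs have lengths \<open>4 * d\<close>, \<open>d\<close> and \<open>4 * d\<close>, hence the
      factor 9.\<close>
    define d where "d = dist x y"
    have d: "d > 0" "d < r1 / 5"
      using \<open>x \<noteq> y\<close> x y dist_triangle3[of x y p] by (auto simp: d_def)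
    define a where "a = x + (4 * d) *\<^sub>R u"
    define b where "b = y + (4 * d) *\<^sub>R u"
    have in_ball: "q + t *\<^sub>R u \<in> ball p r1" if "q \<in> ball p (r1 / 10)" "0 \<le> t" "t \<le> 4 * d" for q t
    proof -
      have "dist p (q + t *\<^sub>R u) \<le> dist p q + dist q (q + t *\<^sub>R u)"
        by (rule dist_triangle)
      also have "dist q (q + t *\<^sub>R u) = t"
        using that norm_u by (simp add: dist_norm)
      finally show ?thesis
        using that d by auto
    qed
    have vert: "open_segment q (q + (4 * d) *\<^sub>R u) \<subseteq> interior S" "q + (4 * d) *\<^sub>R u \<in> interior S"
      if q: "q \<in> S \<inter> ball p (r1 / 10)" for q
    proof -
      have in_S: "q + t *\<^sub>R u \<in> interior S" if "0 < t" "t \<le> 4 * d" for t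
        using that q in_ball[of q t] in_ball[of q 0] d by (intro inner_pt up) auto
      then show "q + (4 * d) *\<^sub>R u \<in> interior S"
        using d by simp
      show "open_segment q (q + (4 * d) *\<^sub>R u) \<subseteq> interior S"
      proof
        fix w assume "w \<in> open_segment q (q + (4 * d) *\<^sub>R u)"
        then obtain s where s: "0 < s" "s < 1" "w = (1 - s) *\<^sub>R q + s *\<^sub>R (q + (4 * d) *\<^sub>R u)"
          by (auto simp: in_segment)
        then have "w = q + (s * (4 * d)) *\<^sub>R u"
          by (simp add: algebra_simps)
        then show "w \<in> interior S"
          using in_S[of "s * (4 * d)"] s d by simp
      qed
    qed
    \<comment> \<open>At \<open>a\<close> the value of \<open>\<phi>\<close> is at most
      \<open>- 2 * d * c\<close>. A move of length at most \<open>d\<close> raises it by at most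
      \<open>c * d + c / 2 * d\<close>, so it stays negative; any factor above 3 in place of 4 would
      do.\<close>
    have "open_segment a b \<subseteq> interior S"
    proof
      fix w assume "w \<in> open_segment a b"
      then obtain s where s: "0 < s" "s < 1" "w = (1 - s) *\<^sub>R a + s *\<^sub>R b"
        by (auto simp: in_segment)
      then have w: "w = a + s *\<^sub>R (y - x)"
        by (simp add: a_def b_def algebra_simps)
      have a: "a \<in> ball p r1" and b: "b \<in> ball p r1"
        using in_ball[of x "4 * d"] in_ball[of y "4 * d"] x y d by (auto simp: a_def b_def)
      then have w_in: "w \<in> ball p r1"
        using \<open>w \<in> open_segment a b\<close> closed_segment_subset[of a "ball p r1" b] open_closed_segment
        by (metis convex_ball subsetD)
      have "\<phi> a \<le> - (2 * d * c)"
        using up(2)[of x "4 * d"] x d a in_ball[of x 0] by (simp add: a_def mult.commute mult.left_commute)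
      moreover have "\<phi> w - \<phi> a \<le> N \<bullet> (s *\<^sub>R (y - x)) + c / 2 * norm (s *\<^sub>R (y - x))"
        using step[OF a w_in] by (simp add: w)
      moreover have "N \<bullet> (s *\<^sub>R (y - x)) \<le> c * norm (s *\<^sub>R (y - x))"
        unfolding c_def by (rule norm_cauchy_schwarz)
      moreover have "norm (s *\<^sub>R (y - x)) \<le> d"
        using s d mult_right_mono[of s 1 d] by (simp add: d_def dist_norm norm_minus_commute)
      then have "3 / 2 * c * norm (s *\<^sub>R (y - x)) \<le> 3 / 2 * c * d"
        using \<open>c > 0\<close> by (intro mult_left_mono) auto
      moreover have "0 < c * d"
        using \<open>c > 0\<close> d by simp
      ultimately have "\<phi> w < 0"
        by (simp add: algebra_simps)
      then show "w \<in> interior S"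
        using w_in by (rule inner_pt[rotated])
    qed
    moreover have "dist x a = 4 * d" "dist b y = 4 * d" "dist a b = d"
      using norm_u d by (auto simp: a_def b_def dist_norm d_def)
    ultimately show "\<exists>a\<in>S. \<exists>b\<in>S. open_segment x a \<subseteq> interior S \<and> open_segment a b \<subseteq> interior S \<and>
        open_segment b y \<subseteq> interior S \<and> dist x a + dist a b + dist b y \<le> 9 * dist x y"
      using vert[OF x] vert[OF y] interior_subset[of S]
      by (intro bexI[of _ a] bexI[of _ b]) (auto simp: a_def b_def d_def open_segment_commute)
  qed
qed

text \<open>The radius is a Lebesgue number of the cover by the local balls. It depends on
  \<open>S\<close> alone and is fixed before \<open>f\<close>, so it serves the log-likelihood
  ratios of all observations at once. Distant points cannot be compared this way, as
  \<open>S\<close> may be disconnected.\<close>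

proposition C1_boundary_uniform_lipschitz:
  fixes S :: "'a::euclidean_space set"
  assumes "compact S" "C1_boundary S"
  obtains r where "r > 0"
    "\<And>(f::'a \<Rightarrow> real) B x y. \<lbrakk>\<And>p. p \<in> S \<Longrightarrow> f differentiable (at p within S);
       \<And>p. p \<in> S \<Longrightarrow> norm (gradient_within S f p) \<le> B; x \<in> S; y \<in> S; dist x y < r\<rbrakk>
       \<Longrightarrow> \<bar>f x - f y\<bar> \<le> 9 * B * dist x y"
proof -
  define good where "good p r \<longleftrightarrow> r > 0 \<and> (\<forall>x y. x \<in> S \<inter> ball p r \<longrightarrow> y \<in> S \<inter> ball p r \<longrightarrow> x \<noteq> y \<longrightarrow>
      (\<exists>a\<in>S. \<exists>b\<in>S. open_segment x a \<subseteq> interior S \<and> open_segment a b \<subseteq> interior S \<and> open_segment b y \<subseteq> interior S \<and>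
       dist x a + dist a b + dist b y \<le> 9 * dist x y))" for p r
  have "\<exists>r. good p r" if "p \<in> S" for p
    using C1_boundary_detour[OF compact_imp_closed[OF assms(1)] assms(2) that] unfolding good_def by metis
  then obtain R where R: "\<And>p. p \<in> S \<Longrightarrow> good p (R p)"
    by metis
  obtain r where r: "r > 0" "\<And>x. x \<in> S \<Longrightarrow> \<exists>G\<in>(\<lambda>p. ball p (R p)) ` S. ball x r \<subseteq> G"
  proof (rule Heine_Borel_lemma[OF assms(1), of "(\<lambda>p. ball p (R p)) ` S"])
    show "S \<subseteq> \<Union>((\<lambda>p. ball p (R p)) ` S)"
      using R by (auto simp: good_def intro!: bexI)
  qed auto
  show thesis
  proof (rule that[OF r(1)])
    fix f :: "'a \<Rightarrow> real" and B x y
    assume f: "\<And>p. p \<in> S \<Longrightarrow> f differentiable (at p within S)" "\<And>p. p \<in> S \<Longrightarrow> norm (gradient_within S f p) \<le> B"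
      and xy: "x \<in> S" "y \<in> S" "dist x y < r"
    have B: "B \<ge> 0"
      using f(2)[OF xy(1)] norm_ge_zero order_trans by blast
    show "\<bar>f x - f y\<bar> \<le> 9 * B * dist x y"
    proof (cases "x = y")
      case False
      obtain p where "p \<in> S" "ball x r \<subseteq> ball p (R p)"
        using r(2)[OF xy(1)] by auto
      moreover have "x \<in> ball x r" "y \<in> ball x r"
        using xy r(1) by auto
      ultimately have "x \<in> S \<inter> ball p (R p)" "y \<in> S \<inter> ball p (R p)"
        using xy by blast+
      with R[OF \<open>p \<in> S\<close>] False obtain a b where ab: "a \<in> S" "b \<in> S" "open_segment x a \<subseteq> interior S"
        "open_segment a b \<subseteq> interior S" "open_segment b y \<subseteq> interior S"
        "dist x a + dist a b + dist b y \<le> 9 * dist x y"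
        unfolding good_def by metis
      have "\<bar>f x - f y\<bar> \<le> \<bar>f x - f a\<bar> + \<bar>f a - f b\<bar> + \<bar>f b - f y\<bar>"
        by simp
      also have "\<dots> \<le> B * dist x a + B * dist a b + B * dist b y"
        by (intro add_mono segment_lipschitz[where S = S] f ab xy)
      also have "\<dots> \<le> B * (9 * dist x y)"
        unfolding distrib_left[symmetric] using ab(6) B by (rule mult_left_mono)
      finally show ?thesis by simp
    qed simp
  qed
qed

section \<open>Exponential tilting\<close>

abbreviation iid :: "'a measure \<Rightarrow> nat \<Rightarrow> (nat \<Rightarrow> 'a) measure" where
  "iid P n \<equiv> \<Pi>\<^sub>M i\<in>{..<n}. P"

text \<open>One majorant for all exponents in \<open>[0, 1]\<close>, integrable as soon as
  \<open>exp (l x)\<close> is.\<close>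

lemma exp_le_one_plus_exp:
  assumes "0 \<le> z" "z \<le> (1::real)"
  shows "exp (z * y) \<le> 1 + exp y"
proof (cases "y \<ge> 0")
  case True
  then have "exp (z * y) \<le> exp y"
    using assms mult_right_mono[of z 1 y] by simp
  then show ?thesis by (simp add: add_increasing)
next
  case False
  then have "exp (z * y) \<le> 1"
    using assms by (simp add: mult_nonneg_nonpos)
  then show ?thesis by (simp add: add_increasing2)
qed

lemma abs_le_exp: "\<bar>y\<bar> \<le> exp \<bar>y::real\<bar>"
  using exp_ge_add_one_self[of "\<bar>y\<bar>"] by linarith

text \<open>The explicit remainder replaces differentiation of the moment generating function under
  the integral sign.\<close>

lemma exp_second_order: "exp y \<le> 1 + y + y\<^sup>2 * exp \<bar>y::real\<bar>"
proof -
  obtain t where t: "\<bar>t\<bar> \<le> \<bar>y\<bar>" "exp y = (\<Sum>m<2. y ^ m / fact m) + exp t / fact 2 * y ^ 2"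
    using Maclaurin_exp_le[of y 2] by blast
  have "exp t / 2 * y\<^sup>2 \<le> exp \<bar>y\<bar> * y\<^sup>2"
  proof (rule mult_right_mono)
    have "exp t \<le> exp \<bar>y\<bar>"
      using t(1) by simp
    moreover have "exp t / 2 \<le> exp t"
      by simp
    ultimately show "exp t / 2 \<le> exp \<bar>y\<bar>"
      by linarith
  qed simp
  then show ?thesis
    unfolding t(2) by (simp add: numeral_2_eq_2 mult.commute)
qed

text \<open>\<open>exp (l x)\<close> is the density of the alternative with respect to
  \<open>P\<close>. This normalization makes the moment generating function finite on
  \<open>[0, 1]\<close> with value 1 at both ends, whatever the moments of \<open>l\<close>.\<close>

locale likelihood_tilting = prob_space P for P :: "'a measure" +
  fixes l :: "'a \<Rightarrow> real"
  assumes l_measurable [measurable]: "l \<in> borel_measurable P"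
    and integrable_exp_l: "integrable P (\<lambda>x. exp (l x))"
    and integral_exp_l: "(\<integral>x. exp (l x) \<partial>P) = 1"
begin

definition alt :: "'a measure" where "alt = density P (\<lambda>x. ennreal (exp (l x)))"

definition mgf :: "real \<Rightarrow> real" where "mgf z = (\<integral>x. exp (z * l x) \<partial>P)"

lemma prob_space_alt: "prob_space alt"
proof
  have "(\<integral>\<^sup>+x. ennreal (exp (l x)) \<partial>P) = 1"
    using integrable_exp_l integral_exp_l by (subst nn_integral_eq_integral) auto
  then show "emeasure alt (space alt) = 1"
    by (simp add: alt_def emeasure_density cong: nn_integral_cong)
qed

lemma sets_alt [measurable_cong, simp]: "sets alt = sets P"
  by (simp add: alt_def)

sublocale iid_P: product_prob_space "\<lambda>_. P" "{..<n}" for n :: nat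
  by (intro product_prob_spaceI prob_space_axioms)

sublocale iid_alt: product_prob_space "\<lambda>_. alt" "{..<n}" for n :: nat
  by (intro product_prob_spaceI prob_space_alt)

text \<open>Both sides agree on rectangles, where the likelihood factors over the
  coordinates.\<close>

lemma iid_alt_eq: "iid alt n = density (iid P n) (\<lambda>X. ennreal (exp (\<Sum>i<n. l (X i))))"
proof (rule iid_alt.PiM_eqI[symmetric])
  fix A :: "nat \<Rightarrow> 'a set" assume "\<And>i. i \<in> {..<n} \<Longrightarrow> A i \<in> sets alt"
  then have A [measurable]: "\<And>i. i \<in> {..<n} \<Longrightarrow> A i \<in> sets P"
    by simp
  have "emeasure (density (iid P n) (\<lambda>X. ennreal (exp (\<Sum>i<n. l (X i))))) (Pi\<^sub>E {..<n} A)
     = (\<integral>\<^sup>+X. ennreal (exp (\<Sum>i<n. l (X i))) * indicator (Pi\<^sub>E {..<n} A) X \<partial>iid P n)"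
    by (intro emeasure_density) auto
  also have "\<dots> = (\<integral>\<^sup>+X. (\<Prod>i<n. ennreal (exp (l (X i))) * indicator (A i) (X i)) \<partial>iid P n)"
  proof (rule nn_integral_cong)
    fix X assume "X \<in> space (iid P n)"
    then have "X \<in> extensional {..<n}"
      by (auto simp: space_PiM PiE_def)
    then have "indicator (Pi\<^sub>E {..<n} A) X = (\<Prod>i<n. indicator (A i) (X i) :: ennreal)"
      by (cases "X \<in> Pi\<^sub>E {..<n} A")
        (auto simp: PiE_def Pi_iff prod.neutral prod_zero_iff indicator_def)
    then show "ennreal (exp (\<Sum>i<n. l (X i))) * indicator (Pi\<^sub>E {..<n} A) X
        = (\<Prod>i<n. ennreal (exp (l (X i))) * indicator (A i) (X i))"
      by (simp add: prod.distrib exp_sum prod_ennreal)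
  qed
  also have "\<dots> = (\<Prod>i<n. \<integral>\<^sup>+x. ennreal (exp (l x)) * indicator (A i) x \<partial>P)"
    by (rule iid_P.product_nn_integral_prod) auto
  also have "\<dots> = (\<Prod>i<n. emeasure alt (A i))"
    by (intro prod.cong) (auto simp: alt_def emeasure_density)
  finally show "emeasure (density (iid P n) (\<lambda>X. ennreal (exp (\<Sum>i<n. l (X i))))) (Pi\<^sub>E {..<n} A)
     = (\<Prod>i<n. emeasure alt (A i))" .
qed (auto intro!: sets_PiM_cong)

lemma sets_iid_alt: "sets (iid alt n) = sets (iid P n)"
  by (intro sets_PiM_cong) auto

lemma integrable_exp: "0 \<le> z \<Longrightarrow> z \<le> 1 \<Longrightarrow> integrable P (\<lambda>x. exp (z * l x))"
  by (rule Bochner_Integration.integrable_bound[of _ "\<lambda>x. 1 + exp (l x)"])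
    (auto intro!: Bochner_Integration.integrable_add integrable_exp_l exp_le_one_plus_exp AE_I2
      simp: abs_of_nonneg add_nonneg_nonneg)

lemma mgf_0 [simp]: "mgf 0 = 1" and mgf_1 [simp]: "mgf 1 = 1"
  by (simp_all add: mgf_def prob_space integral_exp_l)

lemma mgf_pos: "0 \<le> z \<Longrightarrow> z \<le> 1 \<Longrightarrow> 0 < mgf z"
proof -
  assume z: "0 \<le> z" "z \<le> 1"
  have "mgf z \<noteq> 0"
    unfolding mgf_def using z by (subst integral_nonneg_eq_0_iff_AE) (auto intro: integrable_exp)
  moreover have "mgf z \<ge> 0"
    unfolding mgf_def by (intro integral_nonneg_AE) auto
  ultimately show ?thesis by simp
qed

lemma continuous_on_mgf: "continuous_on {0..1} mgf"
  unfolding continuous_on_sequentially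
proof safe
  fix u :: "nat \<Rightarrow> real" and z assume u: "\<forall>n. u n \<in> {0..1}" "z \<in> {0..1}" "u \<longlonglongrightarrow> z"
  have "(\<lambda>n. \<integral>x. exp (u n * l x) \<partial>P) \<longlonglongrightarrow> (\<integral>x. exp (z * l x) \<partial>P)"
  proof (rule integral_dominated_convergence[where w = "\<lambda>x. 1 + exp (l x)"])
    show "AE x in P. (\<lambda>n. exp (u n * l x)) \<longlonglongrightarrow> exp (z * l x)"
      by (intro AE_I2 tendsto_intros u(3))
    show "AE x in P. norm (exp (u n * l x)) \<le> 1 + exp (l x)" for n
      using u(1) by (intro AE_I2) (auto intro: exp_le_one_plus_exp)
  qed (auto intro!: Bochner_Integration.integrable_add integrable_exp_l)
  then show "(mgf \<circ> u) \<longlonglongrightarrow> mgf z"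
    by (simp add: mgf_def o_def)
qed

section \<open>Error probabilities of an i.i.d. sample: Chernoff's inequality and its
  converse\<close>

lemma iid_exp_sum:
  assumes "0 \<le> z" "z \<le> 1"
  shows "integrable (iid P n) (\<lambda>X. exp (z * (\<Sum>i<n. l (X i))))"
    and "(\<integral>X. exp (z * (\<Sum>i<n. l (X i))) \<partial>iid P n) = mgf z ^ n"
proof -
  have eq: "exp (z * (\<Sum>i<n. l (X i))) = (\<Prod>i<n. exp (z * l (X i)))" for X
    by (simp add: exp_sum sum_distrib_left)
  show "integrable (iid P n) (\<lambda>X. exp (z * (\<Sum>i<n. l (X i))))"
    unfolding eq using assms by (intro iid_P.product_integrable_prod integrable_exp) auto
  show "(\<integral>X. exp (z * (\<Sum>i<n. l (X i))) \<partial>iid P n) = mgf z ^ n"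
    unfolding eq using assms
    by (subst iid_P.product_integral_prod) (auto intro: integrable_exp simp: mgf_def)
qed

text \<open>Markov's inequality for \<open>exp (z * L)\<close>. The slack \<open>a\<close> is room
  for replacing a parameter by a nearby net point.\<close>

lemma chernoff_bound:
  assumes "0 \<le> z" "z \<le> 1"
  shows "measure (iid P n) {X\<in>space (iid P n). - a \<le> (\<Sum>i<n. l (X i))} \<le> exp (z * a) * mgf z ^ n"
proof -
  have "measure (iid P n) {X\<in>space (iid P n). - a \<le> (\<Sum>i<n. l (X i))}
      \<le> measure (iid P n) {X\<in>space (iid P n). exp (- z * a) \<le> exp (z * (\<Sum>i<n. l (X i)))}"
    using assms mult_left_mono[of "- a" _ z]
    by (intro iid_P.finite_measure_mono) auto
  also have "\<dots> \<le> (\<integral>X. exp (z * (\<Sum>i<n. l (X i))) \<partial>iid P n) / exp (- z * a)"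
    using assms by (intro integral_Markov_inequality_measure[where A = "{}"] iid_exp_sum) auto
  also have "\<dots> = exp (z * a) * mgf z ^ n"
    using assms by (simp add: iid_exp_sum exp_minus field_simps)
  finally show ?thesis .
qed

text \<open>\<open>mgf z ^ n\<close> is the total mass of \<open>exp (z * L)\<close>. Where
  \<open>L\<close> is small, this is compared with the exponent \<open>z0\<close>, where
  \<open>L\<close> is large with \<open>z2\<close>, on the rest of \<open>C\<close> with a constant,
  and on the rest of the complement with \<open>exp L\<close>, the density of the alternative. Upper
  bounds for the other three terms thus force \<open>C\<close> to have mass.\<close>

lemma error_tradeoff:
  assumes z: "0 \<le> z0" "z0 \<le> z" "z \<le> z2" "z2 \<le> 1" and C [measurable]: "C \<in> sets (iid P n)"
  shows "mgf z ^ n \<le> exp (n * ((z - z0) * a)) * mgf z0 ^ n + exp (- (n * ((z2 - z) * b))) * mgf z2 ^ n +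
    exp (n * (z * b)) * measure (iid P n) C +
    exp (- (n * ((1 - z) * a))) * measure (iid alt n) (space (iid P n) - C)"
proof -
  define L where "L = (\<lambda>X::nat \<Rightarrow> 'a. \<Sum>i<n. l (X i))"
  have L [measurable]: "L \<in> borel_measurable (iid P n)"
    unfolding L_def by measurable
  have int_exp: "integrable (iid P n) (\<lambda>X. exp (t * L X))" "(\<integral>X. exp (t * L X) \<partial>iid P n) = mgf t ^ n"
    if "0 \<le> t" "t \<le> 1" for t
    using iid_exp_sum[OF that] by (simp_all add: L_def)
  define D where "D = space (iid P n) - C"
  have D [measurable]: "D \<in> sets (iid P n)"
    unfolding D_def by measurable
  have alt_D: "measure (iid alt n) D = (\<integral>X. exp (L X) * indicator D X \<partial>iid P n)"
  proof -
    have "measure (iid alt n) D = (\<integral>X. indicator D X \<partial>iid alt n)"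
      using D sets.sets_into_space[of D "iid alt n"] by (simp add: sets_iid_alt Int_absorb2)
    also have "\<dots> = (\<integral>X. exp (L X) * indicator D X \<partial>iid P n)"
      unfolding iid_alt_eq L_def by (subst integral_density) auto
    finally show ?thesis .
  qed
  have int_D: "integrable (iid P n) (\<lambda>X. exp (L X) * indicator D X)"
    using int_exp(1)[of 1] by (intro integrable_real_mult_indicator) auto
  define U1 where "U1 X = exp (n * ((z - z0) * a)) * exp (z0 * L X)" for X
  define U2 where "U2 X = exp (- (n * ((z2 - z) * b))) * exp (z2 * L X)" for X
  define U3 where "U3 X = exp (n * (z * b)) * indicator C X" for X
  define U4 where "U4 X = exp (- (n * ((1 - z) * a))) * (exp (L X) * indicator D X)" for X
  have nonneg: "0 \<le> U1 X" "0 \<le> U2 X" "0 \<le> U3 X" "0 \<le> U4 X" for X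
    by (simp_all add: U1_def U2_def U3_def U4_def)
  have "exp (z * L X) \<le> U1 X + U2 X + U3 X + U4 X" if X: "X \<in> space (iid P n)" for X
  proof -
    \<comment> \<open>The cases may overlap, and no order between \<open>a\<close> and
      \<open>b\<close> is assumed: in each case one of the four nonnegative summands
      dominates.\<close>
    consider "L X < n * a" | "L X > n * b" | "L X \<le> n * b" "X \<in> C" | "L X \<ge> n * a" "X \<in> D"
      using X by (force simp: D_def)
    then show ?thesis
    proof cases
      case 1
      have "z * L X \<le> n * ((z - z0) * a) + z0 * L X"
        using z 1 mult_left_mono[of "L X" "n * a" "z - z0"] by (simp add: algebra_simps)
      then have "exp (z * L X) \<le> exp (n * ((z - z0) * a)) * exp (z0 * L X)"
        by (simp add: exp_add[symmetric])
      then show ?thesis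
        using nonneg[of X] unfolding U1_def[symmetric] by linarith
    next
      case 2
      have "z * L X \<le> - (n * ((z2 - z) * b)) + z2 * L X"
        using z 2 mult_left_mono[of "n * b" "L X" "z2 - z"] by (simp add: algebra_simps)
      then have "exp (z * L X) \<le> exp (- (n * ((z2 - z) * b))) * exp (z2 * L X)"
        by (simp add: exp_add[symmetric])
      then show ?thesis
        using nonneg[of X] unfolding U2_def[symmetric] by linarith
    next
      case 3
      have "exp (z * L X) \<le> exp (n * (z * b))"
        using z 3 mult_left_mono[of "L X" "n * b" "z"] by (simp add: algebra_simps)
      then have "exp (z * L X) \<le> U3 X"
        using 3 by (simp add: U3_def)
      then show ?thesis
        using nonneg[of X] by linarith
    next
      case 4
      have "z * L X \<le> - (n * ((1 - z) * a)) + L X"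
        using z 4 mult_left_mono[of "n * a" "L X" "1 - z"] by (simp add: algebra_simps)
      then have "exp (z * L X) \<le> exp (- (n * ((1 - z) * a))) * exp (L X)"
        by (simp add: exp_add[symmetric])
      then have "exp (z * L X) \<le> U4 X"
        using 4 by (simp add: U4_def)
      then show ?thesis
        using nonneg[of X] by linarith
    qed
  qed
  moreover have int: "integrable (iid P n) U1" "integrable (iid P n) U2" "integrable (iid P n) U3"
      "integrable (iid P n) U4"
    unfolding U1_def U2_def U3_def U4_def using z
    by (auto intro!: integrable_mult_right int_exp int_D integrable_real_indicator simp: less_top[symmetric])
  ultimately have "(\<integral>X. exp (z * L X) \<partial>iid P n) \<le> (\<integral>X. U1 X + U2 X + U3 X + U4 X \<partial>iid P n)"
    using z by (intro integral_mono Bochner_Integration.integrable_add int_exp) auto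
  also have "\<dots> = (\<integral>X. U1 X \<partial>iid P n) + (\<integral>X. U2 X \<partial>iid P n) + (\<integral>X. U3 X \<partial>iid P n) + (\<integral>X. U4 X \<partial>iid P n)"
    using int by simp
  also have "\<dots> = exp (n * ((z - z0) * a)) * mgf z0 ^ n + exp (- (n * ((z2 - z) * b))) * mgf z2 ^ n +
    exp (n * (z * b)) * measure (iid P n) C + exp (- (n * ((1 - z) * a))) * measure (iid alt n) D"
    unfolding U1_def U2_def U3_def U4_def using z
    by (simp add: int_exp alt_D sets.sets_into_space[OF C] Int_absorb2)
  finally have "(\<integral>X. exp (z * L X) \<partial>iid P n) \<le> \<dots>" .
  then show ?thesis
    using z by (simp add: int_exp D_def)
qed

text \<open>At an interior minimum the linear term of the second order expansion vanishes.\<close>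

lemma mgf_quadratic_at_minimum:
  assumes z0: "0 < z0" "z0 < 1" and min: "\<And>z. 0 \<le> z \<Longrightarrow> z \<le> 1 \<Longrightarrow> mgf z0 \<le> mgf z"
  obtains \<delta> c where "\<delta> > 0" "c > 0" "z0 + \<delta> \<le> 1" "\<And>s. 0 \<le> s \<Longrightarrow> s \<le> \<delta> \<Longrightarrow> mgf (z0 + s) \<le> mgf z0 + c * s\<^sup>2"
proof -
  \<comment> \<open>\<open>3 * \<delta>\<close> has to fit between \<open>z0\<close> and either end
    of \<open>[0, 1]\<close>: two \<open>\<delta>\<close> pay for \<open>y ^ 2\<close>, as
    \<open>\<delta> * \<bar>y\<bar> \<le> exp (\<delta> * \<bar>y\<bar>)\<close>, and one for the
    factor \<open>exp \<bar>s * y\<bar>\<close> of the remainder.\<close>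
  define \<delta> where "\<delta> = min z0 (1 - z0) / 3"
  have \<delta>: "\<delta> > 0" "3 * \<delta> \<le> z0" "z0 + 3 * \<delta> \<le> 1"
    using z0 by (auto simp: \<delta>_def min_def)
  define B where "B = (\<integral>x. l x * exp (z0 * l x) \<partial>P)"
  \<comment> \<open>The integral of \<open>1 + exp (l x)\<close> is 2, so the expansion yields
    \<open>2 / \<delta>\<^sup>2\<close>; this constant is a generous one.\<close>
  define c where "c = 2 * (4 / \<delta>\<^sup>2)"
  have exp_bound: "exp (z0 * y + 3 * \<delta> * \<bar>y\<bar>) \<le> 1 + exp y" for y
  proof (cases "y \<ge> 0")
    case True
    then show ?thesis
      using exp_le_one_plus_exp[of "z0 + 3 * \<delta>" y] \<delta> z0 by (simp add: algebra_simps)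
  next
    case False
    then show ?thesis
      using exp_le_one_plus_exp[of "z0 - 3 * \<delta>" y] \<delta> z0 by (simp add: algebra_simps)
  qed
  have abs_bound: "\<delta> * \<bar>y\<bar> \<le> exp (\<delta> * \<bar>y\<bar>)" for y
    using abs_le_exp[of "\<delta> * y"] \<delta> by (simp add: abs_mult)
  have int_dom: "integrable P (\<lambda>x. k * (1 + exp (l x)))" for k
    by (intro integrable_mult_right Bochner_Integration.integrable_add integrable_exp_l) auto
  have int_B: "integrable P (\<lambda>x. l x * exp (z0 * l x))"
  proof (rule Bochner_Integration.integrable_bound[OF int_dom[of "1 / \<delta>"]])
    show "AE x in P. norm (l x * exp (z0 * l x)) \<le> norm (1 / \<delta> * (1 + exp (l x)))"
    proof (rule AE_I2)
      fix x
      have "\<delta> * \<bar>l x\<bar> * exp (z0 * l x) \<le> exp (\<delta> * \<bar>l x\<bar>) * exp (z0 * l x)"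
        by (intro mult_right_mono abs_bound) auto
      also have "\<dots> \<le> exp (z0 * l x + 3 * \<delta> * \<bar>l x\<bar>)"
        using \<delta> by (simp add: exp_add[symmetric])
      also have "\<dots> \<le> 1 + exp (l x)"
        by (rule exp_bound)
      finally show "norm (l x * exp (z0 * l x)) \<le> norm (1 / \<delta> * (1 + exp (l x)))"
        using \<delta> by (simp add: abs_mult abs_of_nonneg add_nonneg_nonneg field_simps)
    qed
  qed simp
  have expand: "mgf (z0 + s) \<le> mgf z0 + s * B + c * s\<^sup>2" if s: "\<bar>s\<bar> \<le> \<delta>" for s
  proof -
    have "exp ((z0 + s) * y) \<le> exp (z0 * y) + s * (y * exp (z0 * y)) + s\<^sup>2 / \<delta>\<^sup>2 * (1 + exp y)" for y
    proof -
      have "exp ((z0 + s) * y) = exp (z0 * y) * exp (s * y)"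
        by (simp add: distrib_right exp_add)
      also have "\<dots> \<le> exp (z0 * y) * (1 + s * y + (s * y)\<^sup>2 * exp \<bar>s * y\<bar>)"
        by (intro mult_left_mono exp_second_order) auto
      also have "\<dots> = exp (z0 * y) + s * (y * exp (z0 * y)) + s\<^sup>2 * (y\<^sup>2 * (exp (z0 * y) * exp \<bar>s * y\<bar>))"
        by (simp add: algebra_simps power2_eq_square)
      also have "y\<^sup>2 * (exp (z0 * y) * exp \<bar>s * y\<bar>) \<le> 1 / \<delta>\<^sup>2 * (1 + exp y)"
      proof -
        have "(\<delta> * \<bar>y\<bar>)\<^sup>2 \<le> (exp (\<delta> * \<bar>y\<bar>))\<^sup>2"
          using \<delta> by (intro power_mono abs_bound) auto
        moreover have "exp \<bar>s * y\<bar> \<le> exp (\<delta> * \<bar>y\<bar>)"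
          using s by (simp add: abs_mult mult_right_mono)
        ultimately have "(\<delta> * \<bar>y\<bar>)\<^sup>2 * (exp (z0 * y) * exp \<bar>s * y\<bar>)
            \<le> (exp (\<delta> * \<bar>y\<bar>))\<^sup>2 * (exp (z0 * y) * exp (\<delta> * \<bar>y\<bar>))"
          by (intro mult_mono) auto
        also have "\<dots> = exp (z0 * y + 3 * \<delta> * \<bar>y\<bar>)"
          by (simp add: exp_add[symmetric] exp_double[symmetric] flip: exp_of_nat_mult)
        also have "\<dots> \<le> 1 + exp y"
          by (rule exp_bound)
        finally show ?thesis
          using \<delta> by (simp add: power_mult_distrib field_simps)
      qed
      finally show ?thesis
        by (simp add: mult_left_mono)
    qed
    then have "mgf (z0 + s) \<le> (\<integral>x. exp (z0 * l x) + s * (l x * exp (z0 * l x)) + s\<^sup>2 / \<delta>\<^sup>2 * (1 + exp (l x)) \<partial>P)"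
      unfolding mgf_def using s \<delta> z0
      by (intro integral_mono Bochner_Integration.integrable_add integrable_exp int_dom
          integrable_mult_right int_B) auto
    also have "\<dots> = mgf z0 + s * B + s\<^sup>2 / \<delta>\<^sup>2 * 2"
      using z0 integrable_exp[of z0] int_B int_dom[of "s\<^sup>2 / \<delta>\<^sup>2"] integrable_exp_l
      by (simp add: mgf_def B_def prob_space integral_exp_l)
    also have "\<dots> \<le> mgf z0 + s * B + c * s\<^sup>2"
      unfolding c_def by (intro add_left_mono) (simp add: divide_right_mono)
    finally show ?thesis .
  qed
  have "B = 0"
  proof (rule ccontr)
    assume "B \<noteq> 0"
    have c: "c > 0"
      using \<delta> by (simp add: c_def)
    \<comment> \<open>\<open>B\<close> is the derivative at \<open>z0\<close>. A step of size
      \<open>e\<close> against its sign gains \<open>e * \<bar>B\<bar>\<close> and loses at most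
      half of that through the quadratic term, contradicting minimality.\<close>
    define e where "e = min \<delta> (\<bar>B\<bar> / (2 * c))"
    have e: "e > 0" "e \<le> \<delta>" "e * (2 * c) \<le> \<bar>B\<bar>"
      using \<delta> \<open>B \<noteq> 0\<close> c by (auto simp: e_def min_def field_simps)
    define s where "s = - sgn B * e"
    have "\<bar>s\<bar> = e" "s * B = - (e * \<bar>B\<bar>)"
      using e \<open>B \<noteq> 0\<close> by (auto simp: s_def abs_mult sgn_if)
    moreover have "0 \<le> z0 + s" "z0 + s \<le> 1"
      using \<open>\<bar>s\<bar> = e\<close> e \<delta> by linarith+
    ultimately have "0 \<le> - (e * \<bar>B\<bar>) + c * e\<^sup>2"
      using expand[of s] min[of "z0 + s"] e by (simp add: power2_abs[of s, symmetric])
    then have "\<bar>B\<bar> \<le> c * e"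
      using e by (simp add: power2_eq_square field_simps)
    with e c show False
      using \<open>B \<noteq> 0\<close> by (simp add: field_simps)
  qed
  with expand \<delta> show thesis
    by (intro that[of \<delta> c]) (auto simp: c_def)
qed

text \<open>Two demands on the tilt \<open>z\<close> compete. To the right of the minimizer
  \<open>mgf\<close> must grow, so that cutting off \<open>L < n * a\<close> is cheap for some
  \<open>a > 0\<close>; yet it may grow only quadratically, so that cutting off
  \<open>L > n * b\<close> is cheap even for small \<open>b\<close>. The positive \<open>a\<close>
  then outweighs the loss in the assumed bound for the other error.\<close>

theorem error_lower_bound:
  fixes \<rho> \<epsilon> :: real
  assumes \<rho>: "\<rho> > 0" and attained: "\<exists>z\<in>{0..1}. mgf z = exp (- \<rho>)"
    and min: "\<And>z. 0 \<le> z \<Longrightarrow> z \<le> 1 \<Longrightarrow> exp (- \<rho>) \<le> mgf z"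
    and C: "\<And>n. C n \<in> sets (iid P n)"
    and other: "\<And>\<epsilon>. \<epsilon> > 0 \<Longrightarrow> \<forall>\<^sub>F n in sequentially.
        measure (iid alt n) (space (iid P n) - C n) \<le> exp (- (n * (\<rho> - \<epsilon>)))"
    and "\<epsilon> > 0"
  shows "\<forall>\<^sub>F n in sequentially. exp (- (n * (\<rho> + \<epsilon>))) \<le> measure (iid P n) (C n)"
proof -
  define m where "m = exp (- \<rho>)"
  have m: "0 < m" "m < 1"
    using \<rho> by (auto simp: m_def)
  \<comment> \<open>The largest minimizer is wanted: beyond it \<open>mgf\<close> lies strictly
    above its minimum, without any appeal to strict convexity.\<close>
  define K where "K = {0..1} \<inter> mgf -` {m}"
  have "compact K"
    unfolding K_def
    using continuous_closed_preimage[OF continuous_on_mgf closed_atLeastAtMost, of "{m}"]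
    by (auto simp: compact_eq_bounded_closed intro: bounded_subset[of "{0..1}"])
  moreover have "K \<noteq> {}"
    using attained by (auto simp: K_def m_def)
  ultimately obtain z0 where z0: "z0 \<in> K" "\<And>z. z \<in> K \<Longrightarrow> z \<le> z0"
    using compact_attains_sup[of K] by metis
  have mgf_z0: "mgf z0 = m"
    using z0 by (auto simp: K_def)
  have "z0 \<noteq> 0" "z0 \<noteq> 1"
    using mgf_z0 m by auto
  with z0 have z0_in: "0 < z0" "z0 < 1"
    by (auto simp: K_def)
  have gt: "m < mgf z" if "z0 < z" "z \<le> 1" for z
  proof -
    have "mgf z \<noteq> m"
      using z0(2)[of z] that z0_in by (auto simp: K_def)
    then show ?thesis
      using min[of z] that z0_in by (auto simp: m_def)
  qed
  obtain \<delta> c where \<delta>: "\<delta> > 0" "c > 0" "z0 + \<delta> \<le> 1"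
    "\<And>s. 0 \<le> s \<Longrightarrow> s \<le> \<delta> \<Longrightarrow> mgf (z0 + s) \<le> m + c * s\<^sup>2"
    by (rule mgf_quadratic_at_minimum[OF z0_in, unfolded mgf_z0]) (use min in \<open>auto simp: m_def\<close>)
  \<comment> \<open>One half of \<open>\<epsilon>\<close> pays for transferring mass back through
    \<open>L \<le> n * b\<close>, the other half for the factor 4 at the end.\<close>
  define b where "b = \<epsilon> / 2"
  \<comment> \<open>The first bound keeps \<open>z0 + 2 * s\<close> in the range of the quadratic
    estimate. The second makes the growth \<open>4 * c * s\<^sup>2\<close> at \<open>z2\<close> at
    most \<open>m * s * b / 2\<close>, which the gain \<open>exp (s * b)\<close> more than
    covers.\<close>
  define s where "s = min (\<delta> / 3) (m * b / (8 * c))"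
  have b: "b > 0"
    using \<open>\<epsilon> > 0\<close> by (simp add: b_def)
  have "s \<le> \<delta> / 3" "s \<le> m * b / (8 * c)" "s > 0"
    using b m \<delta> by (auto simp: s_def)
  then have s: "s > 0" "2 * s < \<delta>" "8 * c * s \<le> m * b"
    using \<delta> by (auto simp: field_simps)
  define z where "z = z0 + s"
  define z2 where "z2 = z0 + 2 * s"
  have z: "0 < z0" "z0 < z" "z < z2" "z2 < 1"
    using s \<delta> z0_in by (auto simp: z_def z2_def)
  have mz: "m < mgf z" "0 < mgf z"
    using gt[of z] z m by auto
  have r2: "exp (- (s * b)) * mgf z2 < mgf z"
  proof -
    have "8 * (c * s\<^sup>2) \<le> m * (s * b)"
      using mult_left_mono[OF s(3), of s] s by (simp add: power2_eq_square algebra_simps)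
    moreover have "mgf z2 \<le> m + c * (2 * s)\<^sup>2"
      using \<delta>(4)[of "2 * s"] s by (simp add: z2_def)
    moreover have "c * (2 * s)\<^sup>2 = 4 * (c * s\<^sup>2)" "m * (1 + s * b) = m + m * (s * b)"
      by (simp_all add: power_mult_distrib distrib_left)
    moreover have "0 \<le> m * (s * b)"
      using m s b by simp
    ultimately have "mgf z2 \<le> m * (1 + s * b)"
      by linarith
    also have "\<dots> \<le> m * exp (s * b)"
      using m by (intro mult_left_mono exp_ge_add_one_self) auto
    finally have "exp (- (s * b)) * mgf z2 \<le> m"
      by (simp add: exp_minus field_simps)
    with mz show ?thesis by simp
  qed
  \<comment> \<open>With this choice \<open>exp (s * a) * m\<close> is the geometric mean of
    \<open>m\<close> and \<open>mgf z\<close>, hence strictly below \<open>mgf z\<close>.\<close>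
  define a where "a = (ln (mgf z) - ln m) / (2 * s)"
  have a: "a > 0"
    using mz m s by (simp add: a_def)
  have r1: "exp (s * a) * m < mgf z"
  proof -
    have "exp (s * a) * m = exp (s * a + ln m)"
      using m by (simp add: exp_add)
    also have "s * a + ln m < ln (mgf z)"
      using s mz m by (simp add: a_def field_simps)
    finally show ?thesis
      using mz by (simp add: exp_ln)
  qed
  \<comment> \<open>The loss \<open>e\<close> in the bound for the other error uses up half of the
    gain \<open>(1 - z) * a\<close>; the other half leaves a factor tending to 0.\<close>
  define e where "e = (1 - z) * a / 2"
  have e: "e > 0"
    using z a by (simp add: e_def)
  have small: "(\<lambda>n. (r / mgf z) ^ n) \<longlonglongrightarrow> 0" if "0 \<le> r" "r < mgf z" for r
    using that mz by (intro LIMSEQ_power_zero) auto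
  have ev: "\<forall>\<^sub>F n in sequentially. (r / mgf z) ^ n < 1 / 4" if "0 \<le> r" "r < mgf z" for r
    using order_tendstoD(2)[OF small[OF that], of "1 / 4"] by simp
  have mgf_z2: "0 < mgf z2"
    using z by (intro mgf_pos) auto
  have "(\<lambda>n. exp (- e) ^ n) \<longlonglongrightarrow> 0"
    using e by (intro LIMSEQ_power_zero) auto
  then have ev_e: "\<forall>\<^sub>F n in sequentially. exp (- e) ^ n < 1 / 4"
    by (rule order_tendstoD) simp
  have "filterlim (\<lambda>n. exp (n * b)) at_top sequentially"
    by (rule filterlim_compose[OF exp_at_top
        filterlim_at_top_mult_tendsto_pos[OF tendsto_const b filterlim_real_sequentially]])
  then have ev_b: "\<forall>\<^sub>F n in sequentially. 4 \<le> exp (n * b)"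
    by (simp add: filterlim_at_top)
  have "0 \<le> exp (s * a) * m" "0 \<le> exp (- (s * b)) * mgf z2"
    using m mgf_z2 by auto
  from ev[OF this(1) r1] ev[OF this(2) r2] show ?thesis
    using ev_e ev_b other[OF e]
  proof eventually_elim
    case (elim n)
    define G where "G = mgf z ^ n"
    have G: "G > 0" "exp (- (n * \<rho>)) \<le> G"
    proof -
      show "G > 0"
        using mz by (simp add: G_def)
      have "m ^ n \<le> G"
        unfolding G_def using mz m by (intro power_mono) auto
      then show "exp (- (n * \<rho>)) \<le> G"
        by (simp add: m_def flip: exp_of_nat_mult)
    qed
    have power_le: "r ^ n \<le> G / 4" if "(r / mgf z) ^ n < 1 / 4" for r
    proof -
      have "r ^ n / G < 1 / 4"
        using that by (simp add: power_divide G_def)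
      then show ?thesis
        using G(1) by (simp add: pos_divide_less_eq)
    qed
    have "exp (n * ((z - z0) * a)) * mgf z0 ^ n = (exp (s * a) * m) ^ n"
      by (simp add: z_def mgf_z0 power_mult_distrib exp_of_nat_mult)
    with power_le[OF elim(1)] have t1: "exp (n * ((z - z0) * a)) * mgf z0 ^ n \<le> G / 4"
      by simp
    have "exp (- (n * ((z2 - z) * b))) * mgf z2 ^ n = (exp (- (s * b)) * mgf z2) ^ n"
      using exp_of_nat_mult[of n "- (s * b)"] by (simp add: z_def z2_def power_mult_distrib)
    with power_le[OF elim(2)] have t2: "exp (- (n * ((z2 - z) * b))) * mgf z2 ^ n \<le> G / 4"
      by simp
    have t4: "exp (- (n * ((1 - z) * a))) * measure (iid alt n) (space (iid P n) - C n) \<le> G / 4"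
    proof -
      have "exp (- (n * ((1 - z) * a))) * measure (iid alt n) (space (iid P n) - C n)
          \<le> exp (- (n * ((1 - z) * a))) * exp (- (n * (\<rho> - e)))"
        by (intro mult_left_mono elim) auto
      also have "\<dots> = exp (- e) ^ n * exp (- (n * \<rho>))"
        by (simp add: e_def exp_of_nat_mult[symmetric] exp_add[symmetric] algebra_simps)
      also have "\<dots> \<le> 1 / 4 * G"
        using elim G by (intro mult_mono) auto
      finally show ?thesis by simp
    qed
    \<comment> \<open>Three terms take at most a quarter of \<open>G\<close> each, so the last
      quarter must come from \<open>C n\<close>.\<close>
    have "G \<le> G / 4 + G / 4 + exp (n * (z * b)) * measure (iid P n) (C n) + G / 4"
      using error_tradeoff[of z0 z z2 "C n" n a b] C z t1 t2 t4 unfolding G_def by simp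
    then have "G / 4 \<le> exp (n * (z * b)) * measure (iid P n) (C n)"
      by simp
    also have "\<dots> \<le> exp (n * b) * measure (iid P n) (C n)"
      using z b by (intro mult_right_mono) (auto intro!: mult_left_mono)
    finally have "exp (- (n * \<rho>)) / 4 \<le> exp (n * b) * measure (iid P n) (C n)"
      using G by simp
    moreover have "exp (n * b) * exp (- (n * (\<rho> + \<epsilon>))) \<le> exp (- (n * \<rho>)) / 4"
    proof -
      have "exp (n * b) * exp (- (n * (\<rho> + \<epsilon>))) = exp (- (n * \<rho>)) / exp (n * b)"
        by (simp add: b_def exp_add[symmetric] exp_diff[symmetric] algebra_simps)
      also have "\<dots> \<le> exp (- (n * \<rho>)) / 4"
        using elim by (intro divide_left_mono) auto
      finally show ?thesis .
    qed
    ultimately show ?case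
      by (meson exp_gt_zero mult_le_cancel_left_pos order_trans)
  qed
qed

end

section \<open>A uniform Chernoff bound\<close>

text \<open>A cubic grid of side \<open>\<delta> / D\<close>; the divisor \<open>D\<close>
  compensates for bounding the norm by a sum over coordinates. From each cell that meets
  \<open>S\<close> one point of \<open>S\<close> is taken, because the net has to consist of
  admissible parameters.\<close>

lemma polynomial_net:
  fixes S :: "'a::euclidean_space set"
  assumes "bounded S"
  obtains c where "c > 0"
    "\<And>\<delta>. 0 < \<delta> \<Longrightarrow> \<delta> \<le> 1 \<Longrightarrow>
       \<exists>T\<subseteq>S. finite T \<and> card T \<le> (c / \<delta>) ^ DIM('a) \<and> (\<forall>x\<in>S. \<exists>y\<in>T. dist x y \<le> \<delta>)"
proof -
  obtain m where m: "m > 0" "\<And>x. x \<in> S \<Longrightarrow> norm x \<le> m"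
    using assms bounded_pos by blast
  define D where "D = real DIM('a)"
  have D: "D \<ge> 1"
    using DIM_positive[where 'a = 'a] by (simp add: D_def)
  show thesis
  proof (rule that[of "2 * m * D + 2"])
    show "0 < 2 * m * D + 2"
      using m D by (simp add: add_pos_pos)
    fix \<delta> :: real assume \<delta>: "0 < \<delta>" "\<delta> \<le> 1"
    define s where "s = \<delta> / D"
    have s: "s > 0" "D * s = \<delta>"
      using \<delta> D by (auto simp: s_def)
    define cell where "cell x = (\<lambda>b\<in>Basis. \<lfloor>(x \<bullet> b) / s\<rfloor>)" for x :: 'a
    define Box where "Box = (Basis::'a set) \<rightarrow>\<^sub>E {\<lfloor>- m / s\<rfloor>..\<lfloor>m / s\<rfloor>}"
    have cell_in: "cell ` S \<subseteq> Box"
    proof -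
      have "\<lfloor>(x \<bullet> b) / s\<rfloor> \<in> {\<lfloor>- m / s\<rfloor>..\<lfloor>m / s\<rfloor>}" if "x \<in> S" "b \<in> Basis" for x b
      proof -
        have "\<bar>x \<bullet> b\<bar> \<le> m"
          using m(2)[OF that(1)] Basis_le_norm[OF that(2), of x] by simp
        then have "- m / s \<le> (x \<bullet> b) / s" "(x \<bullet> b) / s \<le> m / s"
          using s divide_right_mono[of "- m" "x \<bullet> b" s] divide_right_mono[of "x \<bullet> b" m s] by auto
        then show ?thesis
          by (simp add: floor_mono)
      qed
      then show ?thesis
        by (auto simp: cell_def Box_def)
    qed
    have "finite Box"
      by (simp add: Box_def finite_PiE)
    then have fin: "finite (cell ` S)"
      using cell_in finite_subset by blast
    define T where "T = inv_into S cell ` cell ` S"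
    have "card T \<le> card (cell ` S)"
      unfolding T_def by (rule card_image_le[OF fin])
    also have "\<dots> \<le> card Box"
      using \<open>finite Box\<close> cell_in by (rule card_mono)
    also have "card Box = nat (\<lfloor>m / s\<rfloor> - \<lfloor>- m / s\<rfloor> + 1) ^ DIM('a)"
      by (simp add: Box_def card_PiE)
    finally have "real (card T) \<le> real (nat (\<lfloor>m / s\<rfloor> - \<lfloor>- m / s\<rfloor> + 1)) ^ DIM('a)"
      by (simp flip: of_nat_power)
    also have "\<dots> \<le> ((2 * m * D + 2) / \<delta>) ^ DIM('a)"
    proof (rule power_mono)
      have "0 \<le> m / s"
        using m s by simp
      then have "real (nat (\<lfloor>m / s\<rfloor> - \<lfloor>- m / s\<rfloor> + 1)) \<le> 2 * (m / s) + 2"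
        by linarith
      also have "\<dots> \<le> (2 * m * D + 2) / \<delta>"
        using \<delta> by (simp add: s_def field_simps)
      finally show "real (nat (\<lfloor>m / s\<rfloor> - \<lfloor>- m / s\<rfloor> + 1)) \<le> (2 * m * D + 2) / \<delta>" .
    qed simp
    finally have card: "real (card T) \<le> ((2 * m * D + 2) / \<delta>) ^ DIM('a)" .
    have "\<exists>y\<in>T. dist x y \<le> \<delta>" if x: "x \<in> S" for x
    proof -
      define y where "y = inv_into S cell (cell x)"
      have y: "y \<in> T" "cell y = cell x"
        using x by (auto simp: y_def T_def f_inv_into_f)
      have "dist x y \<le> (\<Sum>b\<in>Basis. \<bar>(x - y) \<bullet> b\<bar>)"
        unfolding dist_norm by (rule norm_le_l1)
      also have "\<dots> \<le> (\<Sum>b\<in>(Basis::'a set). s)"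
      proof (rule sum_mono)
        fix b :: 'a assume "b \<in> Basis"
        with y(2) have "\<lfloor>(y \<bullet> b) / s\<rfloor> = \<lfloor>(x \<bullet> b) / s\<rfloor>"
          by (auto simp: cell_def fun_eq_iff restrict_def split: if_splits dest: spec[of _ b])
        then have "\<bar>(x \<bullet> b) / s - (y \<bullet> b) / s\<bar> \<le> 1"
          by linarith
        then have "\<bar>((x - y) \<bullet> b) / s\<bar> \<le> 1"
          by (simp add: inner_diff_left diff_divide_distrib)
        then show "\<bar>(x - y) \<bullet> b\<bar> \<le> s"
          using s by (simp add: abs_divide pos_divide_le_eq)
      qed
      also have "\<dots> = \<delta>"
        using s by (simp add: D_def)
      finally show ?thesis
        using y(1) by blast
    qed
    moreover have "T \<subseteq> S"
      by (auto simp: T_def inv_into_into)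
    moreover have "finite T"
      using fin by (simp add: T_def)
    ultimately show "\<exists>T\<subseteq>S. finite T \<and> card T \<le> ((2 * m * D + 2) / \<delta>) ^ DIM('a) \<and> (\<forall>x\<in>S. \<exists>y\<in>T. dist x y \<le> \<delta>)"
      using card by blast
  qed
qed

lemma measure_iid_component:
  assumes "prob_space P" "B \<in> sets P" "j < n"
  shows "{X\<in>space (iid P n). X j \<in> B} \<in> sets (iid P n)"
    and "measure (iid P n) {X\<in>space (iid P n). X j \<in> B} = measure P B"
proof -
  interpret product_prob_space "\<lambda>_. P" "{..<n}"
    using assms(1) by (intro product_prob_spaceI)
  have j: "(\<lambda>X. X j) \<in> measurable (iid P n) P"
    using assms(3) by (intro measurable_component_singleton) auto
  show "{X\<in>space (iid P n). X j \<in> B} \<in> sets (iid P n)"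
    using measurable_sets[OF j assms(2)] by (simp add: vimage_def Int_def conj_commute)
  have "measure P B = measure (distr (iid P n) P (\<lambda>X. X j)) B"
    using assms(3) by (subst distr_PiM_component) (auto intro: assms(1))
  also have "\<dots> = measure (iid P n) {X\<in>space (iid P n). X j \<in> B}"
    using j assms(2) by (subst measure_distr) (auto simp: vimage_def Int_def conj_commute)
  finally show "measure (iid P n) {X\<in>space (iid P n). X j \<in> B} = measure P B" ..
qed

text \<open>The mesh \<open>exp (- n powr \<beta>)\<close> of the net balances two requirements: \<open>\<beta> < 1\<close> keeps its cardinality
  subexponential, and \<open>\<beta> * (1 + \<eta>) > 1\<close> makes the probability that some score exceeds the inverse
  mesh superexponentially small.\<close>

lemma net_asymptotics:
  fixes \<eta> \<rho> \<epsilon> c K :: real and d :: nat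
  assumes "\<eta> > 0" "\<epsilon> > 0" "c > 0" "K > 0" "d > 0"
  obtains \<beta> where "\<beta> > 0"
    "\<forall>\<^sub>F n in sequentially. real n * exp (- ((real n powr \<beta>) powr (1 + \<eta>))) +
       (c / (exp (- (real n powr \<beta>)) / (K * real n))) ^ d * (exp 1 * exp (- \<rho>) ^ n) \<le> exp (- (real n * (\<rho> - \<epsilon>)))"
proof -
  \<comment> \<open>Any \<open>\<kappa>\<close> strictly between 1 and \<open>1 + \<eta>\<close>
    works: it yields \<open>\<beta> < 1\<close> and \<open>\<beta> * (1 + \<eta>) > 1\<close>
    together.\<close>
  define \<kappa> where "\<kappa> = 1 + \<eta> / 2"
  define \<beta> where "\<beta> = \<kappa> / (1 + \<eta>)"
  have \<kappa>: "\<kappa> > 1" and \<beta>: "\<beta> > 0" "\<beta> < 1" "\<beta> * (1 + \<eta>) = \<kappa>"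
    using assms(1) by (auto simp: \<kappa>_def \<beta>_def field_simps)
  \<comment> \<open>The superexponential term is below \<open>exp (- n * q)\<close> for every
    \<open>q\<close>; this one is positive and at least \<open>\<rho> - \<epsilon>\<close>, whatever
    the sign of \<open>\<rho>\<close>.\<close>
  define q where "q = \<bar>\<rho>\<bar> + 1"
  have q: "q > 0" "q \<ge> \<rho> - \<epsilon>"
    using assms(2) by (auto simp: q_def)
  have "\<forall>\<^sub>F x::real in at_top. x * exp (- (x powr \<kappa>)) \<le> exp (- (x * q)) / 2"
    using \<kappa> q(1) by real_asymp
  then have e1: "\<forall>\<^sub>F n in sequentially. real n * exp (- (real n powr \<kappa>)) \<le> exp (- (real n * q)) / 2"
    using filterlim_real_sequentially unfolding filterlim_iff by blast
  define D where "D = real d"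
  have "D > 0" using assms by (simp add: D_def)
  then have "\<forall>\<^sub>F x::real in at_top. exp 1 * exp (D * (ln (c * K * x) + x powr \<beta>)) \<le> exp (x * \<epsilon>) / 2"
    using \<beta> assms(2-4) by real_asymp
  then have e2: "\<forall>\<^sub>F n in sequentially. exp 1 * exp (D * (ln (c * K * real n) + real n powr \<beta>)) \<le> exp (real n * \<epsilon>) / 2"
    using filterlim_real_sequentially unfolding filterlim_iff by blast
  show thesis
  proof (rule that[OF \<beta>(1)])
    show "\<forall>\<^sub>F n in sequentially. real n * exp (- ((real n powr \<beta>) powr (1 + \<eta>))) +
       (c / (exp (- (real n powr \<beta>)) / (K * real n))) ^ d * (exp 1 * exp (- \<rho>) ^ n) \<le> exp (- (real n * (\<rho> - \<epsilon>)))"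
      using e1 e2 eventually_gt_at_top[of 0]
    proof eventually_elim
      case (elim n)
      have "real n * q \<ge> real n * (\<rho> - \<epsilon>)"
        using q by (intro mult_left_mono) auto
      then have "exp (- (real n * q)) \<le> exp (- (real n * (\<rho> - \<epsilon>)))"
        by simp
      then have t1: "real n * exp (- ((real n powr \<beta>) powr (1 + \<eta>))) \<le> exp (- (real n * (\<rho> - \<epsilon>))) / 2"
        using order_trans[OF elim(1) divide_right_mono] by (simp add: powr_powr \<beta>)
      have pos: "c * K * real n > 0"
        using assms elim by simp
      have "c / (exp (- (real n powr \<beta>)) / (K * real n)) = exp (ln (c * K * real n) + real n powr \<beta>)"
        using pos by (simp add: exp_add exp_minus field_simps)
      then have "(c / (exp (- (real n powr \<beta>)) / (K * real n))) ^ d * (exp 1 * exp (- \<rho>) ^ n)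
          = exp 1 * exp (D * (ln (c * K * real n) + real n powr \<beta>)) * exp (- (real n * \<rho>))"
        by (simp add: D_def exp_of_nat_mult[of n "- \<rho>", simplified] exp_of_nat_mult[of d])
      also have "\<dots> \<le> exp (real n * \<epsilon>) / 2 * exp (- (real n * \<rho>))"
        by (intro mult_right_mono elim) auto
      also have "\<dots> = exp (- (real n * (\<rho> - \<epsilon>))) / 2"
        by (simp add: exp_add[symmetric] algebra_simps)
      finally show ?case
        using t1 by simp
    qed
  qed
qed

text \<open>The index \<open>i\<close> stands for the parameter of the null family; the hypotheses
  are uniform in \<open>i\<close>, and so is the threshold for \<open>n\<close>. The event that some
  \<open>\<gamma>\<close> is at least as likely is an uncountable union, so the bound is stated for
  arbitrary measurable \<open>A\<close> inside it, up to samples that meet \<open>N\<close>.\<close>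

theorem uniform_chernoff_bound:
  fixes \<Gamma> :: "'b::euclidean_space set" and P :: "'i \<Rightarrow> 'x measure" and l :: "'i \<Rightarrow> 'b \<Rightarrow> 'x \<Rightarrow> real"
    and S :: "'x \<Rightarrow> real" and \<rho> \<epsilon> K r \<eta> x0 :: real
  assumes "bounded \<Gamma>"
    and tilting: "\<And>i \<gamma>. i \<in> I \<Longrightarrow> \<gamma> \<in> \<Gamma> \<Longrightarrow> likelihood_tilting (P i) (l i \<gamma>)"
    and mgf: "\<And>i \<gamma>. i \<in> I \<Longrightarrow> \<gamma> \<in> \<Gamma> \<Longrightarrow> \<exists>z\<in>{0..1}. likelihood_tilting.mgf (P i) (l i \<gamma>) z \<le> exp (- \<rho>)"
    and prob: "\<And>i. i \<in> I \<Longrightarrow> prob_space (P i)"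
    and null: "\<And>i. i \<in> I \<Longrightarrow> N \<in> null_sets (P i)"
    and "r > 0" "K > 0"
    and lipschitz: "\<And>i x \<gamma> \<gamma>'. i \<in> I \<Longrightarrow> x \<in> space (P i) \<Longrightarrow> x \<notin> N \<Longrightarrow> \<gamma> \<in> \<Gamma> \<Longrightarrow> \<gamma>' \<in> \<Gamma> \<Longrightarrow> dist \<gamma> \<gamma>' < r \<Longrightarrow>
       \<bar>l i \<gamma> x - l i \<gamma>' x\<bar> \<le> K * S x * dist \<gamma> \<gamma>'"
    and S_meas: "\<And>i. i \<in> I \<Longrightarrow> S \<in> borel_measurable (P i)"
    and "\<eta> > 0"
    and tail: "\<And>i x. i \<in> I \<Longrightarrow> x > x0 \<Longrightarrow> measure (P i) {y\<in>space (P i). x < S y} \<le> exp (- (ln x powr (1 + \<eta>)))"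
    and "\<epsilon> > 0"
  shows "\<forall>\<^sub>F n in sequentially. \<forall>i\<in>I. \<forall>A\<in>sets (iid (P i) n).
     (\<forall>X\<in>A. (\<forall>j<n. X j \<notin> N) \<longrightarrow> (\<exists>\<gamma>\<in>\<Gamma>. 0 \<le> (\<Sum>j<n. l i \<gamma> (X j)))) \<longrightarrow>
     measure (iid (P i) n) A \<le> exp (- (real n * (\<rho> - \<epsilon>)))"
proof -
  obtain c where c: "c > 0" and net: "\<And>\<delta>. 0 < \<delta> \<Longrightarrow> \<delta> \<le> 1 \<Longrightarrow>
       \<exists>T\<subseteq>\<Gamma>. finite T \<and> card T \<le> (c / \<delta>) ^ DIM('b) \<and> (\<forall>x\<in>\<Gamma>. \<exists>y\<in>T. dist x y \<le> \<delta>)"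
    by (rule polynomial_net[OF assms(1)], rule that) assumption+
  obtain \<beta> where "\<beta> > 0" and asymp: "\<forall>\<^sub>F n in sequentially.
       real n * exp (- ((real n powr \<beta>) powr (1 + \<eta>))) +
       (c / (exp (- (real n powr \<beta>)) / (K * real n))) ^ DIM('b) * (exp 1 * exp (- \<rho>) ^ n) \<le> exp (- (real n * (\<rho> - \<epsilon>)))"
    by (rule net_asymptotics[OF \<open>\<eta> > 0\<close> \<open>\<epsilon> > 0\<close> c \<open>K > 0\<close> DIM_positive])
  have "\<forall>\<^sub>F x::real in at_top. exp (- (x powr \<beta>)) / (K * x) < min r 1"
    using \<open>\<beta> > 0\<close> \<open>K > 0\<close> \<open>r > 0\<close> unfolding min_less_iff_conj by (intro eventually_conj) real_asymp+
  then have ev_mesh: "\<forall>\<^sub>F n in sequentially. exp (- (real n powr \<beta>)) / (K * real n) < min r 1"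
    using filterlim_real_sequentially unfolding filterlim_iff by blast
  have "\<forall>\<^sub>F x::real in at_top. x0 < exp (x powr \<beta>)"
    using \<open>\<beta> > 0\<close> by real_asymp
  then have ev_level: "\<forall>\<^sub>F n in sequentially. x0 < exp (real n powr \<beta>)"
    using filterlim_real_sequentially unfolding filterlim_iff by blast
  show ?thesis
    using asymp ev_mesh ev_level eventually_gt_at_top[of 0]
  proof (eventually_elim, intro ballI impI)
    fix n i A
    assume n: "real n * exp (- ((real n powr \<beta>) powr (1 + \<eta>))) +
       (c / (exp (- (real n powr \<beta>)) / (K * real n))) ^ DIM('b) * (exp 1 * exp (- \<rho>) ^ n) \<le> exp (- (real n * (\<rho> - \<epsilon>)))"
      "exp (- (real n powr \<beta>)) / (K * real n) < min r 1" "x0 < exp (real n powr \<beta>)" "0 < n"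
      and i: "i \<in> I" and A [measurable]: "A \<in> sets (iid (P i) n)"
      and A_imp: "\<forall>X\<in>A. (\<forall>j<n. X j \<notin> N) \<longrightarrow> (\<exists>\<gamma>\<in>\<Gamma>. 0 \<le> (\<Sum>j<n. l i \<gamma> (X j)))"
    interpret iid: product_prob_space "\<lambda>_. P i" "{..<n}"
      using prob[OF i] by (intro product_prob_spaceI)
    \<comment> \<open>Mesh and level satisfy \<open>n * (K * \<delta> * t) = 1\<close>: if all
      \<open>n\<close> scores are at most \<open>t\<close>, moving \<open>\<gamma>\<close> to its
      net point changes the log-likelihood ratio of the sample by at most 1. This explains the slack
      in \<open>BT\<close> and the factor \<open>exp 1\<close>.\<close>
    define \<delta> where "\<delta> = exp (- (real n powr \<beta>)) / (K * real n)"
    define t where "t = exp (real n powr \<beta>)"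
    have \<delta>: "0 < \<delta>" "\<delta> \<le> 1" "\<delta> < r"
      using n \<open>K > 0\<close> by (auto simp: \<delta>_def)
    have \<delta>t: "n * (K * \<delta> * t) = 1"
      using n \<open>K > 0\<close> by (simp add: \<delta>_def t_def exp_minus field_simps)
    obtain T where T: "T \<subseteq> \<Gamma>" "finite T" "card T \<le> (c / \<delta>) ^ DIM('b)" "\<And>x. x \<in> \<Gamma> \<Longrightarrow> \<exists>y\<in>T. dist x y \<le> \<delta>"
      using net[OF \<delta>(1,2)] by auto
    define BN where "BN = (\<lambda>j. {X\<in>space (iid (P i) n). X j \<in> N})"
    define BS where "BS = (\<lambda>j. {X\<in>space (iid (P i) n). X j \<in> {y\<in>space (P i). t < S y}})"
    define BT where "BT = (\<lambda>\<gamma>. {X\<in>space (iid (P i) n). - 1 \<le> (\<Sum>j<n. l i \<gamma> (X j))})"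
    have S_set: "{y\<in>space (P i). t < S y} \<in> sets (P i)"
      using S_meas[OF i] by measurable
    have N_set: "N \<in> sets (P i)"
      using null[OF i] by auto
    have BN: "BN j \<in> sets (iid (P i) n)" "measure (iid (P i) n) (BN j) = 0" if "j < n" for j
      using measure_iid_component[OF prob[OF i] N_set that] null[OF i]
      by (auto simp: BN_def measure_def null_sets_def)
    have BS: "BS j \<in> sets (iid (P i) n)" "measure (iid (P i) n) (BS j) \<le> exp (- ((real n powr \<beta>) powr (1 + \<eta>)))"
      if "j < n" for j
      using measure_iid_component[OF prob[OF i] S_set that] tail[OF i n(3)]
      by (simp_all add: BS_def t_def)
    have BT: "BT \<gamma> \<in> sets (iid (P i) n)" "measure (iid (P i) n) (BT \<gamma>) \<le> exp 1 * exp (- \<rho>) ^ n" if "\<gamma> \<in> T" for \<gamma>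
    proof -
      have \<gamma>: "\<gamma> \<in> \<Gamma>"
        using that T(1) by auto
      interpret tilt: likelihood_tilting "P i" "l i \<gamma>"
        by (rule tilting[OF i \<gamma>])
      show "BT \<gamma> \<in> sets (iid (P i) n)"
        unfolding BT_def by measurable
      obtain z where z: "0 \<le> z" "z \<le> 1" "tilt.mgf z \<le> exp (- \<rho>)"
        using mgf[OF i \<gamma>] by auto
      have "measure (iid (P i) n) (BT \<gamma>) \<le> exp (z * 1) * tilt.mgf z ^ n"
        unfolding BT_def using z by (intro tilt.chernoff_bound) auto
      also have "\<dots> \<le> exp 1 * exp (- \<rho>) ^ n"
        using z tilt.mgf_pos[of z] by (intro mult_mono power_mono) auto
      finally show "measure (iid (P i) n) (BT \<gamma>) \<le> exp 1 * exp (- \<rho>) ^ n" .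
    qed
    \<comment> \<open>Outside the first two unions all coordinates are regular with scores at most
      \<open>t\<close>, so the net point near a winning \<open>\<gamma>\<close> puts the sample into
      its \<open>BT\<close>.\<close>
    have "A \<subseteq> ((\<Union>j<n. BN j) \<union> (\<Union>j<n. BS j)) \<union> (\<Union>\<gamma>\<in>T. BT \<gamma>)"
    proof
      fix X assume X: "X \<in> A"
      then have X_space: "X \<in> space (iid (P i) n)"
        using sets.sets_into_space[OF A] by auto
      then have X_comp: "X j \<in> space (P i)" if "j < n" for j
        using that by (auto simp: space_PiM)
      show "X \<in> ((\<Union>j<n. BN j) \<union> (\<Union>j<n. BS j)) \<union> (\<Union>\<gamma>\<in>T. BT \<gamma>)"
      proof (rule ccontr)
        assume contra: "X \<notin> ((\<Union>j<n. BN j) \<union> (\<Union>j<n. BS j)) \<union> (\<Union>\<gamma>\<in>T. BT \<gamma>)"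
        have good: "X j \<notin> N" "S (X j) \<le> t" if "j < n" for j
          using contra that X_space X_comp[OF that] by (auto simp: BN_def BS_def not_less)
        then obtain \<gamma> where \<gamma>: "\<gamma> \<in> \<Gamma>" "0 \<le> (\<Sum>j<n. l i \<gamma> (X j))"
          using A_imp X by auto
        obtain \<gamma>' where \<gamma>': "\<gamma>' \<in> T" "dist \<gamma> \<gamma>' \<le> \<delta>"
          using T(4)[OF \<gamma>(1)] by auto
        have "l i \<gamma> (X j) \<le> l i \<gamma>' (X j) + K * \<delta> * t" if "j < n" for j
        proof -
          have "\<bar>l i \<gamma> (X j) - l i \<gamma>' (X j)\<bar> \<le> K * S (X j) * dist \<gamma> \<gamma>'"
            using good(1)[OF that] X_comp[OF that] \<gamma>(1) \<gamma>' T(1) \<delta> by (intro lipschitz[OF i]) auto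
          also have "\<dots> \<le> K * t * dist \<gamma> \<gamma>'"
            using good(2)[OF that] \<open>K > 0\<close> by (intro mult_right_mono mult_left_mono) auto
          also have "\<dots> \<le> K * t * \<delta>"
            using \<gamma>'(2) \<open>K > 0\<close> by (intro mult_left_mono) (auto simp: t_def)
          finally show ?thesis by (simp add: mult.commute mult.left_commute)
        qed
        then have "(\<Sum>j<n. l i \<gamma> (X j)) \<le> (\<Sum>j<n. l i \<gamma>' (X j) + K * \<delta> * t)"
          by (intro sum_mono) auto
        also have "\<dots> = (\<Sum>j<n. l i \<gamma>' (X j)) + 1"
          using \<delta>t by (simp add: sum.distrib)
        finally have "X \<in> BT \<gamma>'"
          using \<gamma>(2) X_space by (simp add: BT_def)
        with contra \<gamma>'(1) show False by auto
      qed
    qed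
    then have "measure (iid (P i) n) A \<le> measure (iid (P i) n) (((\<Union>j<n. BN j) \<union> (\<Union>j<n. BS j)) \<union> (\<Union>\<gamma>\<in>T. BT \<gamma>))"
      using BN BS BT T(2) by (intro iid.finite_measure_mono) (auto intro!: sets.Un sets.finite_UN)
    also have "\<dots> \<le> measure (iid (P i) n) (\<Union>j<n. BN j) + measure (iid (P i) n) (\<Union>j<n. BS j) + measure (iid (P i) n) (\<Union>\<gamma>\<in>T. BT \<gamma>)"
      using BN BS BT T(2)
      by (intro order_trans[OF measure_Un_le] add_right_mono measure_Un_le) (auto intro!: sets.Un sets.finite_UN)
    also have "\<dots> \<le> (\<Sum>j<n. measure (iid (P i) n) (BN j)) + (\<Sum>j<n. measure (iid (P i) n) (BS j)) + (\<Sum>\<gamma>\<in>T. measure (iid (P i) n) (BT \<gamma>))"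
      using BN BS BT T(2) by (intro add_mono iid.finite_measure_subadditive_finite) auto
    also have "\<dots> \<le> 0 + real n * exp (- ((real n powr \<beta>) powr (1 + \<eta>))) + real (card T) * (exp 1 * exp (- \<rho>) ^ n)"
      using BN BS BT sum_bounded_above[of "{..<n}" "\<lambda>j. measure (iid (P i) n) (BS j)"]
        sum_bounded_above[of T "\<lambda>\<gamma>. measure (iid (P i) n) (BT \<gamma>)"]
      by (intro add_mono) auto
    also have "\<dots> \<le> 0 + real n * exp (- ((real n powr \<beta>) powr (1 + \<eta>))) + (c / \<delta>) ^ DIM('b) * (exp 1 * exp (- \<rho>) ^ n)"
      using T(3) by (intro add_left_mono mult_right_mono) auto
    also have "\<dots> \<le> exp (- (real n * (\<rho> - \<epsilon>)))"
      using n(1) by (simp add: \<delta>_def)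
    finally show "measure (iid (P i) n) A \<le> exp (- (real n * (\<rho> - \<epsilon>)))" .
  qed
qed

section \<open>The Chernoff index of a pair of densities\<close>

lemma measurable_llr [measurable]:
  "g \<in> borel_measurable M \<Longrightarrow> h \<in> borel_measurable M \<Longrightarrow> llr g h \<in> borel_measurable M"
  unfolding llr_def[abs_def] by (intro borel_measurable_diff borel_measurable_ln)

lemma llr_swap: "llr h g x = - llr g h x"
  by (simp add: llr_def)

text \<open>Where \<open>g\<close> vanishes the quotient is 0 by convention, and absolute continuity
  forces \<open>h\<close> to vanish there too, up to a null set.\<close>

lemma law_change_of_density:
  assumes [measurable]: "g \<in> borel_measurable M" "h \<in> borel_measurable M"
    and nonneg: "\<And>x. 0 \<le> g x" "\<And>x. 0 \<le> h x"
    and ac: "absolutely_continuous (law M g) (law M h)"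
  shows "law M h = density (law M g) (\<lambda>x. ennreal (h x / g x))"
proof -
  define Z where "Z = {x\<in>space M. g x = 0}"
  have "Z \<in> null_sets (law M g)"
    by (subst null_sets_density_iff) (auto simp: Z_def)
  then have "Z \<in> null_sets (law M h)"
    using ac by (auto simp: absolutely_continuous_def)
  then have "AE x in M. x \<in> Z \<longrightarrow> h x = 0"
    using nonneg by (subst (asm) null_sets_density_iff) (auto simp: ennreal_eq_0_iff elim!: eventually_mono intro: antisym)
  then have "AE x in M. ennreal (h x) = ennreal (g x) * ennreal (h x / g x)"
    using AE_space
  proof eventually_elim
    case (elim x)
    then show ?case
      using nonneg by (cases "g x = 0") (auto simp: Z_def ennreal_mult'[symmetric])
  qed
  then have "law M h = density M (\<lambda>x. ennreal (g x) * ennreal (h x / g x))"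
    by (intro density_cong) auto
  then show ?thesis
    by (simp add: density_density_eq)
qed

text \<open>Positivity almost everywhere keeps \<open>ln\<close> away from its default value at
  0.\<close>

lemma law_eq_density_exp_llr:
  assumes [measurable]: "g \<in> borel_measurable M" "h \<in> borel_measurable M"
    and nonneg: "\<And>x. 0 \<le> g x" "\<And>x. 0 \<le> h x"
    and ac: "absolutely_continuous (law M g) (law M h)"
    and pos: "AE x in law M g. 0 < g x \<and> 0 < h x"
  shows "law M h = density (law M g) (\<lambda>x. ennreal (exp (llr g h x)))"
  unfolding law_change_of_density[OF assms(1-5)]
proof (rule density_cong)
  show "AE x in law M g. ennreal (h x / g x) = ennreal (exp (llr g h x))"
    using pos by eventually_elim (simp add: llr_def exp_diff)
qed auto

text \<open>The conditions are symmetric in \<open>g\<close> and \<open>h\<close>, so each fact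
  about \<open>g\<close> acquires a twin with the densities exchanged.\<close>

locale density_pair =
  fixes M :: "real measure" and g h :: "real \<Rightarrow> real"
  assumes density_g: "prob_density M g" and density_h: "prob_density M h"
    and ac_gh: "absolutely_continuous (law M g) (law M h)"
    and ac_hg: "absolutely_continuous (law M h) (law M g)"
    and pos_g: "AE x in law M g. 0 < g x \<and> 0 < h x"
    and pos_h: "AE x in law M h. 0 < g x \<and> 0 < h x"
begin

lemma measurable_g [measurable]: "g \<in> borel_measurable M" and measurable_h [measurable]: "h \<in> borel_measurable M"
  and nonneg: "0 \<le> g x" "0 \<le> h x"
  using density_g density_h by (auto simp: prob_density_def)

sublocale G: prob_space "law M g" + H: prob_space "law M h"
  using density_g density_h by (auto simp: prob_density_def)

lemma law_h_eq: "law M h = density (law M g) (\<lambda>x. ennreal (exp (llr g h x)))"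
  by (intro law_eq_density_exp_llr nonneg ac_gh pos_g) auto

sublocale likelihood_tilting "law M g" "llr g h"
proof
  show meas: "llr g h \<in> borel_measurable (law M g)" by measurable
  have "(\<integral>\<^sup>+x. ennreal (exp (llr g h x)) \<partial>law M g) = emeasure (law M h) (space M)"
    unfolding law_h_eq using meas by (subst emeasure_density) (auto intro!: nn_integral_cong split: split_indicator)
  also have "\<dots> = 1"
    using H.emeasure_space_1 by simp
  finally have 1: "(\<integral>\<^sup>+x. ennreal (exp (llr g h x)) \<partial>law M g) = 1" .
  with meas show "integrable (law M g) (\<lambda>x. exp (llr g h x))"
    by (intro integrableI_nonneg) auto
  show "(\<integral>x. exp (llr g h x) \<partial>law M g) = 1"
    using meas 1 by (subst integral_eq_nn_integral) auto
qed

lemma alt_eq: "alt = law M h"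
  by (simp add: alt_def law_h_eq)

lemma llr_mgf_eq: "0 \<le> z \<Longrightarrow> z \<le> 1 \<Longrightarrow> llr_mgf M g h z = ennreal (mgf z)"
  unfolding llr_mgf_def mgf_def by (intro nn_integral_eq_integral integrable_exp) auto

text \<open>The change of measure multiplies the integrand by \<open>exp (llr g h x)\<close>. As
  \<open>z\<close> is an arbitrary real and infinite values are included, exponents above 1 under
  \<open>g\<close> become negative ones under \<open>h\<close>.\<close>

lemma llr_mgf_swap: "llr_mgf M h g z = llr_mgf M g h (1 - z)"
proof -
  have "llr_mgf M h g z = (\<integral>\<^sup>+x. ennreal (exp (llr g h x)) * ennreal (exp (z * llr h g x)) \<partial>law M g)"
    unfolding llr_mgf_def law_h_eq by (subst nn_integral_density) auto
  also have "\<dots> = llr_mgf M g h (1 - z)"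
    unfolding llr_mgf_def
    by (intro nn_integral_cong) (simp add: ennreal_mult'[symmetric] exp_add[symmetric] llr_swap[of h g] algebra_simps)
  finally show ?thesis .
qed

end

sublocale density_pair \<subseteq> swap: density_pair M h g
  using density_g density_h ac_gh ac_hg pos_g pos_h by unfold_locales (auto simp: conj_commute)

context density_pair
begin

lemma mgf_swap:
  assumes "0 \<le> z" "z \<le> 1"
  shows "swap.mgf z = mgf (1 - z)"
proof -
  have "ennreal (swap.mgf z) = ennreal (mgf (1 - z))"
    using assms swap.llr_mgf_eq[of z] llr_mgf_eq[of "1 - z"] llr_mgf_swap[of z] by simp
  then show ?thesis
    using assms mgf_pos[of "1 - z"] swap.mgf_pos[of z] by (simp add: ennreal_inj)
qed

end

section \<open>Extended expectations, Jensen's inequality and separation\<close>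

lemma ext_expectation_ge:
  assumes "integrable P u" and le: "\<And>x. u x \<le> f x"
  shows "ereal (\<integral>x. u x \<partial>P) \<le> ext_expectation P f"
proof -
  have fin: "(\<integral>\<^sup>+x. ennreal (u x) \<partial>P) < \<infinity>" "(\<integral>\<^sup>+x. ennreal (- u x) \<partial>P) < \<infinity>"
    using assms(1) by (auto simp: real_integrable_def top.not_eq_extremum)
  have "ereal (\<integral>x. u x \<partial>P) = enn2ereal (\<integral>\<^sup>+x. ennreal (u x) \<partial>P) - enn2ereal (\<integral>\<^sup>+x. ennreal (- u x) \<partial>P)"
    unfolding real_lebesgue_integral_def[OF assms(1)] using fin
    by (cases "\<integral>\<^sup>+x. ennreal (u x) \<partial>P"; cases "\<integral>\<^sup>+x. ennreal (- u x) \<partial>P") auto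
  also have "\<dots> \<le> ext_expectation P f"
    unfolding ext_expectation_def
  proof (rule ereal_minus_mono)
    show "enn2ereal (\<integral>\<^sup>+x. ennreal (u x) \<partial>P) \<le> enn2ereal (\<integral>\<^sup>+x. ennreal (f x) \<partial>P)"
      using le by (auto simp: less_eq_ennreal.rep_eq[symmetric] intro!: nn_integral_mono ennreal_leI)
    show "enn2ereal (\<integral>\<^sup>+x. ennreal (- f x) \<partial>P) \<le> enn2ereal (\<integral>\<^sup>+x. ennreal (- u x) \<partial>P)"
      using le by (auto simp: less_eq_ennreal.rep_eq[symmetric] intro!: nn_integral_mono ennreal_leI)
  qed
  finally show ?thesis .
qed

text \<open>Finiteness rules out \<open>\<infinity> - \<infinity>\<close>, which is
  \<open>\<infinity>\<close> in \<open>ereal\<close> and would break the symmetry under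
  negation.\<close>

lemma ext_expectation_uminus:
  assumes "(\<integral>\<^sup>+x. ennreal (- f x) \<partial>P) < \<infinity>"
  shows "ext_expectation P (\<lambda>x. - f x) = - ext_expectation P f"
  using assms unfolding ext_expectation_def
  by (cases "\<integral>\<^sup>+x. ennreal (f x) \<partial>P"; cases "\<integral>\<^sup>+x. ennreal (- f x) \<partial>P") auto

text \<open>Jensen's inequality, in the tangent form \<open>y \<le> exp y / c - 1 + ln c\<close> with \<open>c\<close> the moment
  generating function, so that no integrability of \<open>l\<close> is needed.\<close>

lemma elog_mgf_ge:
  assumes "prob_space P" and [measurable]: "l \<in> borel_measurable P" and "z \<le> 0"
    and t: "ext_expectation P l \<le> ereal t"
  shows "ereal (z * t) - elog (\<integral>\<^sup>+x. ennreal (exp (z * l x)) \<partial>P) \<le> 0"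
proof -
  interpret prob_space P by fact
  define J where "J = (\<integral>\<^sup>+x. ennreal (exp (z * l x)) \<partial>P)"
  show ?thesis
  proof (cases "J = \<infinity> \<or> z = 0")
    case True
    moreover have "J = 1" if "z = 0"
      using that emeasure_space_1 by (simp add: J_def)
    ultimately have "J = \<infinity> \<or> z = 0 \<and> J = 1"
      by blast
    then show ?thesis
      unfolding J_def[symmetric] by (auto simp: elog_def zero_ereal_def)
  next
    case False
    then have "z < 0" "J < \<infinity>"
      using assms(3) by (auto simp: top.not_eq_extremum)
    then have int: "integrable P (\<lambda>x. exp (z * l x))"
      by (intro integrableI_nonneg) (auto simp: J_def)
    define c where "c = (\<integral>x. exp (z * l x) \<partial>P)"
    have J: "J = ennreal c"
      unfolding J_def c_def using int by (intro nn_integral_eq_integral) auto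
    have "c \<noteq> 0"
      unfolding c_def using int by (subst integral_nonneg_eq_0_iff_AE) auto
    moreover have "c \<ge> 0"
      unfolding c_def by (intro integral_nonneg_AE) auto
    ultimately have c: "c > 0" by simp
    \<comment> \<open>Dividing the tangent inequality by the negative \<open>z\<close> turns it into
      an integrable minorant of \<open>l\<close>, whose integral is \<open>ln c / z\<close>.\<close>
    define u where "u x = (exp (z * l x) / c - 1 + ln c) / z" for x
    have int_u: "integrable P u"
      unfolding u_def using int by (intro integrable_divide Bochner_Integration.integrable_add Bochner_Integration.integrable_diff) auto
    have "u x \<le> l x" for x
    proof -
      have "z * l x - ln c \<le> exp (z * l x - ln c) - 1"
        using exp_ge_add_one_self[of "z * l x - ln c"] by linarith
      also have "exp (z * l x - ln c) = exp (z * l x) / c"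
        using c by (simp add: exp_diff)
      finally have "l x * z \<le> exp (z * l x) / c - 1 + ln c"
        by (simp add: mult.commute)
      then show ?thesis
        using \<open>z < 0\<close> by (simp add: u_def neg_divide_le_eq)
    qed
    with int_u have "ereal (\<integral>x. u x \<partial>P) \<le> ereal t"
      using ext_expectation_ge t order_trans by blast
    moreover have "(\<integral>x. u x \<partial>P) = ln c / z"
      unfolding u_def using int c by (simp add: prob_space c_def[symmetric])
    ultimately have "z * t \<le> ln c"
      using \<open>z < 0\<close> by (simp add: neg_divide_le_eq mult.commute)
    then show ?thesis
      using c by (simp add: J_def[symmetric] J elog_def ennreal_eq_0_iff zero_ereal_def)
  qed
qed

context density_pair
begin

text \<open>\<open>mgf (1/2)\<close> is the Hellinger affinity of the two densities. The minorant
  comes from \<open>1 + y \<le> exp y\<close> at half the log-likelihood ratio, where the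
  exponential is integrable.\<close>

lemma ext_expectation_pos:
  assumes "mgf (1/2) < 1"
  shows "0 < ext_expectation (law M g) (llr h g)"
proof -
  have "integrable (law M g) (\<lambda>x. 2 * (1 - exp (1/2 * llr g h x)))"
    using integrable_exp[of "1/2"] by auto
  moreover have "2 * (1 - exp (1/2 * llr g h x)) \<le> llr h g x" for x
  proof -
    have "1 + 1/2 * llr g h x \<le> exp (1/2 * llr g h x)"
      by (rule exp_ge_add_one_self)
    then show ?thesis
      unfolding llr_swap[of h g x] right_diff_distrib by linarith
  qed
  ultimately have "ereal (\<integral>x. 2 * (1 - exp (1/2 * llr g h x)) \<partial>law M g) \<le> ext_expectation (law M g) (llr h g)"
    by (rule ext_expectation_ge)
  also have "(\<integral>x. 2 * (1 - exp (1/2 * llr g h x)) \<partial>law M g) = 2 * (1 - mgf (1/2))"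
    using integrable_exp[of "1/2"] G.prob_space by (simp add: mgf_def)
  finally have "ereal (2 * (1 - mgf (1/2))) \<le> ext_expectation (law M g) (llr h g)" .
  moreover have "0 < ereal (2 * (1 - mgf (1/2)))"
    using assms by simp
  ultimately show ?thesis
    by (rule less_le_trans[rotated])
qed

text \<open>Otherwise the exponential of half the log-likelihood ratio would have mean square
  distance 0 from 1, so the ratio would vanish almost surely and its expectation would be 0. As the
  affinity is symmetric, this and the preceding lemma carry the separation condition from
  \<open>g\<close> over to \<open>h\<close>.\<close>

lemma mgf_half_less_1:
  assumes "0 < ext_expectation (law M g) (llr h g)"
  shows "mgf (1/2) < 1"
proof (rule ccontr)
  assume "\<not> mgf (1/2) < 1"
  define w where "w x = (1 - exp (1/2 * llr g h x))\<^sup>2" for x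
  have w_eq: "w x = 1 - 2 * exp (1/2 * llr g h x) + exp (llr g h x)" for x
  proof -
    have "exp (llr g h x) = (exp (1/2 * llr g h x))\<^sup>2"
      by (simp add: power2_eq_square exp_add[symmetric])
    then show ?thesis
      by (simp add: w_def power2_diff)
  qed
  have int_w: "integrable (law M g) w"
    unfolding w_eq[abs_def] using integrable_exp[of "1/2"] integrable_exp_l by auto
  have "(\<integral>x. w x \<partial>law M g) = 2 * (1 - mgf (1/2))"
    unfolding w_eq[abs_def] using integrable_exp[of "1/2"] integrable_exp_l G.prob_space
    by (simp add: mgf_def integral_exp_l)
  moreover have "(\<integral>x. w x \<partial>law M g) \<ge> 0"
    by (intro integral_nonneg_AE) (auto simp: w_def)
  ultimately have "(\<integral>x. w x \<partial>law M g) = 0"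
    using \<open>\<not> mgf (1/2) < 1\<close> by simp
  then have "AE x in law M g. w x = 0"
    using int_w by (subst (asm) integral_nonneg_eq_0_iff_AE) (auto simp: w_def)
  then have "AE x in law M g. llr h g x = 0"
    by eventually_elim (simp add: w_def llr_swap[of h g])
  then have "(\<integral>\<^sup>+x. ennreal (llr h g x) \<partial>law M g) = 0" "(\<integral>\<^sup>+x. ennreal (- llr h g x) \<partial>law M g) = 0"
    by (subst nn_integral_0_iff_AE; auto)+
  with assms show False
    by (simp add: ext_expectation_def)
qed

lemma nn_integral_llr_finite: "(\<integral>\<^sup>+x. ennreal (llr g h x) \<partial>law M g) < \<infinity>"
proof -
  have "(\<integral>\<^sup>+x. ennreal (llr g h x) \<partial>law M g) \<le> (\<integral>\<^sup>+x. ennreal (exp (llr g h x)) \<partial>law M g)"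
  proof (intro nn_integral_mono ennreal_leI)
    fix x show "llr g h x \<le> exp (llr g h x)"
      using exp_ge_add_one_self[of "llr g h x"] by linarith
  qed
  also have "\<dots> = ennreal 1"
    using integrable_exp_l integral_exp_l by (subst nn_integral_eq_integral) auto
  finally show ?thesis
    using le_less_trans by fastforce
qed

lemma ext_expectation_swap: "ext_expectation (law M g) (llr g h) = - ext_expectation (law M g) (llr h g)"
  using ext_expectation_uminus[where P = "law M g" and f = "llr h g"] nn_integral_llr_finite
  by (simp add: llr_swap[of h g])

end

section \<open>Rate functions and the value of the Chernoff index\<close>

context density_pair
begin

text \<open>For \<open>z \<le> 0\<close> Jensen's inequality under \<open>g\<close> applies; in
  \<open>[0, 1]\<close> both terms are controlled directly; for \<open>z \<ge> 1\<close> the change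
  of measure produces the exponent \<open>1 - z \<le> 0\<close> under \<open>h\<close>, and Jensen's
  inequality applies again.\<close>

lemma rate_function_le:
  assumes \<rho>: "0 \<le> \<rho>" "\<And>z. 0 \<le> z \<Longrightarrow> z \<le> 1 \<Longrightarrow> exp (- \<rho>) \<le> mgf z"
    and t: "ext_expectation (law M g) (llr g h) \<le> ereal t" "t \<le> 0"
    and h: "ext_expectation (law M h) (llr h g) \<le> 0"
  shows "rate_function M g h t \<le> ereal \<rho>"
  unfolding rate_function_def
proof (rule SUP_least)
  fix z :: real
  consider "z \<le> 0" | "0 \<le> z" "z \<le> 1" | "1 \<le> z" by linarith
  then show "ereal (z * t) - elog (llr_mgf M g h z) \<le> ereal \<rho>"
  proof cases
    case 1
    have "ereal (z * t) - elog (llr_mgf M g h z) \<le> 0"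
      unfolding llr_mgf_def using 1 t(1) by (intro elog_mgf_ge G.prob_space_axioms) auto
    also have "0 \<le> ereal \<rho>"
      using \<rho>(1) by simp
    finally show ?thesis .
  next
    case 2
    have "- \<rho> \<le> ln (mgf z)"
      using \<rho>(2)[OF 2] mgf_pos[OF 2] by (simp add: ln_ge_iff)
    moreover have "z * t \<le> 0"
      using 2 t by (simp add: mult_nonneg_nonpos)
    ultimately show ?thesis
      using 2 mgf_pos[OF 2] by (simp add: llr_mgf_eq elog_def ennreal_eq_0_iff)
  next
    case 3
    have "ereal (z * t) - elog (llr_mgf M g h z) \<le> ereal ((1 - z) * 0) - elog (llr_mgf M h g (1 - z))"
      using 3 t by (intro ereal_minus_mono) (auto simp: mult_nonneg_nonpos swap.llr_mgf_swap)
    also have "\<dots> \<le> 0"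
      unfolding llr_mgf_def using 3 h by (intro elog_mgf_ge H.prob_space_axioms) (auto simp: zero_ereal_def)
    also have "0 \<le> ereal \<rho>"
      using \<rho>(1) by simp
    finally show ?thesis .
  qed
qed

lemma rate_function_0_ge:
  assumes "0 \<le> z" "z \<le> 1" "mgf z = exp (- \<rho>)"
  shows "ereal \<rho> \<le> rate_function M g h 0"
proof -
  have "ereal \<rho> = ereal (z * 0) - elog (llr_mgf M g h z)"
    using assms by (simp add: llr_mgf_eq elog_def ennreal_eq_0_iff)
  also have "\<dots> \<le> rate_function M g h 0"
    unfolding rate_function_def by (rule SUP_upper) simp
  finally show ?thesis .
qed

end

context density_pair
begin

text \<open>For \<open>t \<le> 0\<close> the first rate function is at most \<open>\<rho>\<close>,
  for \<open>t \<ge> 0\<close> the second one by symmetry, and at \<open>t = 0\<close> both reach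
  it. So the index reduces to the minimum of \<open>mgf\<close> over \<open>[0, 1]\<close>.\<close>

theorem chernoff_index_eq:
  assumes "0 < ext_expectation (law M g) (llr h g)"
  obtains \<rho> where "\<rho> > 0" "chernoff_index M g h = ereal \<rho>" "\<exists>z\<in>{0..1}. mgf z = exp (- \<rho>)"
    "\<And>z. 0 \<le> z \<Longrightarrow> z \<le> 1 \<Longrightarrow> exp (- \<rho>) \<le> mgf z"
proof -
  have half: "mgf (1/2) < 1"
    by (rule mgf_half_less_1[OF assms])
  obtain z0 where z0: "z0 \<in> {0..1}" "\<And>z. z \<in> {0..1} \<Longrightarrow> mgf z0 \<le> mgf z"
    using continuous_attains_inf[OF compact_Icc _ continuous_on_mgf] by auto
  define \<rho> where "\<rho> = - ln (mgf z0)"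
  have pos: "mgf z0 > 0"
    using z0 by (intro mgf_pos) auto
  then have mgf_z0: "mgf z0 = exp (- \<rho>)"
    by (simp add: \<rho>_def)
  have "mgf z0 < 1"
    using z0(2)[of "1/2"] half by simp
  then have \<rho>: "\<rho> > 0"
    using pos by (simp add: \<rho>_def)
  have min: "exp (- \<rho>) \<le> mgf z" if "0 \<le> z" "z \<le> 1" for z
    using z0(2)[of z] mgf_z0 that by simp
  have min_swap: "exp (- \<rho>) \<le> swap.mgf z" if "0 \<le> z" "z \<le> 1" for z
    using min[of "1 - z"] that by (simp add: mgf_swap)
  \<comment> \<open>The one-sided separation condition is transferred to \<open>h\<close>, which
    places \<open>t = 0\<close> inside the range of the supremum.\<close>
  have "swap.mgf (1/2) < 1"
    using half mgf_swap[of "1/2"] by simp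
  note Eh = swap.ext_expectation_pos[OF this] and Eg = assms
  have neg: "ext_expectation (law M g) (llr g h) < 0" "ext_expectation (law M h) (llr h g) < 0"
    using Eh Eg by (simp_all add: ext_expectation_swap swap.ext_expectation_swap ereal_uminus_less_reorder)
  have "chernoff_index M g h \<le> ereal \<rho>"
    unfolding chernoff_index_def
  proof (rule SUP_least)
    fix t assume "t \<in> {t. ext_expectation (law M g) (llr g h) < ereal t \<and> ereal t < ext_expectation (law M h) (llr g h)}"
    then have t: "ext_expectation (law M g) (llr g h) \<le> ereal t" "ext_expectation (law M h) (llr h g) \<le> ereal (- t)"
      by (auto simp: swap.ext_expectation_swap ereal_uminus_le_reorder)
    show "min (rate_function M g h t) (rate_function M h g (- t)) \<le> ereal \<rho>"
    proof (cases "t \<le> 0")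
      case True
      then show ?thesis
        using rate_function_le[OF _ min t(1)] \<rho> neg by (intro min.coboundedI1) auto
    next
      case False
      then show ?thesis
        using swap.rate_function_le[OF _ min_swap t(2)] \<rho> neg by (intro min.coboundedI2) auto
    qed
  qed
  moreover have "ereal \<rho> \<le> min (rate_function M g h 0) (rate_function M h g (- 0))"
    using rate_function_0_ge[of z0 \<rho>] swap.rate_function_0_ge[of "1 - z0" \<rho>] z0(1) mgf_z0 by (simp add: mgf_swap)
  then have "ereal \<rho> \<le> chernoff_index M g h"
    unfolding chernoff_index_def
    using neg Eh by (intro SUP_upper2[of 0]) (auto simp: zero_ereal_def)
  ultimately show thesis
    using \<rho> mgf_z0 z0(1) min by (intro that[of \<rho>]) auto
qed

end

section \<open>Semicontinuity of the moment generating function in the densities\<close>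

lemma exp_young: "0 \<le> z \<Longrightarrow> z \<le> 1 \<Longrightarrow> exp (z * y) \<le> (1 - z) + z * exp (y::real)"
  using convex_onD[OF exp_convex, of z 0 y] by (simp add: mult.commute)

lemma (in likelihood_tilting) mgf_le_1:
  assumes "0 \<le> z" "z \<le> 1"
  shows "mgf z \<le> 1"
proof -
  have "mgf z \<le> (\<integral>x. (1 - z) + z * exp (l x) \<partial>P)"
    unfolding mgf_def using integrable_exp_l assms
    by (intro integral_mono exp_young integrable_exp) auto
  also have "\<dots> = 1"
    using integrable_exp_l integral_exp_l prob_space by simp
  finally show ?thesis .
qed

text \<open>Fatou's lemma applies to the nonnegative functions \<open>(1 - z) g + z h - g powr (1 - z) h powr z\<close>,
  whose integrals are one minus the moment generating function.\<close>

lemma mgf_upper_semicontinuous: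
  fixes u v :: "nat \<Rightarrow> real \<Rightarrow> real"
  assumes pair0: "density_pair M g h" and pairs: "\<And>k. density_pair M (u k) (v k)"
    and ac: "\<And>k. absolutely_continuous (law M g) (law M (u k))" "\<And>k. absolutely_continuous (law M g) (law M (v k))"
    and pos: "\<And>k. AE x in law M g. 0 < u k x \<and> 0 < v k x"
    and lim: "AE x in law M g. (\<lambda>k. u k x) \<longlonglongrightarrow> g x \<and> (\<lambda>k. v k x) \<longlonglongrightarrow> h x"
    and z: "0 \<le> z" "z \<le> 1"
    and a: "\<And>k. a k \<le> likelihood_tilting.mgf (law M (u k)) (llr (u k) (v k)) z" "a \<longlonglongrightarrow> b"
  shows "b \<le> likelihood_tilting.mgf (law M g) (llr g h) z"
proof -
  interpret P: density_pair M g h by fact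
  interpret Q: density_pair M "u k" "v k" for k by (rule pairs)
  \<comment> \<open>Everything is divided by the limit density \<open>g\<close>, so that Fatou's
    lemma runs under the single law for which convergence is assumed.\<close>
  define \<phi> where "\<phi> u v x = (1 - z) * (u x / g x) + z * (v x / g x) - u x / g x * exp (z * llr u v x)" for u v :: "real \<Rightarrow> real" and x
  have \<phi>_nonneg: "0 \<le> \<phi> u v x" if "0 < g x" "0 < u x" "0 < v x" for u v :: "real \<Rightarrow> real" and x
  proof -
    have "u x / g x * exp (z * llr u v x) \<le> u x / g x * ((1 - z) + z * exp (llr u v x))"
      using that by (intro mult_left_mono exp_young z) auto
    also have "\<dots> = (1 - z) * (u x / g x) + z * (v x / g x)"
      using that by (simp add: llr_def exp_diff field_simps)
    finally show ?thesis by (simp add: \<phi>_def)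
  qed
  have int: "(\<integral>\<^sup>+x. ennreal (\<phi> u v x) \<partial>law M g) = ennreal (1 - likelihood_tilting.mgf (law M u) (llr u v) z)"
    if "density_pair M u v" "absolutely_continuous (law M g) (law M u)" "absolutely_continuous (law M g) (law M v)"
      "AE x in law M g. 0 < u x \<and> 0 < v x" for u v
  proof -
    interpret R: density_pair M u v by fact
    have law_u: "law M u = density (law M g) (\<lambda>x. ennreal (u x / g x))"
      by (intro law_change_of_density that P.nonneg R.nonneg) auto
    have law_v: "law M v = density (law M g) (\<lambda>x. ennreal (v x / g x))"
      by (intro law_change_of_density that P.nonneg R.nonneg) auto
    have nn: "AE x in law M g. 0 \<le> u x / g x" "AE x in law M g. 0 \<le> v x / g x"
      using P.nonneg R.nonneg by auto
    have iu: "integrable (law M g) (\<lambda>x. u x / g x)" "(\<integral>x. u x / g x \<partial>law M g) = 1"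
    proof -
      show "integrable (law M g) (\<lambda>x. u x / g x)"
        using R.G.integrable_const[of "1::real"] nn unfolding law_u by (simp add: integrable_density)
      have "1 = (\<integral>x. (1::real) \<partial>law M u)"
        using R.G.prob_space by simp
      also have "\<dots> = (\<integral>x. u x / g x *\<^sub>R 1 \<partial>law M g)"
        using nn by (subst law_u, subst integral_density) auto
      finally show "(\<integral>x. u x / g x \<partial>law M g) = 1"
        by simp
    qed
    have iv: "integrable (law M g) (\<lambda>x. v x / g x)" "(\<integral>x. v x / g x \<partial>law M g) = 1"
    proof -
      show "integrable (law M g) (\<lambda>x. v x / g x)"
        using R.H.integrable_const[of "1::real"] nn unfolding law_v by (simp add: integrable_density)
      have "1 = (\<integral>x. (1::real) \<partial>law M v)"
        using R.H.prob_space by simp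
      also have "\<dots> = (\<integral>x. v x / g x *\<^sub>R 1 \<partial>law M g)"
        using nn by (subst law_v, subst integral_density) auto
      finally show "(\<integral>x. v x / g x \<partial>law M g) = 1"
        by simp
    qed
    have ie: "integrable (law M g) (\<lambda>x. u x / g x * exp (z * llr u v x))"
      using R.integrable_exp[OF z] nn unfolding law_u by (subst (asm) integrable_density) auto
    have ie': "(\<integral>x. u x / g x * exp (z * llr u v x) \<partial>law M g) = R.mgf z"
      unfolding R.mgf_def using nn by (subst law_u, subst integral_density) auto
    note iu' = integrable_mult_right[OF iu(1), of "1 - z"] and iv' = integrable_mult_right[OF iv(1), of z]
    have "integrable (law M g) (\<phi> u v)"
      unfolding \<phi>_def[abs_def] by (intro Bochner_Integration.integrable_diff Bochner_Integration.integrable_add iu' iv' ie)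
    moreover have "(\<integral>x. \<phi> u v x \<partial>law M g) = 1 - R.mgf z"
      unfolding \<phi>_def Bochner_Integration.integral_diff[OF Bochner_Integration.integrable_add[OF iu' iv'] ie]
        Bochner_Integration.integral_add[OF iu' iv'] integral_mult_right_zero iu(2) iv(2) ie' by simp
    moreover have "AE x in law M g. 0 \<le> \<phi> u v x"
      using that(4) P.pos_g by eventually_elim (auto intro: \<phi>_nonneg)
    ultimately show ?thesis
      by (subst nn_integral_eq_integral) auto
  qed
  have lim_\<phi>: "AE x in law M g. liminf (\<lambda>k. ennreal (\<phi> (u k) (v k) x)) = ennreal (\<phi> g h x)"
    using lim P.pos_g
  proof eventually_elim
    case (elim x)
    then have "(\<lambda>k. \<phi> (u k) (v k) x) \<longlonglongrightarrow> \<phi> g h x"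
      unfolding \<phi>_def llr_def by (intro tendsto_intros) auto
    then show ?case
      by (intro lim_imp_Liminf) auto
  qed
  have "ennreal (1 - P.mgf z) = (\<integral>\<^sup>+x. ennreal (\<phi> g h x) \<partial>law M g)"
    using P.pos_g by (intro int[symmetric] P.density_pair_axioms P.ac_gh) (auto simp: absolutely_continuous_def)
  also have "\<dots> = (\<integral>\<^sup>+x. liminf (\<lambda>k. ennreal (\<phi> (u k) (v k) x)) \<partial>law M g)"
    using lim_\<phi> by (intro nn_integral_cong_AE) auto
  also have "\<dots> \<le> liminf (\<lambda>k. \<integral>\<^sup>+x. ennreal (\<phi> (u k) (v k) x) \<partial>law M g)"
    unfolding \<phi>_def by (intro nn_integral_liminf) measurable
  also have "\<dots> = liminf (\<lambda>k. ennreal (1 - Q.mgf k z))"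
    by (simp add: int[OF pairs ac pos])
  also have "\<dots> \<le> liminf (\<lambda>k. ennreal (1 - a k))"
    using a(1) by (intro Liminf_mono always_eventually allI ennreal_leI) simp
  also have "\<dots> = ennreal (1 - b)"
    by (intro lim_imp_Liminf tendsto_intros a(2)) simp
  finally have "ennreal (1 - P.mgf z) \<le> ennreal (1 - b)" .
  \<comment> \<open>\<open>ennreal\<close> maps negative numbers to 0, so comparing the two
    differences requires that they are nonnegative.\<close>
  moreover have "b \<le> 1"
    using a(2) order_trans[OF a(1) Q.mgf_le_1[OF z]] by (intro LIMSEQ_le_const2[of a b 1]) auto
  ultimately show ?thesis
    using P.mgf_le_1[OF z] by (auto simp: ennreal_le_iff2)
qed

section \<open>The generalized likelihood ratio test\<close>

text \<open>The form in which the asymptotics use the assumptions: one exceptional set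
  \<open>N\<close>, null under all members, real-valued measurable versions of the scores, and
  increments in place of gradients, separately for \<open>ln (g \<theta> x)\<close> and
  \<open>ln (h \<gamma> x)\<close>. The two families are then interchangeable, and one proof covers
  both errors.\<close>

locale regular_families =
  fixes M :: "real measure" and \<Theta> :: "'a::euclidean_space set" and \<Gamma> :: "'b::euclidean_space set"
    and g :: "'a \<Rightarrow> real \<Rightarrow> real" and h :: "'b \<Rightarrow> real \<Rightarrow> real"
    and N :: "real set" and S1 S2 :: "real \<Rightarrow> real" and r K \<eta> x0 :: real
  assumes compact: "compact \<Theta>" "compact \<Gamma>" and nonempty: "\<Theta> \<noteq> {}" "\<Gamma> \<noteq> {}"
    and pairs: "\<And>f1 f2. f1 \<in> g ` \<Theta> \<union> h ` \<Gamma> \<Longrightarrow> f2 \<in> g ` \<Theta> \<union> h ` \<Gamma> \<Longrightarrow> density_pair M f1 f2"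
    and null: "\<And>f. f \<in> g ` \<Theta> \<union> h ` \<Gamma> \<Longrightarrow> N \<in> null_sets (law M f)"
    and pos: "\<And>x \<theta>. x \<notin> N \<Longrightarrow> \<theta> \<in> \<Theta> \<Longrightarrow> 0 < g \<theta> x" "\<And>x \<gamma>. x \<notin> N \<Longrightarrow> \<gamma> \<in> \<Gamma> \<Longrightarrow> 0 < h \<gamma> x"
    and cont: "\<And>x. x \<notin> N \<Longrightarrow> continuous_on \<Theta> (\<lambda>\<theta>. g \<theta> x)" "\<And>x. x \<notin> N \<Longrightarrow> continuous_on \<Gamma> (\<lambda>\<gamma>. h \<gamma> x)"
    and const_pos: "r > 0" "K > 0" "\<eta> > 0"
    and lipschitz: "\<And>x \<theta> \<theta>'. x \<notin> N \<Longrightarrow> \<theta> \<in> \<Theta> \<Longrightarrow> \<theta>' \<in> \<Theta> \<Longrightarrow> dist \<theta> \<theta>' < r \<Longrightarrow>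
        \<bar>ln (g \<theta> x) - ln (g \<theta>' x)\<bar> \<le> K * S1 x * dist \<theta> \<theta>'"
      "\<And>x \<gamma> \<gamma>'. x \<notin> N \<Longrightarrow> \<gamma> \<in> \<Gamma> \<Longrightarrow> \<gamma>' \<in> \<Gamma> \<Longrightarrow> dist \<gamma> \<gamma>' < r \<Longrightarrow>
        \<bar>ln (h \<gamma> x) - ln (h \<gamma>' x)\<bar> \<le> K * S2 x * dist \<gamma> \<gamma>'"
    and scores_measurable: "S1 \<in> borel_measurable M" "S2 \<in> borel_measurable M"
    and tails: "\<And>f x. f \<in> g ` \<Theta> \<union> h ` \<Gamma> \<Longrightarrow> x > x0 \<Longrightarrow> measure (law M f) {y\<in>space M. x < S1 y} \<le> exp (- (ln x powr (1 + \<eta>)))"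
      "\<And>f x. f \<in> g ` \<Theta> \<union> h ` \<Gamma> \<Longrightarrow> x > x0 \<Longrightarrow> measure (law M f) {y\<in>space M. x < S2 y} \<le> exp (- (ln x powr (1 + \<eta>)))"

sublocale regular_families \<subseteq> swap: regular_families M \<Gamma> \<Theta> h g N S2 S1 r K \<eta> x0
proof (rule regular_families.intro)
  fix f1 f2 assume "f1 \<in> h ` \<Gamma> \<union> g ` \<Theta>" "f2 \<in> h ` \<Gamma> \<union> g ` \<Theta>"
  then show "density_pair M f1 f2"
    by (intro pairs) blast+
next
  fix f assume "f \<in> h ` \<Gamma> \<union> g ` \<Theta>"
  then have f: "f \<in> g ` \<Theta> \<union> h ` \<Gamma>"
    by blast
  show "N \<in> null_sets (law M f)"
    using f by (rule null)
  fix x assume x: "x > x0"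
  show "measure (law M f) {y\<in>space M. x < S1 y} \<le> exp (- (ln x powr (1 + \<eta>)))"
    "measure (law M f) {y\<in>space M. x < S2 y} \<le> exp (- (ln x powr (1 + \<eta>)))"
    using f x by (rule tails)+
qed (fact compact nonempty pos cont const_pos lipschitz scores_measurable | erule (1) pos cont | erule (4) lipschitz)+

context regular_families
begin

lemma uniform_error_bound:
  fixes \<rho> \<epsilon> :: real
  assumes mgf: "\<And>\<theta> \<gamma>. \<theta> \<in> \<Theta> \<Longrightarrow> \<gamma> \<in> \<Gamma> \<Longrightarrow>
      \<exists>z\<in>{0..1}. likelihood_tilting.mgf (law M (g \<theta>)) (llr (g \<theta>) (h \<gamma>)) z \<le> exp (- \<rho>)"
    and "\<epsilon> > 0"
  shows "\<forall>\<^sub>F n in sequentially. \<forall>\<theta>\<in>\<Theta>. \<forall>A\<in>sets (iid (law M (g \<theta>)) n).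
     (\<forall>X\<in>A. (\<forall>j<n. X j \<notin> N) \<longrightarrow> (\<exists>\<gamma>\<in>\<Gamma>. 0 \<le> (\<Sum>j<n. llr (g \<theta>) (h \<gamma>) (X j)))) \<longrightarrow>
     measure (iid (law M (g \<theta>)) n) A \<le> exp (- (real n * (\<rho> - \<epsilon>)))"
proof (rule uniform_chernoff_bound[where S = S2 and K = K and r = r and \<eta> = \<eta> and ?x0.0 = x0])
  show "bounded \<Gamma>"
    using compact by (simp add: compact_imp_bounded)
  show "likelihood_tilting (law M (g \<theta>)) (llr (g \<theta>) (h \<gamma>))" if "\<theta> \<in> \<Theta>" "\<gamma> \<in> \<Gamma>" for \<theta> \<gamma>
  proof -
    interpret density_pair M "g \<theta>" "h \<gamma>"
      using that by (intro pairs) auto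
    show ?thesis by unfold_locales
  qed
  show "prob_space (law M (g \<theta>))" if "\<theta> \<in> \<Theta>" for \<theta>
  proof -
    interpret density_pair M "g \<theta>" "g \<theta>"
      using that by (intro pairs) auto
    show ?thesis by unfold_locales
  qed
  show "\<bar>llr (g \<theta>) (h \<gamma>) x - llr (g \<theta>) (h \<gamma>') x\<bar> \<le> K * S2 x * dist \<gamma> \<gamma>'"
    if "x \<notin> N" "\<gamma> \<in> \<Gamma>" "\<gamma>' \<in> \<Gamma>" "dist \<gamma> \<gamma>' < r" for \<theta> x \<gamma> \<gamma>'
    using lipschitz(2)[OF that] by (simp add: llr_def)
qed (use mgf null const_pos scores_measurable tails \<open>\<epsilon> > 0\<close> in auto)

end

context regular_families
begin

text \<open>A single error probability equal to 0 would spoil the supremum of logarithms, as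
  \<open>ln 0 = 0\<close> is at least every other term. The sample likelihood ratio is strictly
  positive, so an event charged by one member is charged by all.\<close>

lemma iid_positive_transfer:
  assumes "\<theta> \<in> \<Theta>" "\<theta>' \<in> \<Theta>" "C \<in> sets (iid (law M (g \<theta>)) n)" "0 < measure (iid (law M (g \<theta>')) n) C"
  shows "0 < measure (iid (law M (g \<theta>)) n) C"
proof (rule ccontr)
  interpret P: density_pair M "g \<theta>" "g \<theta>'"
    using assms by (intro pairs) auto
  have iid: "iid (law M (g \<theta>')) n = density (iid (law M (g \<theta>)) n) (\<lambda>X. ennreal (exp (\<Sum>i<n. llr (g \<theta>) (g \<theta>') (X i))))"
    using P.iid_alt_eq[of n] by (simp add: P.alt_eq)
  assume "\<not> 0 < measure (iid (law M (g \<theta>)) n) C"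
  then have "C \<in> null_sets (iid (law M (g \<theta>)) n)"
    using assms(3) by (simp add: not_less measure_le_0_iff null_sets_def P.iid_P.emeasure_eq_measure)
  then have "AE X in iid (law M (g \<theta>)) n. X \<notin> C"
    by (rule AE_not_in)
  then have "C \<in> null_sets (iid (law M (g \<theta>')) n)"
    unfolding iid using assms(3) by (subst null_sets_density_iff) auto
  then show False
    using assms(4) by (simp add: measure_def null_sets_def)
qed

text \<open>\<open>C n\<close> enters only through what errors imply: on it no
  \<open>\<theta>\<close> strictly beats all \<open>\<gamma>\<close>, off it no
  \<open>\<gamma>\<close> strictly beats all \<open>\<theta>\<close>. This is symmetric, so
  complements serve for the exchanged families. The upper bound is uniform in
  \<open>\<theta>\<close>; for the lower one the single member \<open>\<theta>s\<close> is
  enough.\<close>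

theorem sup_log_error_asymptotics:
  fixes \<rho> :: real
  assumes mgf: "\<And>\<theta> \<gamma>. \<theta> \<in> \<Theta> \<Longrightarrow> \<gamma> \<in> \<Gamma> \<Longrightarrow>
      \<exists>z\<in>{0..1}. likelihood_tilting.mgf (law M (g \<theta>)) (llr (g \<theta>) (h \<gamma>)) z \<le> exp (- \<rho>)"
    and \<rho>: "\<rho> > 0" and opt: "\<theta>s \<in> \<Theta>" "\<gamma>s \<in> \<Gamma>"
      "\<And>z. 0 \<le> z \<Longrightarrow> z \<le> 1 \<Longrightarrow> exp (- \<rho>) \<le> likelihood_tilting.mgf (law M (g \<theta>s)) (llr (g \<theta>s) (h \<gamma>s)) z"
    and C_sets: "\<And>n. C n \<in> sets (iid M n)"
    and C: "\<And>n X \<theta>. X \<in> C n \<Longrightarrow> (\<And>j. j < n \<Longrightarrow> X j \<notin> N) \<Longrightarrow> \<theta> \<in> \<Theta> \<Longrightarrow> \<exists>\<gamma>\<in>\<Gamma>. 0 \<le> (\<Sum>j<n. llr (g \<theta>) (h \<gamma>) (X j))"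
    and C_compl: "\<And>n X \<gamma>. X \<in> space (iid M n) - C n \<Longrightarrow> (\<And>j. j < n \<Longrightarrow> X j \<notin> N) \<Longrightarrow> \<gamma> \<in> \<Gamma> \<Longrightarrow> \<exists>\<theta>\<in>\<Theta>. 0 \<le> (\<Sum>j<n. llr (h \<gamma>) (g \<theta>) (X j))"
  shows "(\<lambda>n. (SUP \<theta>\<in>\<Theta>. ln (measure (iid (law M (g \<theta>)) n) (C n))) / real n) \<longlonglongrightarrow> - \<rho>"
proof -
  have sets_iid [simp]: "sets (iid (law M f) n) = sets (iid M n)" for f n
    by (intro sets_PiM_cong) auto
  have C_sets': "C n \<in> sets (iid (law M f) n)" for f n
    unfolding sets_iid by (rule C_sets)
  have space_iid [simp]: "space (iid (law M f) n) = space (iid M n)" for f n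
    by (simp add: space_PiM)
  interpret P: density_pair M "g \<theta>s" "h \<gamma>s"
    using opt by (intro pairs) auto
  have mgf_swap: "\<exists>z\<in>{0..1}. likelihood_tilting.mgf (law M (h \<gamma>)) (llr (h \<gamma>) (g \<theta>)) z \<le> exp (- \<rho>)"
    if \<gamma>\<theta>: "\<gamma> \<in> \<Gamma>" "\<theta> \<in> \<Theta>" for \<gamma> \<theta>
  proof -
    interpret Q: density_pair M "g \<theta>" "h \<gamma>"
      using \<gamma>\<theta> by (intro pairs) auto
    obtain z where "z \<in> {0..1}" "Q.mgf z \<le> exp (- \<rho>)"
      using mgf[OF \<gamma>\<theta>(2,1)] by auto
    then show ?thesis
      by (intro bexI[of _ "1 - z"]) (auto simp: Q.mgf_swap)
  qed
  have attained: "\<exists>z\<in>{0..1}. P.mgf z = exp (- \<rho>)"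
    using mgf[OF opt(1,2)] opt(3) by (meson antisym atLeastAtMost_iff)
  \<comment> \<open>There is no circularity: the second error at \<open>\<gamma>s\<close> is bounded
    by the Chernoff argument for the exchanged families, and only then enters the lower bound at
    \<open>\<theta>s\<close>.\<close>
  have other: "\<forall>\<^sub>F n in sequentially. measure (iid P.alt n) (space (iid (law M (g \<theta>s)) n) - C n) \<le> exp (- (real n * (\<rho> - \<epsilon>)))"
    if "\<epsilon> > 0" for \<epsilon>
    using swap.uniform_error_bound[OF mgf_swap that]
  proof (rule eventually_mono)
    fix n assume *: "\<forall>\<gamma>\<in>\<Gamma>. \<forall>A\<in>sets (iid (law M (h \<gamma>)) n).
        (\<forall>X\<in>A. (\<forall>j<n. X j \<notin> N) \<longrightarrow> (\<exists>\<theta>\<in>\<Theta>. 0 \<le> (\<Sum>j<n. llr (h \<gamma>) (g \<theta>) (X j)))) \<longrightarrow>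
        measure (iid (law M (h \<gamma>)) n) A \<le> exp (- (real n * (\<rho> - \<epsilon>)))"
    have "space (iid M n) - C n \<in> sets (iid (law M (h \<gamma>s)) n)"
      using C_sets[of n] by auto
    with * opt(2) C_compl[where n = n] have "measure (iid (law M (h \<gamma>s)) n) (space (iid M n) - C n) \<le> exp (- (real n * (\<rho> - \<epsilon>)))"
      by blast
    then show "measure (iid P.alt n) (space (iid (law M (g \<theta>s)) n) - C n) \<le> exp (- (real n * (\<rho> - \<epsilon>)))"
      by (simp add: P.alt_eq)
  qed
  have lower: "\<forall>\<^sub>F n in sequentially. exp (- (real n * (\<rho> + \<epsilon>))) \<le> measure (iid (law M (g \<theta>s)) n) (C n)"
    if "\<epsilon> > 0" for \<epsilon>
    using \<rho> attained opt(3) _ other that by (rule P.error_lower_bound) (rule C_sets' | assumption)+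
  show ?thesis
  proof (rule tendstoI)
    fix e :: real assume "e > 0"
    define \<epsilon> where "\<epsilon> = e / 2"
    have \<epsilon>: "\<epsilon> > 0" "\<epsilon> < e"
      using \<open>e > 0\<close> by (auto simp: \<epsilon>_def)
    have error_bound: "\<forall>\<^sub>F n in sequentially. \<forall>\<theta>\<in>\<Theta>. \<forall>A\<in>sets (iid (law M (g \<theta>)) n).
        (\<forall>X\<in>A. (\<forall>j<n. X j \<notin> N) \<longrightarrow> (\<exists>\<gamma>\<in>\<Gamma>. 0 \<le> (\<Sum>j<n. llr (g \<theta>) (h \<gamma>) (X j)))) \<longrightarrow>
        measure (iid (law M (g \<theta>)) n) A \<le> exp (- (real n * (\<rho> - \<epsilon>)))"
      using mgf \<epsilon>(1) by (rule uniform_error_bound)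
    show "\<forall>\<^sub>F n in sequentially. dist ((SUP \<theta>\<in>\<Theta>. ln (measure (iid (law M (g \<theta>)) n) (C n))) / real n) (- \<rho>) < e"
      using error_bound lower[OF \<epsilon>(1)] eventually_gt_at_top[of 0]
    proof eventually_elim
      case (elim n)
      have upper: "measure (iid (law M (g \<theta>)) n) (C n) \<le> exp (- (real n * (\<rho> - \<epsilon>)))" if "\<theta> \<in> \<Theta>" for \<theta>
        using elim(1) that C_sets[of n] C[where n = n and \<theta> = \<theta>] by (simp add: Ball_def)
      have pos_s: "0 < measure (iid (law M (g \<theta>s)) n) (C n)"
        using elim(2) exp_gt_zero less_le_trans by blast
      have pos: "0 < measure (iid (law M (g \<theta>)) n) (C n)" if "\<theta> \<in> \<Theta>" for \<theta>
        using iid_positive_transfer[OF that opt(1) _ pos_s] C_sets by simp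
      have le: "ln (measure (iid (law M (g \<theta>)) n) (C n)) \<le> - (real n * (\<rho> - \<epsilon>))" if "\<theta> \<in> \<Theta>" for \<theta>
        using upper[OF that] pos[OF that] by (subst ln_exp[symmetric], subst ln_le_cancel_iff) auto
      define s where "s = (SUP \<theta>\<in>\<Theta>. ln (measure (iid (law M (g \<theta>)) n) (C n)))"
      have s_le: "s \<le> - (real n * (\<rho> - \<epsilon>))"
        unfolding s_def using nonempty(1) le by (intro cSUP_least)
      have "- (real n * (\<rho> + \<epsilon>)) \<le> ln (measure (iid (law M (g \<theta>s)) n) (C n))"
        using elim(2) pos_s by (simp add: ln_ge_iff)
      also have "\<dots> \<le> s"
        unfolding s_def using le opt(1) by (intro cSUP_upper bdd_aboveI2)
      finally have "- (\<rho> + \<epsilon>) \<le> s / real n"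
        using elim(3) by (simp add: field_simps)
      moreover have "s / real n \<le> - (\<rho> - \<epsilon>)"
        using s_le elim(3) by (simp add: field_simps)
      ultimately show ?case
        using \<epsilon> unfolding s_def[symmetric] dist_real_def by linarith
    qed
  qed
qed

text \<open>The rejection region agrees, off the exceptional samples, with a countable combination over
  dense subsets of the parameter sets.\<close>

lemma rejection_region_measurable_version:
  obtains C where "C \<in> sets (iid M n)"
    "\<And>X. X \<in> samples M n \<Longrightarrow> (\<And>j. j < n \<Longrightarrow> X j \<notin> N) \<Longrightarrow> X \<in> rejection_region M \<Theta> \<Gamma> g h n 1 \<longleftrightarrow> X \<in> C"
    "\<And>X \<theta>. X \<in> C \<Longrightarrow> (\<And>j. j < n \<Longrightarrow> X j \<notin> N) \<Longrightarrow> \<theta> \<in> \<Theta> \<Longrightarrow> \<exists>\<gamma>\<in>\<Gamma>. 0 \<le> (\<Sum>j<n. llr (g \<theta>) (h \<gamma>) (X j))"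
    "\<And>X \<gamma>. X \<in> space (iid M n) - C \<Longrightarrow> (\<And>j. j < n \<Longrightarrow> X j \<notin> N) \<Longrightarrow> \<gamma> \<in> \<Gamma> \<Longrightarrow> \<exists>\<theta>\<in>\<Theta>. 0 \<le> (\<Sum>j<n. llr (h \<gamma>) (g \<theta>) (X j))"
proof -
  obtain D1 where D1: "countable D1" "D1 \<subseteq> \<Theta>" "\<Theta> \<subseteq> closure D1"
    using separable by blast
  obtain D2 where D2: "countable D2" "D2 \<subseteq> \<Gamma>" "\<Gamma> \<subseteq> closure D2"
    using separable by blast
  have cl: "closure D1 = \<Theta>" "closure D2 = \<Gamma>"
    using D1 D2 compact[THEN compact_imp_closed] by (simp_all add: antisym closure_minimal)
  have g_meas [measurable]: "g \<theta> \<in> borel_measurable M" if "\<theta> \<in> D1" for \<theta>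
  proof -
    interpret density_pair M "g \<theta>" "g \<theta>"
      using that D1 by (intro pairs) auto
    show ?thesis by measurable
  qed
  have h_meas [measurable]: "h \<gamma> \<in> borel_measurable M" if "\<gamma> \<in> D2" for \<gamma>
  proof -
    interpret density_pair M "h \<gamma>" "h \<gamma>"
      using that D2 by (intro pairs) auto
    show ?thesis by measurable
  qed
  define G where "G X \<theta> = (\<Prod>j<n. g \<theta> (X j))" for X :: "nat \<Rightarrow> real" and \<theta>
  define H where "H X \<gamma> = (\<Prod>j<n. h \<gamma> (X j))" for X :: "nat \<Rightarrow> real" and \<gamma>
  have G_meas: "(\<lambda>X. G X \<theta>) \<in> borel_measurable (iid M n)" if "\<theta> \<in> D1" for \<theta>
    unfolding G_def using g_meas[OF that] by measurable
  have H_meas: "(\<lambda>X. H X \<gamma>) \<in> borel_measurable (iid M n)" if "\<gamma> \<in> D2" for \<gamma>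
    unfolding H_def using h_meas[OF that] by measurable
  \<comment> \<open>A rational \<open>q\<close> separates the larger supremum from the smaller one;
    over countable dense parameter sets this is a countable combination of measurable sets.\<close>
  define C where "C = (\<Union>q\<in>\<rat>. (\<Union>\<gamma>\<in>D2. {X\<in>space (iid M n). q < H X \<gamma>}) \<inter>
     (space (iid M n) - (\<Union>\<theta>\<in>D1. {X\<in>space (iid M n). q < G X \<theta>})))"
  have C_sets: "C \<in> sets (iid M n)"
    unfolding C_def
    by (intro sets.countable_UN'' sets.Int sets.Diff sets.top countable_rat D1(1) D2(1)
        borel_measurable_less borel_measurable_const H_meas G_meas)
  have *: "\<exists>\<theta>0\<in>\<Theta>. \<exists>\<gamma>0\<in>\<Gamma>. (\<forall>\<theta>\<in>\<Theta>. 0 < G X \<theta> \<and> G X \<theta> \<le> G X \<theta>0) \<and> (\<forall>\<gamma>\<in>\<Gamma>. 0 < H X \<gamma> \<and> H X \<gamma> \<le> H X \<gamma>0) \<and>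
      (X \<in> C \<longleftrightarrow> G X \<theta>0 < H X \<gamma>0) \<and> (X \<in> rejection_region M \<Theta> \<Gamma> g h n 1 \<longleftrightarrow> G X \<theta>0 < H X \<gamma>0)"
    if X: "X \<in> space (iid M n)" and good: "\<And>j. j < n \<Longrightarrow> X j \<notin> N" for X
  proof -
    have contG: "continuous_on \<Theta> (G X)" and contH: "continuous_on \<Gamma> (H X)"
      unfolding G_def H_def using good by (auto intro!: continuous_on_prod cont)
    have posG: "0 < G X \<theta>" if "\<theta> \<in> \<Theta>" for \<theta>
      unfolding G_def using good that by (intro prod_pos ballI pos) auto
    have posH: "0 < H X \<gamma>" if "\<gamma> \<in> \<Gamma>" for \<gamma>
      unfolding H_def using good that by (intro prod_pos ballI pos) auto
    obtain \<theta>0 where \<theta>0: "\<theta>0 \<in> \<Theta>" "\<And>\<theta>. \<theta> \<in> \<Theta> \<Longrightarrow> G X \<theta> \<le> G X \<theta>0"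
      using continuous_attains_sup[OF compact(1) nonempty(1) contG] by auto
    obtain \<gamma>0 where \<gamma>0: "\<gamma>0 \<in> \<Gamma>" "\<And>\<gamma>. \<gamma> \<in> \<Gamma> \<Longrightarrow> H X \<gamma> \<le> H X \<gamma>0"
      using continuous_attains_sup[OF compact(2) nonempty(2) contH] by auto
    have "(SUP \<theta>\<in>\<Theta>. G X \<theta>) = G X \<theta>0"
      using \<theta>0 by (intro cSup_eq_maximum) auto
    moreover have "(SUP \<gamma>\<in>\<Gamma>. H X \<gamma>) = H X \<gamma>0"
      using \<gamma>0 by (intro cSup_eq_maximum) auto
    ultimately have rej: "X \<in> rejection_region M \<Theta> \<Gamma> g h n 1 \<longleftrightarrow> G X \<theta>0 < H X \<gamma>0"
      using X posG[OF \<theta>0(1)]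
      by (simp add: rejection_region_def samples_def gen_likelihood_ratio_def G_def[symmetric] H_def[symmetric] less_divide_eq)
    have "X \<in> C \<longleftrightarrow> G X \<theta>0 < H X \<gamma>0"
    proof
      assume "X \<in> C"
      then obtain q \<gamma> where q: "\<gamma> \<in> D2" "q < H X \<gamma>" "\<And>\<theta>. \<theta> \<in> D1 \<Longrightarrow> G X \<theta> \<le> q"
        using X by (force simp: C_def not_less)
      \<comment> \<open>By continuity the bound on the dense set \<open>D1\<close> extends to its
        closure, which contains the maximizer.\<close>
      have "G X \<theta>0 \<le> q"
        using continuous_le_on_closure[of D1 "G X" \<theta>0 q] contG \<theta>0(1) q(3) by (simp add: cl)
      also have "q < H X \<gamma>0"
        using q(1,2) \<gamma>0(2)[of \<gamma>] D2 by auto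
      finally show "G X \<theta>0 < H X \<gamma>0" .
    next
      assume "G X \<theta>0 < H X \<gamma>0"
      then obtain q where q: "q \<in> \<rat>" "G X \<theta>0 < q" "q < H X \<gamma>0"
        using Rats_dense_in_real by blast
      have "\<exists>\<gamma>\<in>D2. q < H X \<gamma>"
      proof (rule ccontr)
        assume "\<not> (\<exists>\<gamma>\<in>D2. q < H X \<gamma>)"
        then have "H X \<gamma>0 \<le> q"
          using continuous_le_on_closure[of D2 "H X" \<gamma>0 q] contH \<gamma>0(1) by (auto simp: cl not_less)
        with q show False by simp
      qed
      moreover have "\<not> q < G X \<theta>" if "\<theta> \<in> D1" for \<theta>
        using \<theta>0(2)[of \<theta>] that D1 q by auto
      ultimately show "X \<in> C"
        unfolding C_def using X q(1) by blast
    qed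
    with rej \<theta>0 \<gamma>0 posG posH show ?thesis
      by blast
  qed
  have ln_G: "(\<Sum>j<n. ln (g \<theta> (X j))) = ln (G X \<theta>)" if "\<And>j. j < n \<Longrightarrow> X j \<notin> N" "\<theta> \<in> \<Theta>" for X \<theta>
    unfolding G_def using pos(1)[OF that(1) that(2)] by (subst ln_prod) (auto simp: less_le)
  have ln_H: "(\<Sum>j<n. ln (h \<gamma> (X j))) = ln (H X \<gamma>)" if "\<And>j. j < n \<Longrightarrow> X j \<notin> N" "\<gamma> \<in> \<Gamma>" for X \<gamma>
    unfolding H_def using pos(2)[OF that(1) that(2)] by (subst ln_prod) (auto simp: less_le)
  show thesis
  proof (rule that[OF C_sets])
    show "X \<in> rejection_region M \<Theta> \<Gamma> g h n 1 \<longleftrightarrow> X \<in> C" if "X \<in> samples M n" "\<And>j. j < n \<Longrightarrow> X j \<notin> N" for X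
      using *[of X] that by (auto simp: samples_def)
    show "\<exists>\<gamma>\<in>\<Gamma>. 0 \<le> (\<Sum>j<n. llr (g \<theta>) (h \<gamma>) (X j))" if "X \<in> C" "\<And>j. j < n \<Longrightarrow> X j \<notin> N" "\<theta> \<in> \<Theta>" for X \<theta>
    proof -
      have "X \<in> space (iid M n)"
        using that(1) by (auto simp: C_def)
      with *[of X] that obtain \<gamma>0 where "\<gamma>0 \<in> \<Gamma>" "0 < G X \<theta>" "G X \<theta> \<le> H X \<gamma>0"
        by (meson less_imp_le order_trans)
      then show ?thesis
        using ln_G[OF that(2,3)] ln_H[OF that(2)]
        by (intro bexI[of _ \<gamma>0]) (auto simp: llr_def sum_subtractf)
    qed
    show "\<exists>\<theta>\<in>\<Theta>. 0 \<le> (\<Sum>j<n. llr (h \<gamma>) (g \<theta>) (X j))" if "X \<in> space (iid M n) - C" "\<And>j. j < n \<Longrightarrow> X j \<notin> N" "\<gamma> \<in> \<Gamma>" for X \<gamma>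
    proof -
      from *[of X] that obtain \<theta>0 where "\<theta>0 \<in> \<Theta>" "0 < H X \<gamma>" "H X \<gamma> \<le> G X \<theta>0"
        by (metis DiffD1 DiffD2 linorder_not_less order_trans)
      then show ?thesis
        using ln_H[OF that(2,3)] ln_G[OF that(2)]
        by (intro bexI[of _ \<theta>0]) (auto simp: llr_def sum_subtractf)
    qed
  qed
qed

end

text \<open>The actual rejection region need not lie in the product \<sigma>-algebra. It agrees with
  a measurable set off the samples that have a coordinate in \<open>N\<close>, and these form a null
  set, so it is measurable for the completion.\<close>

lemma measure_completion_iid_eq:
  assumes "prob_space P" "N \<in> null_sets P" "B \<in> sets (iid P n)" "A \<subseteq> space (iid P n)"
    and iff: "\<And>X. X \<in> space (iid P n) \<Longrightarrow> (\<And>j. j < n \<Longrightarrow> X j \<notin> N) \<Longrightarrow> X \<in> A \<longleftrightarrow> X \<in> B"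
  shows "measure (completion (iid P n)) A = measure (iid P n) B"
proof -
  define Z where "Z = (\<Union>j<n. {X\<in>space (iid P n). X j \<in> N})"
  interpret prob_space "iid P n"
    using assms(1) by (intro prob_space_PiM)
  have N_sets: "N \<in> sets P"
    using assms(2) by auto
  have "measure P N = 0"
    using assms(2) by (simp add: measure_eq_0_null_sets)
  then have "{X\<in>space (iid P n). X j \<in> N} \<in> null_sets (iid P n)" if "j < n" for j
    using measure_iid_component[OF assms(1) N_sets that]
    by (intro null_setsI) (auto simp: emeasure_eq_measure)
  then have Z: "Z \<in> null_sets (iid P n)"
    unfolding Z_def by (intro null_sets_UN') auto
  have iff': "X \<in> A \<longleftrightarrow> X \<in> B" if "X \<in> space (iid P n)" "X \<notin> Z" for X
    using that by (intro iff) (auto simp: Z_def)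
  then have A_eq: "A = (B - Z) \<union> (A \<inter> Z)"
    using assms(4) sets.sets_into_space[OF assms(3)] by blast
  have "A \<inter> Z \<in> null_sets (completion (iid P n))"
    using null_sets_completionI[OF Z] by (rule null_sets_completion_subset[rotated]) auto
  then have A_sets: "A \<in> sets (completion (iid P n))"
    using assms(3) Z by (subst A_eq) auto
  have "AE X in iid P n. X \<in> A \<longleftrightarrow> X \<in> B"
    using AE_not_in[OF Z] AE_space by eventually_elim (rule iff')
  then have "measure (completion (iid P n)) A = measure (completion (iid P n)) B"
    using assms(3) A_sets by (intro measure_eq_AE AE_completion) auto
  then show ?thesis
    using assms(3) by simp
qed

text \<open>The direct method: a minimizing sequence of pairs has a convergent subsequence, and
  upper semicontinuity of the moment generating function at each fixed \<open>z\<close> bounds the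
  index of the limit pair by the infimum.\<close>

lemma (in regular_families) optimal_pair_exists:
  fixes R :: "'a \<Rightarrow> 'b \<Rightarrow> real"
  assumes R_nonneg: "\<And>\<theta> \<gamma>. \<theta> \<in> \<Theta> \<Longrightarrow> \<gamma> \<in> \<Gamma> \<Longrightarrow> 0 \<le> R \<theta> \<gamma>"
    and R_le: "\<And>\<theta> \<gamma> z. \<theta> \<in> \<Theta> \<Longrightarrow> \<gamma> \<in> \<Gamma> \<Longrightarrow> 0 \<le> z \<Longrightarrow> z \<le> 1 \<Longrightarrow>
        exp (- R \<theta> \<gamma>) \<le> likelihood_tilting.mgf (law M (g \<theta>)) (llr (g \<theta>) (h \<gamma>)) z"
    and R_eq: "\<And>\<theta> \<gamma>. \<theta> \<in> \<Theta> \<Longrightarrow> \<gamma> \<in> \<Gamma> \<Longrightarrow>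
        \<exists>z\<in>{0..1}. likelihood_tilting.mgf (law M (g \<theta>)) (llr (g \<theta>) (h \<gamma>)) z = exp (- R \<theta> \<gamma>)"
  obtains \<theta>s \<gamma>s where "\<theta>s \<in> \<Theta>" "\<gamma>s \<in> \<Gamma>" "\<And>\<theta> \<gamma>. \<theta> \<in> \<Theta> \<Longrightarrow> \<gamma> \<in> \<Gamma> \<Longrightarrow> R \<theta>s \<gamma>s \<le> R \<theta> \<gamma>"
proof -
  define V where "V = (\<lambda>(\<theta>, \<gamma>). R \<theta> \<gamma>) ` (\<Theta> \<times> \<Gamma>)"
  have V: "V \<noteq> {}" "bdd_below V"
    using nonempty R_nonneg by (auto simp: V_def intro!: bdd_belowI[of _ 0])
  define \<rho> where "\<rho> = Inf V"
  have "\<exists>p\<in>\<Theta> \<times> \<Gamma>. R (fst p) (snd p) < \<rho> + 1 / real (Suc k)" for k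
    using cInf_lessD[OF V(1), of "\<rho> + 1 / real (Suc k)"] by (auto simp: V_def \<rho>_def)
  then obtain p where p: "\<And>k. p k \<in> \<Theta> \<times> \<Gamma>" "\<And>k. R (fst (p k)) (snd (p k)) < \<rho> + 1 / real (Suc k)"
    by metis
  obtain l s where l: "l \<in> \<Theta> \<times> \<Gamma>" and s: "strict_mono s" "(p \<circ> s) \<longlonglongrightarrow> l"
    using seq_compactE[OF compact_imp_seq_compact[OF compact_Times[OF compact]], of p] p(1) by auto
  obtain \<theta>s \<gamma>s where l_eq: "l = (\<theta>s, \<gamma>s)" by (cases l)
  have opt: "\<theta>s \<in> \<Theta>" "\<gamma>s \<in> \<Gamma>"
    using l by (auto simp: l_eq)
  define \<theta> where "\<theta> k = fst (p (s k))" for k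
  define \<gamma> where "\<gamma> k = snd (p (s k))" for k
  have in_sets: "\<theta> k \<in> \<Theta>" "\<gamma> k \<in> \<Gamma>" for k
    using p(1)[of "s k"] by (auto simp: \<theta>_def \<gamma>_def mem_Times_iff)
  have lim: "\<theta> \<longlonglongrightarrow> \<theta>s" "\<gamma> \<longlonglongrightarrow> \<gamma>s"
    using tendsto_fst[OF s(2)] tendsto_snd[OF s(2)] by (simp_all add: \<theta>_def[abs_def] \<gamma>_def[abs_def] o_def l_eq)
  \<comment> \<open>The index at step \<open>k\<close> is below
    \<open>\<rho> + 1 / Suc (s k)\<close>, so \<open>a k\<close> bounds the moment generating
    function from below for all \<open>z\<close> at once.\<close>
  define a where "a k = exp (- (\<rho> + 1 / real (Suc (s k))))" for k
  have "(\<lambda>k. 1 / real (Suc (s k))) \<longlonglongrightarrow> 0"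
    using LIMSEQ_subseq_LIMSEQ[OF LIMSEQ_inverse_real_of_nat s(1)] by (simp add: o_def inverse_eq_divide)
  then have "(\<lambda>k. exp (- (\<rho> + 1 / real (Suc (s k))))) \<longlonglongrightarrow> exp (- (\<rho> + 0))"
    by (intro tendsto_intros)
  then have a_lim: "a \<longlonglongrightarrow> exp (- \<rho>)"
    by (simp add: a_def[abs_def])
  have good: "AE x in law M (g \<theta>s). x \<notin> N"
    using opt null[of "g \<theta>s"] by (intro AE_not_in) auto
  have le: "exp (- \<rho>) \<le> likelihood_tilting.mgf (law M (g \<theta>s)) (llr (g \<theta>s) (h \<gamma>s)) z" if z: "0 \<le> z" "z \<le> 1" for z
  proof (rule mgf_upper_semicontinuous[where u = "\<lambda>k. g (\<theta> k)" and v = "\<lambda>k. h (\<gamma> k)" and a = a])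
    show "density_pair M (g \<theta>s) (h \<gamma>s)" "density_pair M (g (\<theta> k)) (h (\<gamma> k))" for k
      using opt in_sets by (auto intro!: pairs)
    show "absolutely_continuous (law M (g \<theta>s)) (law M (g (\<theta> k)))"
        "absolutely_continuous (law M (g \<theta>s)) (law M (h (\<gamma> k)))" for k
      using opt in_sets[of k] density_pair.ac_gh[OF pairs] by auto
    show "AE x in law M (g \<theta>s). 0 < g (\<theta> k) x \<and> 0 < h (\<gamma> k) x" for k
      using good by eventually_elim (use pos in_sets in auto)
    show "AE x in law M (g \<theta>s). (\<lambda>k. g (\<theta> k) x) \<longlonglongrightarrow> g \<theta>s x \<and> (\<lambda>k. h (\<gamma> k) x) \<longlonglongrightarrow> h \<gamma>s x"
      using good
    proof eventually_elim
      case (elim x)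
      show ?case
        using continuous_on_tendsto_compose[OF cont(1)[OF elim] lim(1) opt(1)]
          continuous_on_tendsto_compose[OF cont(2)[OF elim] lim(2) opt(2)] in_sets by simp
    qed
    show "a k \<le> likelihood_tilting.mgf (law M (g (\<theta> k))) (llr (g (\<theta> k)) (h (\<gamma> k))) z" for k
    proof -
      have "a k \<le> exp (- R (\<theta> k) (\<gamma> k))"
        using p(2)[of "s k"] by (simp add: a_def \<theta>_def \<gamma>_def less_imp_le)
      also have "\<dots> \<le> likelihood_tilting.mgf (law M (g (\<theta> k))) (llr (g (\<theta> k)) (h (\<gamma> k))) z"
        by (intro R_le in_sets z)
      finally show ?thesis .
    qed
  qed (use z a_lim in auto)
  have "R \<theta>s \<gamma>s \<le> \<rho>"
    using R_eq[OF opt] le by fastforce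
  moreover have "\<rho> \<le> R \<theta> \<gamma>" if "\<theta> \<in> \<Theta>" "\<gamma> \<in> \<Gamma>" for \<theta> \<gamma>
    unfolding \<rho>_def using that by (intro cInf_lower V(2)) (auto simp: V_def)
  ultimately show thesis
    using opt by (intro that[of \<theta>s \<gamma>s]) (auto intro: order_trans)
qed

text \<open>The event \<open>S x = \<infinity>\<close> lies in every tail event and the bounds tend
  to 0, so \<open>S\<close> is finite almost surely. A function measurable for the completion agrees
  almost everywhere with a measurable one.\<close>

lemma score_real_version:
  assumes "prob_space (law M f)" and bound: "score_tail_bound M f S \<eta> x0" and "\<eta> > 0" and nonneg: "\<And>x. 0 \<le> S x"
  obtains s where "s \<in> borel_measurable M" "AE x in law M f. S x = ereal (s x)"
proof -
  define C where "C = completion (law M f)"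
  interpret C: prob_space C
  proof
    show "emeasure C (space C) = 1"
      using prob_space.emeasure_space_1[OF assms(1)] by (simp add: C_def)
  qed
  have S [measurable]: "S \<in> borel_measurable C"
    using bound by (simp add: score_tail_bound_def C_def)
  define E where "E = {y\<in>space C. S y = \<infinity>}"
  have E [measurable]: "E \<in> sets C"
    unfolding E_def by measurable
  have "measure C E \<le> exp (- (ln x powr (1 + \<eta>)))" if "x > x0" for x
  proof -
    have "measure C E \<le> measure C {y\<in>space C. ereal x < S y}"
      by (intro C.finite_measure_mono) (auto simp: E_def)
    also have "{y\<in>space C. ereal x < S y} = {y\<in>space M. ereal x < S y}"
      by (simp add: C_def)
    also have "measure C \<dots> \<le> exp (- (ln x powr (1 + \<eta>)))"
      using bound that by (simp add: score_tail_bound_def C_def)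
    finally show ?thesis .
  qed
  then have "\<forall>\<^sub>F x in at_top. measure C E \<le> exp (- (ln x powr (1 + \<eta>)))"
    using eventually_gt_at_top by (rule eventually_mono[rotated])
  moreover have "((\<lambda>x. exp (- (ln x powr (1 + \<eta>)))) \<longlongrightarrow> 0) at_top"
    using \<open>\<eta> > 0\<close> by real_asymp
  ultimately have "measure C E \<le> 0"
    by (intro tendsto_lowerbound) auto
  then have "E \<in> null_sets C"
    by (intro null_setsI) (auto simp: C.emeasure_eq_measure measure_le_0_iff)
  then have "AE x in C. x \<notin> E"
    by (rule AE_not_in)
  then have "AE x in C. S x \<noteq> \<infinity>"
    using AE_space by eventually_elim (auto simp: E_def)
  then have fin: "AE x in law M f. S x \<noteq> \<infinity>"
    unfolding C_def AE_completion_iff .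
  have "(\<lambda>x. real_of_ereal (S x)) \<in> borel_measurable (completion (law M f))"
    using S unfolding C_def by measurable
  then obtain s where s: "s \<in> borel_measurable (law M f)" "AE x in law M f. real_of_ereal (S x) = s x"
    using completion_ex_borel_measurable_real by blast
  have "AE x in law M f. S x = ereal (s x)"
    using fin s(2)
  proof eventually_elim
    case (elim x)
    then show ?case
      using nonneg[of x] by (cases "S x") auto
  qed
  with s(1) show thesis
    by (intro that[of s]) auto
qed

text \<open>Each member of the families has its own completion, so the tail bounds are moved to one
  common measurable version \<open>s\<close> through equality almost everywhere.\<close>

lemma score_tail_transfer:
  assumes "score_tail_bound M f S \<eta> x0" "s \<in> borel_measurable M" "AE y in law M f. S y = ereal (s y)" "x > x0"
  shows "measure (law M f) {y\<in>space M. x < s y} \<le> exp (- (ln x powr (1 + \<eta>)))"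
proof -
  have S [measurable]: "S \<in> borel_measurable (completion (law M f))"
    using assms(1) by (simp add: score_tail_bound_def)
  have s: "{y\<in>space M. x < s y} \<in> sets (law M f)"
    using assms(2) by simp
  then have "measure (law M f) {y\<in>space M. x < s y} = measure (completion (law M f)) {y\<in>space M. x < s y}"
    by simp
  also have "\<dots> = measure (completion (law M f)) {y\<in>space M. ereal x < S y}"
  proof (rule measure_eq_AE)
    have "AE y in completion (law M f). S y = ereal (s y)"
      using assms(3) by (rule AE_completion)
    then show "AE y in completion (law M f). (y \<in> {y\<in>space M. x < s y}) = (y \<in> {y\<in>space M. ereal x < S y})"
      by eventually_elim auto
    have "{y\<in>space (completion (law M f)). ereal x < S y} \<in> sets (completion (law M f))"
      by measurable
    then show "{y\<in>space M. ereal x < S y} \<in> sets (completion (law M f))"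
      by simp
    show "{y\<in>space M. x < s y} \<in> sets (completion (law M f))"
      using s by simp
  qed
  also have "\<dots> \<le> exp (- (ln x powr (1 + \<eta>)))"
    using assms(1,4) by (simp add: score_tail_bound_def)
  finally show ?thesis .
qed

section \<open>From exponential rates to asymptotic equivalence\<close>

lemma asymp_equiv_linear:
  fixes a :: "nat \<Rightarrow> real"
  assumes "(\<lambda>n. a n / real n) \<longlonglongrightarrow> - \<rho>" "\<rho> > 0"
  shows "a \<sim>[sequentially] (\<lambda>n. - real n * \<rho>)"
proof (rule asymp_equivI')
  have "(\<lambda>n. (a n / real n) / - \<rho>) \<longlonglongrightarrow> - \<rho> / - \<rho>"
    using assms by (intro tendsto_intros) auto
  then show "(\<lambda>n. a n / (- real n * \<rho>)) \<longlonglongrightarrow> 1"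
    using assms(2) by (simp add: divide_divide_eq_left)
qed

theorem theorem4:
  fixes M :: "real measure"
    and \<Theta> :: "'a::euclidean_space set" and \<Gamma> :: "'b::euclidean_space set"
    and g :: "'a \<Rightarrow> real \<Rightarrow> real" and h :: "'b \<Rightarrow> real \<Rightarrow> real"
  assumes baseline: "sets M = sets borel"
    and nonempty: "\<Theta> \<noteq> {}" "\<Gamma> \<noteq> {}"
    and dens_g: "\<And>\<theta>. \<theta> \<in> \<Theta> \<Longrightarrow> prob_density M (g \<theta>)"
    and dens_h: "\<And>\<gamma>. \<gamma> \<in> \<Gamma> \<Longrightarrow> prob_density M (h \<gamma>)"
    and mutually_ac: "\<And>f1 f2. f1 \<in> g ` \<Theta> \<union> h ` \<Gamma> \<Longrightarrow> f2 \<in> g ` \<Theta> \<union> h ` \<Gamma> \<Longrightarrow>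
          absolutely_continuous (law M f1) (law M f2)"
    and A1: "(INF \<theta>\<in>\<Theta>. INF \<gamma>\<in>\<Gamma>. ext_expectation (law M (g \<theta>)) (llr (h \<gamma>) (g \<theta>))) > 0"
    and A2: "compact \<Theta>" "C1_boundary \<Theta>" "compact \<Gamma>" "C1_boundary \<Gamma>"
    and A3_diff: "\<And>f. f \<in> g ` \<Theta> \<union> h ` \<Gamma> \<Longrightarrow> differentiable_llr M \<Theta> \<Gamma> g h f"
    and A3_tail: "score_tails M \<Theta> \<Gamma> g h"
  shows "(\<lambda>n. SUP \<theta>\<in>\<Theta>. ln (iid_prob M (g \<theta>) n (rejection_region M \<Theta> \<Gamma> g h n 1)))
           \<sim>[sequentially]
         (\<lambda>n. SUP \<gamma>\<in>\<Gamma>. ln (iid_prob M (h \<gamma>) n (samples M n - rejection_region M \<Theta> \<Gamma> g h n 1)))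
       \<and> (\<lambda>n. SUP \<gamma>\<in>\<Gamma>. ln (iid_prob M (h \<gamma>) n (samples M n - rejection_region M \<Theta> \<Gamma> g h n 1)))
           \<sim>[sequentially]
         (\<lambda>n. - real n * real_of_ereal (INF \<theta>\<in>\<Theta>. INF \<gamma>\<in>\<Gamma>. chernoff_index M (g \<theta>) (h \<gamma>)))"
proof -
  define F where "F = g ` \<Theta> \<union> h ` \<Gamma>"
  obtain \<theta>0 \<gamma>0 where \<theta>0: "\<theta>0 \<in> \<Theta>" and \<gamma>0: "\<gamma>0 \<in> \<Gamma>"
    using nonempty by blast
  \<comment> \<open>By mutual absolute continuity a single member decides what is null: exceptional
    sets and score versions are found under \<open>f0\<close> and then transferred.\<close>
  define f0 where "f0 = g \<theta>0"
  have f0: "f0 \<in> F"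
    using \<theta>0 by (auto simp: F_def f0_def)
  have dens: "prob_density M f" if "f \<in> F" for f
    using that dens_g dens_h by (auto simp: F_def)
  have ac: "absolutely_continuous (law M f1) (law M f2)" if "f1 \<in> F" "f2 \<in> F" for f1 f2
    using mutually_ac that by (simp add: F_def)
  have ae: "AE x in law M f. Q x" if "AE x in law M f0. Q x" "f \<in> F" for Q f
    by (rule absolutely_continuous_AE[OF _ ac[OF f0 that(2)] that(1)]) simp
  obtain \<eta> x0 where "\<eta> > 0" and tails: "\<And>f. f \<in> F \<Longrightarrow> score_tail_bound M f (score_sup1 \<Theta> \<Gamma> g h) \<eta> x0"
      "\<And>f. f \<in> F \<Longrightarrow> score_tail_bound M f (score_sup2 \<Theta> \<Gamma> g h) \<eta> x0"
    using A3_tail \<theta>0 \<gamma>0 unfolding score_tails_def F_def by blast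
  have norm_le1: "ereal (norm (gradient_within \<Theta> (\<lambda>t. llr (g t) (h \<gamma>) x) \<theta>)) \<le> score_sup1 \<Theta> \<Gamma> g h x"
    if "\<theta> \<in> \<Theta>" "\<gamma> \<in> \<Gamma>" for \<theta> \<gamma> x
    unfolding score_sup1_def using that by (intro SUP_upper2[of \<theta>] SUP_upper2[of \<gamma>]) auto
  have norm_le2: "ereal (norm (gradient_within \<Gamma> (\<lambda>c. llr (g \<theta>) (h c) x) \<gamma>)) \<le> score_sup2 \<Theta> \<Gamma> g h x"
    if "\<theta> \<in> \<Theta>" "\<gamma> \<in> \<Gamma>" for \<theta> \<gamma> x
    unfolding score_sup2_def using that by (intro SUP_upper2[of \<theta>] SUP_upper2[of \<gamma>]) auto
  have score_nonneg: "0 \<le> score_sup1 \<Theta> \<Gamma> g h x" "0 \<le> score_sup2 \<Theta> \<Gamma> g h x" for x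
    using order_trans[OF _ norm_le1[OF \<theta>0 \<gamma>0]] order_trans[OF _ norm_le2[OF \<theta>0 \<gamma>0]] by simp_all
  have prob_f0: "prob_space (law M f0)"
    using dens[OF f0] by (simp add: prob_density_def)
  obtain S1 where S1: "S1 \<in> borel_measurable M" "AE x in law M f0. score_sup1 \<Theta> \<Gamma> g h x = ereal (S1 x)"
    by (rule score_real_version[OF prob_f0 tails(1)[OF f0] \<open>\<eta> > 0\<close> score_nonneg(1)])
  obtain S2 where S2: "S2 \<in> borel_measurable M" "AE x in law M f0. score_sup2 \<Theta> \<Gamma> g h x = ereal (S2 x)"
    by (rule score_real_version[OF prob_f0 tails(2)[OF f0] \<open>\<eta> > 0\<close> score_nonneg(2)])
  define good where "good x \<longleftrightarrow> (\<forall>\<theta>\<in>\<Theta>. \<forall>\<gamma>\<in>\<Gamma>. 0 < g \<theta> x \<and> 0 < h \<gamma> x \<and>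
        (\<lambda>t. llr (g t) (h \<gamma>) x) differentiable (at \<theta> within \<Theta>) \<and>
        (\<lambda>c. llr (g \<theta>) (h c) x) differentiable (at \<gamma> within \<Gamma>)) \<and>
      score_sup1 \<Theta> \<Gamma> g h x = ereal (S1 x) \<and> score_sup2 \<Theta> \<Gamma> g h x = ereal (S2 x)" for x
  have "AE x in law M f0. good x"
    using A3_diff[OF f0[unfolded F_def]] S1(2) S2(2) unfolding differentiable_llr_def
    by eventually_elim (simp add: good_def)
  then obtain N where N: "\<And>x. x \<in> space (law M f0) - N \<Longrightarrow> good x" "N \<in> null_sets (law M f0)"
    using AE_E3 by blast
  have space_M: "space M = UNIV"
    using sets_eq_imp_space_eq[OF baseline] by simp
  have good: "good x" if "x \<notin> N" for x
    using N(1) that by (auto simp: space_M)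
  have good_pos: "0 < g \<theta> x" "0 < h \<gamma> x" if "x \<notin> N" "\<theta> \<in> \<Theta>" "\<gamma> \<in> \<Gamma>" for x \<theta> \<gamma>
    using good[OF that(1)] that(2,3) by (auto simp: good_def)
  have good_diff: "(\<lambda>t. llr (g t) (h \<gamma>) x) differentiable (at \<theta> within \<Theta>)"
      "(\<lambda>c. llr (g \<theta>) (h c) x) differentiable (at \<gamma> within \<Gamma>)" if "x \<notin> N" "\<theta> \<in> \<Theta>" "\<gamma> \<in> \<Gamma>" for x \<theta> \<gamma>
    using good[OF that(1)] that(2,3) by (auto simp: good_def)
  have good_score: "norm (gradient_within \<Theta> (\<lambda>t. llr (g t) (h \<gamma>) x) \<theta>) \<le> S1 x"
      "norm (gradient_within \<Gamma> (\<lambda>c. llr (g \<theta>) (h c) x) \<gamma>) \<le> S2 x" if "x \<notin> N" "\<theta> \<in> \<Theta>" "\<gamma> \<in> \<Gamma>" for x \<theta> \<gamma>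
    using good[OF that(1)] norm_le1[OF that(2,3), of x] norm_le2[OF that(2,3), of x] by (auto simp: good_def)
  have null: "N \<in> null_sets (law M f)" if "f \<in> F" for f
    using ac[OF f0 that] N(2) by (auto simp: absolutely_continuous_def)
  have pair: "density_pair M f1 f2" if "f1 \<in> F" "f2 \<in> F" for f1 f2
  proof
    have "AE x in law M f. 0 < f1 x \<and> 0 < f2 x" if "f \<in> F" for f
      using AE_not_in[OF null[OF that]]
    proof eventually_elim
      case (elim x)
      then show ?case
        using good_pos[OF elim] \<theta>0 \<gamma>0 \<open>f1 \<in> F\<close> \<open>f2 \<in> F\<close> by (auto simp: F_def)
    qed
    then show "AE x in law M f1. 0 < f1 x \<and> 0 < f2 x" "AE x in law M f2. 0 < f1 x \<and> 0 < f2 x"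
      using that by auto
  qed (use that ac dens in auto)
  obtain r1 where r1: "r1 > 0" "\<And>(f::'a \<Rightarrow> real) B x y. \<lbrakk>\<And>p. p \<in> \<Theta> \<Longrightarrow> f differentiable (at p within \<Theta>);
       \<And>p. p \<in> \<Theta> \<Longrightarrow> norm (gradient_within \<Theta> f p) \<le> B; x \<in> \<Theta>; y \<in> \<Theta>; dist x y < r1\<rbrakk>
       \<Longrightarrow> \<bar>f x - f y\<bar> \<le> 9 * B * dist x y"
    using C1_boundary_uniform_lipschitz[OF A2(1,2)] by blast
  obtain r2 where r2: "r2 > 0" "\<And>(f::'b \<Rightarrow> real) B x y. \<lbrakk>\<And>p. p \<in> \<Gamma> \<Longrightarrow> f differentiable (at p within \<Gamma>);
       \<And>p. p \<in> \<Gamma> \<Longrightarrow> norm (gradient_within \<Gamma> f p) \<le> B; x \<in> \<Gamma>; y \<in> \<Gamma>; dist x y < r2\<rbrakk>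
       \<Longrightarrow> \<bar>f x - f y\<bar> \<le> 9 * B * dist x y"
    using C1_boundary_uniform_lipschitz[OF A2(3,4)] by blast
  have A1_pair: "0 < ext_expectation (law M (g \<theta>)) (llr (h \<gamma>) (g \<theta>))" if "\<theta> \<in> \<Theta>" "\<gamma> \<in> \<Gamma>" for \<theta> \<gamma>
    using less_INF_D[OF less_INF_D[OF A1 that(1)] that(2)] .
  have gF: "g \<theta> \<in> F" if "\<theta> \<in> \<Theta>" for \<theta>
    using that by (auto simp: F_def)
  have hF: "h \<gamma> \<in> F" if "\<gamma> \<in> \<Gamma>" for \<gamma>
    using that by (auto simp: F_def)
  \<comment> \<open>The constant 9 is the length of the detour through the interior relative to the
    distance of its end points.\<close>
  interpret R: regular_families M \<Theta> \<Gamma> g h N S1 S2 "min r1 r2" 9 \<eta> x0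
  proof (rule regular_families.intro; (unfold F_def[symmetric])?)
    fix x assume x: "x \<notin> N"
    \<comment> \<open>The conditions speak of log-likelihood ratios only. Fixing the partner
      \<open>\<gamma>0\<close> makes \<open>ln (h \<gamma>0 x)\<close> a constant, so continuity and
      increments in \<open>\<theta>\<close> pass to \<open>g \<theta>\<close> alone; likewise for
      \<open>h\<close> with \<open>\<theta>0\<close> fixed.\<close>
    have "continuous_on \<Theta> (\<lambda>t. llr (g t) (h \<gamma>0) x)"
      using good_diff(1)[OF x _ \<gamma>0] by (intro differentiable_imp_continuous_on) (auto simp: differentiable_on_def)
    then have "continuous_on \<Theta> (\<lambda>t. exp (ln (h \<gamma>0 x) - llr (g t) (h \<gamma>0) x))"
      by (intro continuous_intros)
    moreover have "exp (ln (h \<gamma>0 x) - llr (g t) (h \<gamma>0) x) = g t x" if "t \<in> \<Theta>" for t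
      using good_pos[OF x that \<gamma>0] by (simp add: llr_def)
    ultimately show "continuous_on \<Theta> (\<lambda>\<theta>. g \<theta> x)"
      by (simp cong: continuous_on_cong)
    have "continuous_on \<Gamma> (\<lambda>c. llr (g \<theta>0) (h c) x)"
      using good_diff(2)[OF x \<theta>0] by (intro differentiable_imp_continuous_on) (auto simp: differentiable_on_def)
    then have "continuous_on \<Gamma> (\<lambda>c. exp (ln (g \<theta>0 x) + llr (g \<theta>0) (h c) x))"
      by (intro continuous_intros)
    moreover have "exp (ln (g \<theta>0 x) + llr (g \<theta>0) (h c) x) = h c x" if "c \<in> \<Gamma>" for c
      using good_pos[OF x \<theta>0 that] by (simp add: llr_def)
    ultimately show "continuous_on \<Gamma> (\<lambda>\<gamma>. h \<gamma> x)"
      by (simp cong: continuous_on_cong)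
    show "\<bar>ln (g \<theta> x) - ln (g \<theta>' x)\<bar> \<le> 9 * S1 x * dist \<theta> \<theta>'"
      if "\<theta> \<in> \<Theta>" "\<theta>' \<in> \<Theta>" "dist \<theta> \<theta>' < min r1 r2" for \<theta> \<theta>'
      using r1(2)[OF good_diff(1)[OF x _ \<gamma>0] good_score(1)[OF x _ \<gamma>0], of \<theta> \<theta>'] that
      by (simp add: llr_def abs_minus_commute)
    show "\<bar>ln (h \<gamma> x) - ln (h \<gamma>' x)\<bar> \<le> 9 * S2 x * dist \<gamma> \<gamma>'"
      if "\<gamma> \<in> \<Gamma>" "\<gamma>' \<in> \<Gamma>" "dist \<gamma> \<gamma>' < min r1 r2" for \<gamma> \<gamma>'
      using r2(2)[OF good_diff(2)[OF x \<theta>0] good_score(2)[OF x \<theta>0], of \<gamma> \<gamma>'] that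
      by (simp add: llr_def)
  next
    fix f x assume f: "f \<in> F" and x: "x0 < x"
    show "measure (law M f) {y\<in>space M. x < S1 y} \<le> exp (- (ln x powr (1 + \<eta>)))"
      by (rule score_tail_transfer[OF tails(1)[OF f] S1(1) ae[OF S1(2) f] x])
    show "measure (law M f) {y\<in>space M. x < S2 y} \<le> exp (- (ln x powr (1 + \<eta>)))"
      by (rule score_tail_transfer[OF tails(2)[OF f] S2(1) ae[OF S2(2) f] x])
  qed (use A2 nonempty pair null r1(1) r2(1) \<open>\<eta> > 0\<close> S1(1) S2(1) good_pos \<theta>0 \<gamma>0 in auto)
  define R where "R \<theta> \<gamma> = real_of_ereal (chernoff_index M (g \<theta>) (h \<gamma>))" for \<theta> \<gamma>
  have R: "R \<theta> \<gamma> > 0 \<and> chernoff_index M (g \<theta>) (h \<gamma>) = ereal (R \<theta> \<gamma>) \<and>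
      (\<exists>z\<in>{0..1}. likelihood_tilting.mgf (law M (g \<theta>)) (llr (g \<theta>) (h \<gamma>)) z = exp (- R \<theta> \<gamma>)) \<and>
      (\<forall>z. 0 \<le> z \<longrightarrow> z \<le> 1 \<longrightarrow> exp (- R \<theta> \<gamma>) \<le> likelihood_tilting.mgf (law M (g \<theta>)) (llr (g \<theta>) (h \<gamma>)) z)"
    if \<theta>\<gamma>: "\<theta> \<in> \<Theta>" "\<gamma> \<in> \<Gamma>" for \<theta> \<gamma>
  proof -
    interpret P: density_pair M "g \<theta>" "h \<gamma>"
      using \<theta>\<gamma> by (intro pair gF hF)
    show ?thesis
      by (rule P.chernoff_index_eq[OF A1_pair[OF \<theta>\<gamma>]]) (simp add: R_def)
  qed
  obtain \<theta>s \<gamma>s where opt: "\<theta>s \<in> \<Theta>" "\<gamma>s \<in> \<Gamma>" "\<And>\<theta> \<gamma>. \<theta> \<in> \<Theta> \<Longrightarrow> \<gamma> \<in> \<Gamma> \<Longrightarrow> R \<theta>s \<gamma>s \<le> R \<theta> \<gamma>"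
    using R by (elim R.optimal_pair_exists[rotated 3]) (auto intro: less_imp_le)
  define \<rho> where "\<rho> = R \<theta>s \<gamma>s"
  have \<rho>: "\<rho> > 0"
    using R[OF opt(1,2)] by (simp add: \<rho>_def)
  have "(INF \<theta>\<in>\<Theta>. INF \<gamma>\<in>\<Gamma>. chernoff_index M (g \<theta>) (h \<gamma>)) = ereal \<rho>"
  proof (rule antisym)
    show "(INF \<theta>\<in>\<Theta>. INF \<gamma>\<in>\<Gamma>. chernoff_index M (g \<theta>) (h \<gamma>)) \<le> ereal \<rho>"
      using R[OF opt(1,2)] opt(1,2) by (intro INF_lower2[of \<theta>s] INF_lower2[of \<gamma>s]) (auto simp: \<rho>_def)
    show "ereal \<rho> \<le> (INF \<theta>\<in>\<Theta>. INF \<gamma>\<in>\<Gamma>. chernoff_index M (g \<theta>) (h \<gamma>))"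
      using R opt(3) by (intro INF_greatest) (auto simp: \<rho>_def)
  qed
  then have INF_eq: "real_of_ereal (INF \<theta>\<in>\<Theta>. INF \<gamma>\<in>\<Gamma>. chernoff_index M (g \<theta>) (h \<gamma>)) = \<rho>"
    by simp
  \<comment> \<open>One predicate holds all properties of the measurable version, so that a single
    choice provides the sets for all \<open>n\<close>.\<close>
  define version where "version n B \<longleftrightarrow> B \<in> sets (iid M n) \<and>
      (\<forall>X. X \<in> samples M n \<longrightarrow> (\<forall>j<n. X j \<notin> N) \<longrightarrow> (X \<in> rejection_region M \<Theta> \<Gamma> g h n 1 \<longleftrightarrow> X \<in> B)) \<and>
      (\<forall>X \<theta>. X \<in> B \<longrightarrow> (\<forall>j<n. X j \<notin> N) \<longrightarrow> \<theta> \<in> \<Theta> \<longrightarrow> (\<exists>\<gamma>\<in>\<Gamma>. 0 \<le> (\<Sum>j<n. llr (g \<theta>) (h \<gamma>) (X j)))) \<and>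
      (\<forall>X \<gamma>. X \<in> space (iid M n) - B \<longrightarrow> (\<forall>j<n. X j \<notin> N) \<longrightarrow> \<gamma> \<in> \<Gamma> \<longrightarrow> (\<exists>\<theta>\<in>\<Theta>. 0 \<le> (\<Sum>j<n. llr (h \<gamma>) (g \<theta>) (X j))))"
    for n B
  have "\<exists>B. version n B" for n
    by (rule R.rejection_region_measurable_version[of n]) (unfold version_def, blast)
  then obtain C where version: "\<And>n. version n (C n)"
    by metis
  have C_sets: "C n \<in> sets (iid M n)" for n
    using version[of n] by (simp add: version_def)
  have C_iff: "X \<in> rejection_region M \<Theta> \<Gamma> g h n 1 \<longleftrightarrow> X \<in> C n"
    if "X \<in> samples M n" "\<And>j. j < n \<Longrightarrow> X j \<notin> N" for n X
    using version[of n] that unfolding version_def by blast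
  have C: "\<exists>\<gamma>\<in>\<Gamma>. 0 \<le> (\<Sum>j<n. llr (g \<theta>) (h \<gamma>) (X j))"
    if "X \<in> C n" "\<And>j. j < n \<Longrightarrow> X j \<notin> N" "\<theta> \<in> \<Theta>" for n X \<theta>
    using version[of n] that unfolding version_def by blast
  have C_compl: "\<exists>\<theta>\<in>\<Theta>. 0 \<le> (\<Sum>j<n. llr (h \<gamma>) (g \<theta>) (X j))"
    if "X \<in> space (iid M n) - C n" "\<And>j. j < n \<Longrightarrow> X j \<notin> N" "\<gamma> \<in> \<Gamma>" for n X \<gamma>
    using version[of n] that unfolding version_def by blast
  have sets_iid: "sets (iid (law M f) n) = sets (iid M n)" for f n
    by (intro sets_PiM_cong) auto
  have space_iid: "space (iid (law M f) n) = samples M n" "space (iid M n) = samples M n" for f n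
    by (simp_all add: space_PiM samples_def)
  have rej_sub: "rejection_region M \<Theta> \<Gamma> g h n 1 \<subseteq> samples M n" for n
    by (auto simp: rejection_region_def)
  have prob: "prob_space (law M f)" if "f \<in> F" for f
    using dens[OF that] by (simp add: prob_density_def)
  have error1: "iid_prob M f n (rejection_region M \<Theta> \<Gamma> g h n 1) = measure (iid (law M f) n) (C n)" if "f \<in> F" for f n
    unfolding iid_prob_def using C_sets[of n] C_iff[where n = n] rej_sub[of n]
    by (intro measure_completion_iid_eq[OF prob[OF that] null[OF that]]) (auto simp: sets_iid space_iid)
  have error2: "iid_prob M f n (samples M n - rejection_region M \<Theta> \<Gamma> g h n 1) = measure (iid (law M f) n) (space (iid M n) - C n)"
    if "f \<in> F" for f n
    unfolding iid_prob_def using C_sets[of n] C_iff[where n = n]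
    by (intro measure_completion_iid_eq[OF prob[OF that] null[OF that]])
      (auto simp: sets_iid space_iid simp flip: space_iid(2))
  have mgf: "\<exists>z\<in>{0..1}. likelihood_tilting.mgf (law M (g \<theta>)) (llr (g \<theta>) (h \<gamma>)) z \<le> exp (- \<rho>)"
    if "\<theta> \<in> \<Theta>" "\<gamma> \<in> \<Gamma>" for \<theta> \<gamma>
    using R[OF that] opt(3)[OF that] unfolding \<rho>_def by (metis exp_le_cancel_iff neg_le_iff_le)
  have min: "exp (- \<rho>) \<le> likelihood_tilting.mgf (law M (g \<theta>s)) (llr (g \<theta>s) (h \<gamma>s)) z" if "0 \<le> z" "z \<le> 1" for z
    using R[OF opt(1,2)] that by (simp add: \<rho>_def)
  have swap_eq: "likelihood_tilting.mgf (law M (h \<gamma>)) (llr (h \<gamma>) (g \<theta>)) z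
      = likelihood_tilting.mgf (law M (g \<theta>)) (llr (g \<theta>) (h \<gamma>)) (1 - z)" if "\<theta> \<in> \<Theta>" "\<gamma> \<in> \<Gamma>" "0 \<le> z" "z \<le> 1" for \<theta> \<gamma> z
    using that by (intro density_pair.mgf_swap pair gF hF)
  have mgf': "\<exists>z\<in>{0..1}. likelihood_tilting.mgf (law M (h \<gamma>)) (llr (h \<gamma>) (g \<theta>)) z \<le> exp (- \<rho>)"
    if \<gamma>\<theta>: "\<gamma> \<in> \<Gamma>" "\<theta> \<in> \<Theta>" for \<gamma> \<theta>
  proof -
    obtain z where "z \<in> {0..1}" "likelihood_tilting.mgf (law M (g \<theta>)) (llr (g \<theta>) (h \<gamma>)) z \<le> exp (- \<rho>)"
      using mgf[OF \<gamma>\<theta>(2,1)] by blast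
    then show ?thesis
      using \<gamma>\<theta> by (intro bexI[of _ "1 - z"]) (auto simp: swap_eq)
  qed
  have min': "exp (- \<rho>) \<le> likelihood_tilting.mgf (law M (h \<gamma>s)) (llr (h \<gamma>s) (g \<theta>s)) z" if "0 \<le> z" "z \<le> 1" for z
    using min[of "1 - z"] that opt(1,2) by (simp add: swap_eq)
  have "(\<lambda>n. (SUP \<theta>\<in>\<Theta>. ln (measure (iid (law M (g \<theta>)) n) (C n))) / real n) \<longlonglongrightarrow> - \<rho>"
    using mgf \<rho> opt(1,2) min C_sets C C_compl by (rule R.sup_log_error_asymptotics)
  from asymp_equiv_linear[OF this \<rho>]
  have lim1: "(\<lambda>n. SUP \<theta>\<in>\<Theta>. ln (iid_prob M (g \<theta>) n (rejection_region M \<Theta> \<Gamma> g h n 1))) \<sim>[sequentially] (\<lambda>n. - real n * \<rho>)"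
    by (simp add: error1 gF cong: SUP_cong_simp)
  have "(\<lambda>n. (SUP \<gamma>\<in>\<Gamma>. ln (measure (iid (law M (h \<gamma>)) n) (space (iid M n) - C n))) / real n) \<longlonglongrightarrow> - \<rho>"
  \<comment> \<open>With the families exchanged, the acceptance regions play the part of the
    rejection regions.\<close>
  proof (rule R.swap.sup_log_error_asymptotics[OF mgf' \<rho> opt(2,1) min'])
    show "space (iid M n) - C n \<in> sets (iid M n)" for n
      using C_sets[of n] by auto
    show "\<exists>\<gamma>\<in>\<Gamma>. 0 \<le> (\<Sum>j<n. llr (g \<theta>) (h \<gamma>) (X j))"
      if "X \<in> space (iid M n) - (space (iid M n) - C n)" "\<And>j. j < n \<Longrightarrow> X j \<notin> N" "\<theta> \<in> \<Theta>" for n X \<theta>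
      using that by (intro C[of X n]) auto
  qed (rule C_compl | assumption)+
  from asymp_equiv_linear[OF this \<rho>]
  have lim2: "(\<lambda>n. SUP \<gamma>\<in>\<Gamma>. ln (iid_prob M (h \<gamma>) n (samples M n - rejection_region M \<Theta> \<Gamma> g h n 1))) \<sim>[sequentially] (\<lambda>n. - real n * \<rho>)"
    by (simp add: error2 hF cong: SUP_cong_simp)
  show ?thesis
    unfolding INF_eq using asymp_equiv_trans[OF lim1] lim2 asymp_equiv_sym by blast
qed

end
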